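(* For every $\epsilon$ with $0 < \epsilon \le \frac{1}{2}$ there exists $p_0(\epsilon)$ such that for every prime $p > p_0(\epsilon)$, \[ \#\{\text{primes } q < p^{\frac{1}{2}+\epsilon} : q \text{ is a quadratic residue modulo } p\} > p^{\frac{1}{25}\epsilon}. \]
   Context: An integer $a$ is a quadratic residue modulo the prime $p$ if $a \equiv y^2 \pmod{p}$ for some integer $y$ with $p \nmid y$. *)

theory Defs
  imports "HOL-Number_Theory.Number_Theory"
begin

definition quad_residue :: "int \<Rightarrow> int \<Rightarrow> bool" where
  "quad_residue a p \<longleftrightarrow> (\<exists>y::int. [a = y^2] (mod p) \<and> \<not> p dvd y)"

end

theory Submission
  imports Defs "HOL-Analysis.Analysis" "HOL-Real_Asymp.Real_Asymp"
begin

text \<open>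
  Put \<open>D = p\<close> or \<open>D = -p\<close>, whichever is 1 modulo 4. By reciprocity every odd prime factor, other than
  \<open>p\<close>, of a value of a polynomial \<open>a n\<^sup>2 + b n + c\<close> of discriminant \<open>D\<close> is a quadratic residue modulo \<open>p\<close>.
  If the values for \<open>n \<le> K\<close> all lie between about \<open>p powr (7/16)\<close> and \<open>p powr (1/2 + \<epsilon>)\<close>,
  and \<open>K\<close> is a small power of \<open>p\<close>, then few primes cannot account for their product, since a prime power
  \<open>q ^ j\<close> divides at most \<open>2 (K / q ^ j + 1)\<close> of them.

  For \<open>p\<close> congruent to 1 modulo 4 such values occur just above the larger root of the principal form.
  For \<open>p\<close> congruent to 3 modulo 4 one needs a form whose leading coefficient is close to \<open>sqrt p\<close>, i.e. an
  integer near \<open>sqrt p\<close> composed of split primes. If there is none, then \<open>(\<Sum>d | d dvd n. \<chi> d)\<close>, summed over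
  \<open>n \<le> p powr (1/2 + \<delta>)\<close>, is too small for its main term \<open>L(1, \<chi>) p powr (1/2 + \<delta>)\<close>: the error term is
  controlled by the Polya-Vinogradov inequality, and the main term is large by Siegel's theorem, which is where
  the result becomes ineffective. Siegel's theorem is proved by the hyperbola method applied to the non-negative
  coefficients of \<open>\<zeta>(s) L(s, \<chi>\<^sub>1) L(s, \<chi>) L(s, \<chi>\<^sub>1 \<chi>)\<close> at a real zero of \<open>L(s, \<chi>\<^sub>1)\<close>.
\<close>

section \<open>Dirichlet convolution\<close>

text \<open>For \<open>p\<close> congruent to 3 modulo 4 the forms are definite: the values of
  \<open>a n^2 + b n + c\<close> are at least \<open>p / (4 a)\<close> and grow like
  \<open>a n^2\<close>. Small \<open>a\<close> makes the values too large from the start, and large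
  \<open>a\<close> makes them grow too large, so \<open>a\<close> is sought within a factor
  \<open>p powr (\<epsilon>/8)\<close> of \<open>sqrt p\<close>. With about
  \<open>p powr (3 \<epsilon>/8)\<close> values of \<open>n\<close> the values then stay below
  roughly \<open>p powr (1/2 + 7 \<epsilon>/8)\<close>, which leaves
  \<open>p powr (\<epsilon>/8)\<close> to absorb constants. From below, \<open>p / (4 a)\<close> is
  at least \<open>p powr (1/2 - \<epsilon>/8) / 4\<close>, and \<open>1/2 - \<epsilon>/8\<close> is
  at least 7/16 because \<open>\<epsilon> \<le> 1/2\<close>.

  The search for \<open>a\<close> takes place at length \<open>x = p powr (1/2 + \<delta>)\<close>,
  which is below \<open>p\<close>. The hyperbola method has error about \<open>sqrt (x B)\<close>,
  where \<open>B\<close> bounds the character sums. The trivial \<open>B = p\<close> would make this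
  exceed \<open>x\<close>; the Polya-Vinogradov bound, about \<open>sqrt p\<close> up to a
  logarithm, leaves a power of \<open>p\<close> to spare, and Siegel's theorem ensures that
  \<open>L(1, \<chi>)\<close> does not use it up. Inside the proof of Siegel's theorem the lengths
  are large powers of \<open>p\<close>, and there the trivial bound suffices.\<close>

definition dconv :: "(nat \<Rightarrow> real) \<Rightarrow> (nat \<Rightarrow> real) \<Rightarrow> nat \<Rightarrow> real" where
  "dconv u v n = (\<Sum>d | d dvd n. u d * v (n div d))"

definition multiplicative :: "(nat \<Rightarrow> real) \<Rightarrow> bool" where
  "multiplicative u \<longleftrightarrow> u 1 = 1 \<and> (\<forall>a b. a > 0 \<longrightarrow> b > 0 \<longrightarrow> coprime a b \<longrightarrow> u (a * b) = u a * u b)"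

definition real_char :: "(nat \<Rightarrow> real) \<Rightarrow> bool" where
  "real_char f \<longleftrightarrow> f 1 = 1 \<and> (\<forall>m n. f (m * n) = f m * f n) \<and> (\<forall>n. f n \<in> {-1, 0, 1})"

lemma prime_power_coprime_induct [consumes 1, case_names one step]:
  fixes n :: nat
  assumes "n > 0" and one: "P 1"
    and step: "\<And>q k n. prime q \<Longrightarrow> k > 0 \<Longrightarrow> \<not> q dvd n \<Longrightarrow> n > 0 \<Longrightarrow> P n \<Longrightarrow> P (q ^ k * n)"
  shows "P n"
  using assms(1)
proof (induction n rule: less_induct)
  case (less n)
  show ?case
  proof (cases "n = 1")
    case True
    then show ?thesis using one by simp
  next
    case False
    then obtain q where q: "prime q" "q dvd n" using prime_factor_nat by blast
    obtain m where m: "n = q ^ multiplicity q n * m" "\<not> q dvd m"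
      using multiplicity_decompose'[of n q] less.prems q(1) by (metis not_prime_unit not_less_iff_gr_or_eq)
    have k: "multiplicity q n > 0"
      using q less.prems by (simp add: prime_multiplicity_gt_zero_iff)
    have "m > 0" using m less.prems by (metis gr0I mult_0_right)
    have "q ^ multiplicity q n > 1" using k q(1) prime_gt_1_nat one_less_power by blast
    hence "1 * m < q ^ multiplicity q n * m" using \<open>m > 0\<close> by (intro mult_strict_right_mono)
    hence "m < n" using m(1) by simp
    from step[OF q(1) k m(2) \<open>m > 0\<close> less.IH[OF this \<open>m > 0\<close>]] m(1) show ?thesis by simp
  qed
qed

lemma bij_betw_divisors_mult:
  fixes a b :: nat
  assumes "a > 0" "b > 0" "coprime a b"
  shows "bij_betw (\<lambda>(d, e). d * e) ({d. d dvd a} \<times> {e. e dvd b}) {d. d dvd a * b}"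
  unfolding bij_betw_def
proof
  show "inj_on (\<lambda>(d, e). d * e) ({d. d dvd a} \<times> {e. e dvd b})"
  proof (rule inj_onI, clarify)
    fix d e d' e' assume *: "d dvd a" "e dvd b" "d' dvd a" "e' dvd b" "d * e = d' * e'"
    \<comment> \<open>Coprimality lets \<open>d\<close> be read off from the product as
      \<open>gcd (d * e) a\<close>, which gives injectivity.\<close>
    have g: "gcd (x * y) a = x" if "x dvd a" "y dvd b" for x y
    proof -
      have "coprime y a" using assms(3) that(2) by (meson coprime_commute coprime_divisors dvd_refl)
      thus ?thesis using that(1) by (simp add: gcd_mult_right_right_cancel gcd_nat.absorb1 gcd_mult_left_right_cancel coprime_commute)
    qed
    have "d = d'" using g[of d e] g[of d' e'] * by metis
    moreover have "d > 0" using * assms by (metis dvd_0_left gr0I less_numeral_extra(3))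
    ultimately show "d = d' \<and> e = e'" using * by simp
  qed
  show "(\<lambda>(d, e). d * e) ` ({d. d dvd a} \<times> {e. e dvd b}) = {d. d dvd a * b}"
    by (auto simp: mult_dvd_mono image_iff) (metis division_decomp)
qed

lemma multiplicative_dconv:
  assumes u: "multiplicative u" and v: "multiplicative v"
  shows "multiplicative (dconv u v)"
  unfolding multiplicative_def
proof (intro conjI allI impI)
  show "dconv u v 1 = 1" using u v by (simp add: dconv_def multiplicative_def)
  fix a b :: nat assume ab: "a > 0" "b > 0" "coprime a b"
  have "dconv u v (a * b) = (\<Sum>(d, e) \<in> {d. d dvd a} \<times> {e. e dvd b}. u (d * e) * v (a * b div (d * e)))"
    unfolding dconv_def
    by (subst sum.reindex_bij_betw[OF bij_betw_divisors_mult[OF ab], symmetric]) (simp add: case_prod_beta)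
  also have "\<dots> = (\<Sum>(d, e) \<in> {d. d dvd a} \<times> {e. e dvd b}. (u d * v (a div d)) * (u e * v (b div e)))"
  proof (rule sum.cong, simp, clarify)
    fix d e assume de: "d dvd a" "e dvd b"
    have c1: "coprime d e" using ab(3) de by (meson coprime_divisors)
    have c2: "coprime (a div d) (b div e)"
      using ab(3) de by (metis coprime_divisors dvd_div_mult_self dvd_triv_left)
    have pos: "d > 0" "e > 0" using ab de by (auto intro: dvd_pos_nat)
    have pos2: "a div d > 0" "b div e > 0" using ab de by (auto simp: dvd_div_eq_0_iff)
    have "a * b div (d * e) = (a div d) * (b div e)" using de by (simp add: div_mult_div_if_dvd)
    thus "u (d * e) * v (a * b div (d * e)) = (u d * v (a div d)) * (u e * v (b div e))"
      using u v c1 c2 pos pos2 unfolding multiplicative_def by simp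
  qed
  also have "\<dots> = dconv u v a * dconv u v b"
    unfolding dconv_def by (simp add: sum_product sum.cartesian_product)
  finally show "dconv u v (a * b) = dconv u v a * dconv u v b" .
qed

lemma dconv_prime_power:
  assumes "prime q"
  shows "dconv u v (q ^ k) = (\<Sum>i\<le>k. u (q ^ i) * v (q ^ (k - i)))"
proof -
  have "{d. d dvd q ^ k} = (\<lambda>i. q ^ i) ` {..k}"
    using assms by (auto simp: divides_primepow_nat le_imp_power_dvd)
  moreover have "inj_on (\<lambda>i. q ^ i) {..k}"
    using assms prime_gt_1_nat by (auto intro!: inj_onI dest: power_inject_exp)
  ultimately have "dconv u v (q ^ k) = (\<Sum>i\<le>k. u (q ^ i) * v (q ^ k div q ^ i))"
    unfolding dconv_def by (simp add: sum.reindex)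
  also have "\<dots> = (\<Sum>i\<le>k. u (q ^ i) * v (q ^ (k - i)))"
    using assms prime_gt_0_nat by (intro sum.cong) (auto simp: power_diff)
  finally show ?thesis .
qed

lemma real_char_multiplicative: "real_char f \<Longrightarrow> multiplicative f"
  by (auto simp: real_char_def multiplicative_def)

lemma real_char_power: "real_char f \<Longrightarrow> f (q ^ k) = f q ^ k"
  by (induction k) (auto simp: real_char_def simp flip: One_nat_def)

lemma real_char_abs_le: "real_char f \<Longrightarrow> \<bar>f n\<bar> \<le> 1"
  by (auto simp: real_char_def dest!: spec[where x = n])

lemma real_char_one: "real_char (\<lambda>_. 1)"
  by (auto simp: real_char_def)

lemma real_char_mult:
  assumes "real_char f" "real_char g"
  shows "real_char (\<lambda>n. f n * g n)"
  unfolding real_char_def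
proof (intro conjI allI)
  fix m n
  show "f 1 * g 1 = 1" using assms by (simp add: real_char_def)
  show "f (m * n) * g (m * n) = f m * g m * (f n * g n)" using assms by (simp add: real_char_def)
  have "f n \<in> {-1, 0, 1}" "g n \<in> {-1, 0, 1}" using assms unfolding real_char_def by blast+
  thus "f n * g n \<in> {-1, 0, 1}" by auto
qed

lemma real_char_cases: "real_char f \<Longrightarrow> f n = -1 \<or> f n = 0 \<or> f n = 1"
  by (auto simp: real_char_def)

lemma multiplicative_mult: "multiplicative f \<Longrightarrow> multiplicative g \<Longrightarrow> multiplicative (\<lambda>n. f n * g n)"
  by (auto simp: multiplicative_def)

lemma multiplicative_nonneg:
  assumes u: "multiplicative u" and n: "n > 0"
    and pp: "\<And>q k. prime q \<Longrightarrow> u (q ^ k) \<ge> 0"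
  shows "u n \<ge> 0"
  using n
proof (induction n rule: prime_power_coprime_induct)
  case one
  then show ?case using u by (simp add: multiplicative_def)
next
  case (step q k n)
  have "coprime (q ^ k) n" using step prime_imp_coprime by (metis coprime_power_left_iff)
  hence "u (q ^ k * n) = u (q ^ k) * u n"
    using u step prime_gt_0_nat by (auto simp: multiplicative_def)
  then show ?case using pp[OF step(1)] step by simp
qed

section \<open>Divisor sums of real characters\<close>

text \<open>These are the coefficients of \<zeta>(s) L(s, f). For the constant function 1 this is
  the number of divisors; for \<open>chi p\<close> it is the number of ideals of norm
  \<open>n\<close> in the quadratic field of discriminant \<open>D\<close>.\<close>

abbreviation rho :: "(nat \<Rightarrow> real) \<Rightarrow> nat \<Rightarrow> real" where
  "rho f \<equiv> dconv (\<lambda>_. 1) f"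

lemma rho_prime_power:
  assumes "real_char f" "prime q"
  shows "rho f (q ^ k) = (\<Sum>i\<le>k. f q ^ i)"
proof -
  have "(\<Sum>i\<le>k. f q ^ (k - i)) = (\<Sum>i\<le>k. f q ^ i)"
    by (rule sum.reindex_bij_witness[of _ "\<lambda>i. k - i" "\<lambda>i. k - i"]) auto
  thus ?thesis using assms by (simp add: dconv_prime_power real_char_power)
qed

lemma rho_prime_power_1: "real_char f \<Longrightarrow> prime q \<Longrightarrow> f q = 1 \<Longrightarrow> rho f (q ^ k) = real k + 1"
  by (simp add: rho_prime_power)

lemma rho_prime_power_0: "real_char f \<Longrightarrow> prime q \<Longrightarrow> f q = 0 \<Longrightarrow> rho f (q ^ k) = 1"
  by (simp add: rho_prime_power power_0_left)

lemma rho_prime_power_m1: "real_char f \<Longrightarrow> prime q \<Longrightarrow> f q = -1 \<Longrightarrow> rho f (q ^ k) = (if even k then 1 else 0)"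
  by (subst rho_prime_power; (simp; fail)?) (induction k; simp)

lemma multiplicative_rho: "real_char f \<Longrightarrow> multiplicative (rho f)"
  by (intro multiplicative_dconv real_char_multiplicative real_char_one)

lemma rho_prime_power_nonneg: "real_char f \<Longrightarrow> prime q \<Longrightarrow> rho f (q ^ k) \<ge> 0"
  using real_char_cases[of f q] rho_prime_power_1[of f q k] rho_prime_power_0[of f q k] rho_prime_power_m1[of f q k]
  by auto

lemma rho_nonneg: "real_char f \<Longrightarrow> n > 0 \<Longrightarrow> rho f n \<ge> 0"
  using multiplicative_nonneg[OF multiplicative_rho] rho_prime_power_nonneg by blast

text \<open>The sum is the coefficient of \<open>x ^ k\<close> in
  \<open>(1 + x)^(-2) * (1 - x)^(-2) = (1 - x^2)^(-2)\<close>.\<close>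

lemma alternating_quadratic_sum:
  "(\<Sum>i\<le>k. (-1) ^ i * (real i + 1) * (real (k - i) + 1)) = (if even k then real k / 2 + 1 else 0)"
proof (induction k)
  case 0
  then show ?case by simp
next
  case (Suc k)
  have a: "(\<Sum>i\<le>k. (-1) ^ i * (real i + 1)) = (if even k then real k / 2 + 1 else - (real k + 1) / 2)" for k
    by (induction k) (auto simp: field_simps)
  have "(\<Sum>i\<le>Suc k. (-1) ^ i * (real i + 1) * (real (Suc k - i) + 1))
      = (\<Sum>i\<le>k. (-1) ^ i * (real i + 1) * (real (k - i) + 1) + (-1) ^ i * (real i + 1)) + (-1) ^ Suc k * (real (Suc k) + 1)"
    by (simp add: algebra_simps Suc_diff_le sum.distrib)
  also have "\<dots> = (if even (Suc k) then real (Suc k) / 2 + 1 else 0)"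
    unfolding sum.distrib Suc.IH a by (auto simp: field_simps)
  finally show ?case .
qed

text \<open>These are the coefficients of \<zeta>(s) L(s, f) L(s, h) L(s, f h). At a prime with
  \<open>h q = -1\<close> the Euler factor is \<open>1 / (1 - x^2)\<close> if \<open>f q = 0\<close>
  and its square otherwise, with \<open>x = q powr -s\<close>; if \<open>h q\<close> is 0 or 1,
  every summand of the convolution is already non-negative.\<close>

lemma dconv_rho_nonneg:
  assumes f: "real_char f" and h: "real_char h" and n: "n > 0"
  shows "dconv (rho f) (\<lambda>m. h m * rho f m) n \<ge> 0"
proof (rule multiplicative_nonneg[OF _ n])
  show "multiplicative (dconv (rho f) (\<lambda>m. h m * rho f m))"
    by (intro multiplicative_dconv multiplicative_mult multiplicative_rho f real_char_multiplicative h)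
next
  fix q k :: nat assume q: "prime q"
  have eq: "dconv (rho f) (\<lambda>m. h m * rho f m) (q ^ k)
     = (\<Sum>i\<le>k. rho f (q ^ i) * (h q ^ (k - i) * rho f (q ^ (k - i))))"
    using q h by (simp add: dconv_prime_power[OF q, of "rho f"] real_char_power)
  consider "h q = 1" | "h q = 0" | "h q = -1" "f q = 0" | "h q = -1" "f q = 1" | "h q = -1" "f q = -1"
    using real_char_cases[OF h, of q] real_char_cases[OF f, of q] by blast
  then show "dconv (rho f) (\<lambda>m. h m * rho f m) (q ^ k) \<ge> 0"
  proof cases
    case 1
    then show ?thesis unfolding eq
      by (intro sum_nonneg) (simp add: rho_prime_power_nonneg f q)
  next
    case 2
    then show ?thesis unfolding eq
      by (intro sum_nonneg mult_nonneg_nonneg) (simp_all add: rho_prime_power_nonneg f q)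
  next
    case 3
    have "(\<Sum>i\<le>k. (-1::real) ^ (k - i)) = (\<Sum>i\<le>k. (-1) ^ i)"
      by (rule sum.reindex_bij_witness[of _ "\<lambda>i. k - i" "\<lambda>i. k - i"]) auto
    also have "\<dots> \<ge> 0" by (induction k rule: nat_induct2) auto
    finally show ?thesis unfolding eq using 3 by (simp add: rho_prime_power_0 f q)
  next
    case 4
    have "(\<Sum>i\<le>k. (real i + 1) * ((- 1) ^ (k - i) * (real (k - i) + 1)))
       = (\<Sum>i\<le>k. (real (k - i) + 1) * ((- 1) ^ i * (real i + 1)))"
      by (rule sum.reindex_bij_witness[of _ "\<lambda>i. k - i" "\<lambda>i. k - i"]) auto
    also have "\<dots> = (\<Sum>i\<le>k. (-1) ^ i * (real i + 1) * (real (k - i) + 1))"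
      by (simp add: mult_ac)
    also have "\<dots> \<ge> 0" by (subst alternating_quadratic_sum) auto
    finally show ?thesis unfolding eq using 4 by (simp add: rho_prime_power_1 f q)
  next
    case 5
    \<comment> \<open>\<open>rho f (q ^ i)\<close> vanishes for odd \<open>i\<close>, so in every
      surviving term \<open>k - i\<close> is even and \<open>h q ^ (k - i)\<close> is 1.\<close>
    then show ?thesis unfolding eq
      by (intro sum_nonneg) (auto simp: rho_prime_power_m1 f q)
  qed
qed

section \<open>Hyperbola method and partial summation\<close>

text \<open>A real bound allows summation up to \<open>x / real m\<close> in the hyperbola method
  without writing floors.\<close>

definition upto_real :: "real \<Rightarrow> nat set" where
  "upto_real x = {k. 0 < k \<and> real k \<le> x}"

abbreviation psum :: "(nat \<Rightarrow> real) \<Rightarrow> real \<Rightarrow> real" where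
  "psum f x \<equiv> \<Sum>k\<in>upto_real x. f k"

abbreviation wt :: "(nat \<Rightarrow> real) \<Rightarrow> real \<Rightarrow> nat \<Rightarrow> real" where
  "wt f s \<equiv> \<lambda>k. f k * real k powr - s"

lemma upto_real_eq: "upto_real x = {1..nat \<lfloor>x\<rfloor>}"
proof -
  have "real k \<le> x \<longleftrightarrow> k \<le> nat \<lfloor>x\<rfloor>" if "k > 0" for k
  proof -
    have "real k \<le> x \<longleftrightarrow> int k \<le> \<lfloor>x\<rfloor>" by (simp add: le_floor_iff)
    also have "\<dots> \<longleftrightarrow> k \<le> nat \<lfloor>x\<rfloor>" using that by arith
    finally show ?thesis .
  qed
  thus ?thesis by (auto simp: upto_real_def)
qed

lemma finite_upto_real [simp]: "finite (upto_real x)"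
  by (simp add: upto_real_eq)

lemma upto_real_mono: "x \<le> y \<Longrightarrow> upto_real x \<subseteq> upto_real y"
  by (auto simp: upto_real_def)

lemma upto_real_of_nat: "upto_real (real n) = {1..n}"
  by (simp add: upto_real_eq)

lemma card_upto_real_le: "x \<ge> 0 \<Longrightarrow> real (card (upto_real x)) \<le> x"
  by (simp add: upto_real_eq)

lemma psum_dconv:
  "psum (dconv u v) x = (\<Sum>(k, m) | 0 < k \<and> 0 < m \<and> real k * real m \<le> x. u k * v m)"
proof -
  have "psum (dconv u v) x = (\<Sum>(n, d) \<in> Sigma (upto_real x) (\<lambda>n. {d. d dvd n}). u d * v (n div d))"
    unfolding dconv_def by (rule sum.Sigma) (simp, auto simp: upto_real_def)
  also have "\<dots> = (\<Sum>(k, m) | 0 < k \<and> 0 < m \<and> real k * real m \<le> x. u k * v m)"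
    by (rule sum.reindex_bij_witness[of _ "\<lambda>(k, m). (k * m, k)" "\<lambda>(n, d). (d, n div d)"])
      (auto simp: upto_real_def dvd_div_eq_0_iff dvd_pos_nat simp flip: of_nat_mult)
  finally show ?thesis .
qed

text \<open>The pairs with \<open>k * m \<le> x\<close> are split by \<open>m \<le> y\<close> or
  \<open>m > y\<close>; in the second case \<open>k < x / y\<close>. Writing the second part with a
  difference of partial sums of \<open>v\<close>, instead of the symmetric formula with a product
  term, lets a bound on the tails of \<open>v\<close> be applied directly.\<close>

lemma hyperbola:
  assumes "0 < y" "y \<le> x"
  shows "psum (dconv u v) x = (\<Sum>m\<in>upto_real y. v m * psum u (x / real m))
     + (\<Sum>k\<in>upto_real (x / y). u k * (psum v (x / real k) - psum v y))"
proof -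
  let ?P = "{(k, m). 0 < k \<and> 0 < m \<and> real k * real m \<le> x}"
  let ?P1 = "Sigma (upto_real y) (\<lambda>m. upto_real (x / real m))"
  let ?P2 = "Sigma (upto_real (x / y)) (\<lambda>k. upto_real (x / real k) - upto_real y)"
  have P: "?P = (\<lambda>(m, k). (k, m)) ` ?P1 \<union> ?P2"
  proof (intro equalityI subsetI)
    fix z assume z: "z \<in> ?P"
    then obtain k m where km: "z = (k, m)" "0 < k" "0 < m" "real k * real m \<le> x" by auto
    show "z \<in> (\<lambda>(m, k). (k, m)) ` ?P1 \<union> ?P2"
    proof (cases "real m \<le> y")
      case True
      hence "(m, k) \<in> ?P1" using km by (auto simp: upto_real_def field_simps)
      thus ?thesis using km(1) by force
    next
      case False
      hence "real k * y \<le> real k * real m" using km by (intro mult_left_mono) auto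
      hence "real k * y \<le> x" using km by linarith
      hence "real k \<le> x / y" using assms by (simp add: pos_le_divide_eq)
      moreover have "real m \<le> x / real k" using km by (simp add: field_simps)
      ultimately have "(k, m) \<in> ?P2" using km False by (auto simp: upto_real_def)
      thus ?thesis using km(1) by blast
    qed
  next
    fix z assume "z \<in> (\<lambda>(m, k). (k, m)) ` ?P1 \<union> ?P2"
    thus "z \<in> ?P" by (auto simp: upto_real_def field_simps)
  qed
  have disj: "(\<lambda>(m, k). (k, m)) ` ?P1 \<inter> ?P2 = {}" by (auto simp: upto_real_def)
  have "psum (dconv u v) x = (\<Sum>(k, m) \<in> ?P. u k * v m)"
    by (simp add: psum_dconv)
  also have "\<dots> = (\<Sum>(k, m) \<in> (\<lambda>(m, k). (k, m)) ` ?P1. u k * v m) + (\<Sum>(k, m) \<in> ?P2. u k * v m)"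
    unfolding P by (rule sum.union_disjoint[OF _ _ disj]) auto
  also have "(\<Sum>(k, m) \<in> (\<lambda>(m, k). (k, m)) ` ?P1. u k * v m) = (\<Sum>(m, k) \<in> ?P1. v m * u k)"
    by (subst sum.reindex) (auto simp: inj_on_def case_prod_beta mult.commute)
  also have "\<dots> = (\<Sum>m\<in>upto_real y. v m * psum u (x / real m))"
    by (subst sum.Sigma[symmetric]) (auto simp: sum_distrib_left)
  also have "(\<Sum>(k, m) \<in> ?P2. u k * v m)
     = (\<Sum>k\<in>upto_real (x / y). u k * (\<Sum>m\<in>upto_real (x / real k) - upto_real y. v m))"
    by (subst sum.Sigma[symmetric]) (auto simp: sum_distrib_left)
  also have "\<dots> = (\<Sum>k\<in>upto_real (x / y). u k * (psum v (x / real k) - psum v y))"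
  proof (rule sum.cong[OF refl])
    fix k assume k: "k \<in> upto_real (x / y)"
    hence "y \<le> x / real k" using assms by (auto simp: upto_real_def field_simps)
    thus "u k * (\<Sum>m\<in>upto_real (x / real k) - upto_real y. v m) = u k * (psum v (x / real k) - psum v y)"
      by (subst sum_diff) (auto dest: upto_real_mono)
  qed
  finally show ?thesis .
qed

text \<open>The two factors enter asymmetrically: \<open>u\<close> has partial sums with a known
  main term \<open>M\<close>, while of \<open>v\<close> only the smallness of its tails is
  known.\<close>

lemma hyperbola_bound:
  assumes y: "0 < y" "y \<le> x"
    and U: "\<And>t. t \<ge> 1 \<Longrightarrow> \<bar>psum u t - M t\<bar> \<le> e t"
    and V: "\<And>t. t \<ge> y \<Longrightarrow> \<bar>psum v t - psum v y\<bar> \<le> T"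
  shows "\<bar>psum (dconv u v) x - (\<Sum>m\<in>upto_real y. v m * M (x / real m))\<bar>
     \<le> (\<Sum>m\<in>upto_real y. \<bar>v m\<bar> * e (x / real m)) + psum (\<lambda>k. \<bar>u k\<bar>) (x / y) * T"
proof -
  have eq: "psum (dconv u v) x - (\<Sum>m\<in>upto_real y. v m * M (x / real m))
     = (\<Sum>m\<in>upto_real y. v m * (psum u (x / real m) - M (x / real m)))
     + (\<Sum>k\<in>upto_real (x / y). u k * (psum v (x / real k) - psum v y))"
    by (simp add: hyperbola[OF y] right_diff_distrib sum_subtractf)
  have "\<bar>psum (dconv u v) x - (\<Sum>m\<in>upto_real y. v m * M (x / real m))\<bar>
     \<le> \<bar>\<Sum>m\<in>upto_real y. v m * (psum u (x / real m) - M (x / real m))\<bar>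
     + \<bar>\<Sum>k\<in>upto_real (x / y). u k * (psum v (x / real k) - psum v y)\<bar>"
    unfolding eq by (rule abs_triangle_ineq)
  also have "\<bar>\<Sum>m\<in>upto_real y. v m * (psum u (x / real m) - M (x / real m))\<bar>
     \<le> (\<Sum>m\<in>upto_real y. \<bar>v m\<bar> * e (x / real m))"
  proof (intro order.trans[OF sum_abs] sum_mono)
    fix m assume "m \<in> upto_real y"
    hence "0 < real m" "real m \<le> x" using y by (simp_all add: upto_real_def)
    hence "x / real m \<ge> 1" by simp
    thus "\<bar>v m * (psum u (x / real m) - M (x / real m))\<bar> \<le> \<bar>v m\<bar> * e (x / real m)"
      unfolding abs_mult by (intro mult_left_mono U) auto
  qed
  also have "\<bar>\<Sum>k\<in>upto_real (x / y). u k * (psum v (x / real k) - psum v y)\<bar>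
      \<le> (\<Sum>k\<in>upto_real (x / y). \<bar>u k\<bar> * T)"
  proof (intro order.trans[OF sum_abs] sum_mono)
    fix k assume "k \<in> upto_real (x / y)"
    hence "0 < real k" "real k \<le> x / y" by (simp_all add: upto_real_def)
    hence "x / real k \<ge> y" using y by (simp add: field_simps)
    thus "\<bar>u k * (psum v (x / real k) - psum v y)\<bar> \<le> \<bar>u k\<bar> * T"
      unfolding abs_mult by (intro mult_left_mono V) auto
  qed
  finally show ?thesis by (simp add: sum_distrib_right)
qed

section \<open>Partial sums of powers and summation by parts\<close>

lemma powr_diff_bounds:
  fixes s a :: real
  assumes "0 < s" "s < 1" "0 < a"
  shows "(a + 1) powr - s \<le> ((a + 1) powr (1 - s) - a powr (1 - s)) / (1 - s)"
    and "((a + 1) powr (1 - s) - a powr (1 - s)) / (1 - s) \<le> a powr - s"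
proof -
  have "\<exists>z. z > a \<and> z < a + 1 \<and> (a + 1) powr (1 - s) - a powr (1 - s)
      = (a + 1 - a) * ((1 - s) * z powr (1 - s - 1))"
    using assms
    by (intro MVT2[where f = "\<lambda>x. x powr (1 - s)" and f' = "\<lambda>z. (1 - s) * z powr (1 - s - 1)"])
      (auto intro!: derivative_eq_intros)
  then obtain z where z: "z > a" "z < a + 1"
     "(a + 1) powr (1 - s) - a powr (1 - s) = (1 - s) * z powr - s" by auto
  have eq: "((a + 1) powr (1 - s) - a powr (1 - s)) / (1 - s) = z powr - s"
    using z assms by simp
  show "(a + 1) powr - s \<le> ((a + 1) powr (1 - s) - a powr (1 - s)) / (1 - s)"
    unfolding eq using z assms by (intro powr_mono2') auto
  show "((a + 1) powr (1 - s) - a powr (1 - s)) / (1 - s) \<le> a powr - s"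
    unfolding eq using z assms by (intro powr_mono2') auto
qed

text \<open>The constant is \<zeta>(s). Comparing the sum with the integral up to its last index or
  up to the next one gives a decreasing sequence \<open>a\<close> and an increasing sequence
  \<open>b\<close> with the same limit. The limit is at most \<open>a 0 = 1 - 1 / (1 - s)\<close>,
  hence negative; this sign is what the lower bound for L(1, f) exploits.\<close>

lemma zeta_partial_sums:
  fixes s :: real
  assumes s: "0 < s" "s < 1"
  shows "\<exists>z < 0. \<forall>t \<ge> 1. \<bar>psum (\<lambda>k. real k powr - s) t - t powr (1 - s) / (1 - s) - z\<bar> \<le> 2 * t powr - s"
proof -
  define Z where "Z = (\<lambda>n. \<Sum>k=1..n. real k powr - s)"
  define a where "a = (\<lambda>n. Z (Suc n) - real (Suc n) powr (1 - s) / (1 - s))"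
  define b where "b = (\<lambda>n. Z (Suc n) - (real (Suc n) + 1) powr (1 - s) / (1 - s))"
  have Zs: "Z (Suc n) = Z n + real (Suc n) powr - s" for n by (simp add: Z_def)
  have a: "decseq a"
  proof (rule decseq_SucI)
    fix n
    have "real (Suc (Suc n)) powr - s \<le> (real (Suc (Suc n)) powr (1 - s) - real (Suc n) powr (1 - s)) / (1 - s)"
      using powr_diff_bounds(1)[OF s, of "real (Suc n)"] by (simp add: add_ac)
    thus "a (Suc n) \<le> a n" using s unfolding a_def Zs[of "Suc n"] diff_divide_distrib by linarith
  qed
  have b: "incseq b"
  proof (rule incseq_SucI)
    fix n
    have "((real (Suc (Suc n)) + 1) powr (1 - s) - real (Suc (Suc n)) powr (1 - s)) / (1 - s) \<le> real (Suc (Suc n)) powr - s"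
      using powr_diff_bounds(2)[OF s, of "real (Suc (Suc n))"] by (simp add: add_ac)
    moreover have "real (Suc n) + 1 = real (Suc (Suc n))" by simp
    ultimately show "b n \<le> b (Suc n)" using s unfolding b_def Zs[of "Suc n"] diff_divide_distrib by simp
  qed
  have ba: "b n \<le> a n" "a n - b n \<le> real (Suc n) powr - s" for n
    using powr_diff_bounds[OF s, of "real (Suc n)"] s powr_ge_zero[of "real (Suc n) + 1" "-s"]
    unfolding a_def b_def diff_divide_distrib by linarith+
  have "b 0 \<le> a n" for n
    using ba(1)[of n] incseqD[OF b, of 0 n] by simp
  then obtain z where z: "a \<longlonglongrightarrow> z" "\<And>n. z \<le> a n"
    using decseq_convergent[OF a] by metis
  have "(\<lambda>n. real (Suc n) powr - s) \<longlonglongrightarrow> 0" using s by real_asymp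
  moreover have "\<forall>\<^sub>F n in sequentially. 0 \<le> a n - b n"
    by (rule always_eventually) (use ba(1) in simp)
  moreover have "\<forall>\<^sub>F n in sequentially. a n - b n \<le> real (Suc n) powr - s"
    by (rule always_eventually) (use ba(2) in blast)
  ultimately have "(\<lambda>n. a n - b n) \<longlonglongrightarrow> 0"
    by (intro tendsto_sandwich[of "\<lambda>_. 0" "\<lambda>n. a n - b n" sequentially "\<lambda>n. real (Suc n) powr - s"]) simp_all
  hence "(\<lambda>n. a n - (a n - b n)) \<longlonglongrightarrow> z - 0" by (intro tendsto_diff z)
  hence "b \<longlonglongrightarrow> z" by simp
  hence zb: "b n \<le> z" for n using b incseq_le by blast
  have "a 0 = 1 - 1 / (1 - s)" by (simp add: a_def Z_def)
  also have "\<dots> < 0" using s by (simp add: field_simps)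
  finally have "z < 0" using z(2)[of 0] by linarith
  moreover have "\<bar>psum (\<lambda>k. real k powr - s) t - t powr (1 - s) / (1 - s) - z\<bar> \<le> 2 * t powr - s" if t: "t \<ge> 1" for t
  proof -
    define n where "n = nat \<lfloor>t\<rfloor> - 1"
    have n: "real (Suc n) \<le> t" "t \<le> real (Suc n) + 1" "nat \<lfloor>t\<rfloor> = Suc n"
      unfolding n_def using t by linarith+
    have ps: "psum (\<lambda>k. real k powr - s) t = Z (Suc n)" by (simp add: upto_real_eq n Z_def)
    have "real (Suc n) powr (1 - s) / (1 - s) \<le> t powr (1 - s) / (1 - s)"
      using n s t by (intro divide_right_mono powr_mono2) auto
    moreover have "t powr (1 - s) / (1 - s) \<le> (real (Suc n) + 1) powr (1 - s) / (1 - s)"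
      using n s t by (intro divide_right_mono powr_mono2) auto
    ultimately have "\<bar>psum (\<lambda>k. real k powr - s) t - t powr (1 - s) / (1 - s) - z\<bar> \<le> real (Suc n) powr - s"
      using ba[of n] z(2)[of n] zb[of n] unfolding ps a_def b_def by linarith
    \<comment> \<open>\<open>t\<close> is at most \<open>real (Suc n) + 1\<close>, hence at most
      twice \<open>real (Suc n)\<close>.\<close>
    also have "\<dots> \<le> (t / 2) powr - s"
      using n s t by (intro powr_mono2') auto
    also have "\<dots> = 2 powr s * t powr - s"
      using t by (simp add: powr_divide powr_minus field_simps)
    also have "\<dots> \<le> 2 powr 1 * t powr - s"
      using s by (intro mult_right_mono powr_mono) auto
    finally show ?thesis by simp
  qed
  ultimately show ?thesis by blast
qed

lemma psum_powr_le:
  fixes s t :: real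
  assumes s: "0 \<le> s" "s < 1" and t: "t \<ge> 0"
  shows "psum (\<lambda>k. real k powr - s) t \<le> t powr (1 - s) / (1 - s)"
proof (cases "s = 0")
  case True
  have "psum (\<lambda>k. real k powr - s) t = (\<Sum>k\<in>upto_real t. 1)"
    using True by (intro sum.cong) (auto simp: upto_real_def)
  then show ?thesis using card_upto_real_le[OF t] t True by simp
next
  case False
  have "(\<Sum>k=1..n. real k powr - s) \<le> real n powr (1 - s) / (1 - s)" for n
  proof (induction n)
    case (Suc n)
    show ?case
    proof (cases "n = 0")
      case False
      thus ?thesis using powr_diff_bounds(1)[of s "real n"] s \<open>s \<noteq> 0\<close> Suc
        by (simp add: diff_divide_distrib add_ac)
    qed (use s in simp)
  qed simp
  from this[of "nat \<lfloor>t\<rfloor>"] have "psum (\<lambda>k. real k powr - s) t \<le> real (nat \<lfloor>t\<rfloor>) powr (1 - s) / (1 - s)"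
    by (simp add: upto_real_eq)
  also have "\<dots> \<le> t powr (1 - s) / (1 - s)"
    using s t by (intro divide_right_mono powr_mono2) auto
  finally show ?thesis .
qed

lemma psum_inverse_le:
  fixes t :: real
  assumes t: "t \<ge> 1"
  shows "psum (\<lambda>k. real k powr - 1) t \<le> 1 + ln t"
proof -
  have "(\<Sum>k=1..Suc n. real k powr - 1) \<le> 1 + ln (real (Suc n))" for n
  proof (induction n)
    case (Suc n)
    have "ln (real (Suc n) / real (Suc (Suc n))) \<le> real (Suc n) / real (Suc (Suc n)) - 1"
      by (intro ln_le_minus_one) auto
    hence "real (Suc (Suc n)) powr - 1 \<le> ln (real (Suc (Suc n))) - ln (real (Suc n))"
      by (simp add: ln_div powr_minus field_simps)
    thus ?case using Suc by simp
  qed simp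
  from this[of "nat \<lfloor>t\<rfloor> - 1"] have "psum (\<lambda>k. real k powr - 1) t \<le> 1 + ln (real (nat \<lfloor>t\<rfloor>))"
    using t by (simp add: upto_real_eq)
  also have "ln (real (nat \<lfloor>t\<rfloor>)) \<le> ln t" using t by (subst ln_le_cancel_iff) auto
  finally show ?thesis by simp
qed

text \<open>Through this property alone the analytic part knows that a character is non-principal.
  For modulus \<open>N\<close> periodicity gives the bound \<open>N\<close>, and for
  \<open>chi p\<close> the Polya-Vinogradov inequality gives a better one.\<close>

definition bounded_sums :: "(nat \<Rightarrow> real) \<Rightarrow> real \<Rightarrow> bool" where
  "bounded_sums f B \<longleftrightarrow> (\<forall>n. \<bar>\<Sum>k=1..n. f k\<bar> \<le> B)"

lemma abel_bound:
  fixes w :: "nat \<Rightarrow> real"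
  assumes f: "bounded_sums f B" and w: "\<And>k. k > M \<Longrightarrow> w (Suc k) \<le> w k" "\<And>k. k > M \<Longrightarrow> w k \<ge> 0"
  shows "\<bar>\<Sum>k=Suc M..N. f k * w k\<bar> \<le> 2 * B * w (Suc M)"
proof -
  define F where "F = (\<lambda>n. \<Sum>k=Suc M..n. f k)"
  have B: "B \<ge> 0" using f unfolding bounded_sums_def by (metis abs_ge_zero order.trans)
  \<comment> \<open>A block sum is a difference of two initial sums, whence the factor 2.\<close>
  have F: "\<bar>F n\<bar> \<le> 2 * B" for n
  proof (cases "M \<le> n")
    case True
    have "(\<Sum>k=1..n. f k) = (\<Sum>k=1..M. f k) + F n"
      unfolding F_def using sum.ub_add_nat[of 1 M f "n - M"] True by simp
    moreover have "\<bar>\<Sum>k=1..n. f k\<bar> \<le> B" "\<bar>\<Sum>k=1..M. f k\<bar> \<le> B"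
      using f unfolding bounded_sums_def by blast+
    ultimately show ?thesis by linarith
  qed (use B in \<open>simp add: F_def\<close>)
  have parts: "(\<Sum>k=Suc M..N. f k * w k) = F N * w (Suc N) + (\<Sum>k=Suc M..N. F k * (w k - w (Suc k)))" for N
  proof (induction N)
    case 0 then show ?case by (simp add: F_def)
  next
    case (Suc N)
    show ?case
    proof (cases "Suc M \<le> Suc N")
      case True
      have "F (Suc N) = F N + f (Suc N)" using True by (simp add: F_def)
      thus ?thesis using Suc True by (simp add: algebra_simps)
    next
      case False
      thus ?thesis by (simp add: F_def)
    qed
  qed
  show ?thesis
  proof (cases "Suc M \<le> N")
    case True
    have "\<bar>\<Sum>k=Suc M..N. f k * w k\<bar> \<le> \<bar>F N * w (Suc N)\<bar> + \<bar>\<Sum>k=Suc M..N. F k * (w k - w (Suc k))\<bar>"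
      unfolding parts by linarith
    also have "\<bar>F N * w (Suc N)\<bar> \<le> 2 * B * w (Suc N)"
      unfolding abs_mult using w(2)[of "Suc N"] True F[of N] by (intro mult_mono) auto
    also have "\<bar>\<Sum>k=Suc M..N. F k * (w k - w (Suc k))\<bar> \<le> (\<Sum>k=Suc M..N. 2 * B * (w k - w (Suc k)))"
    proof (intro order.trans[OF sum_abs] sum_mono)
      fix k assume "k \<in> {Suc M..N}"
      thus "\<bar>F k * (w k - w (Suc k))\<bar> \<le> 2 * B * (w k - w (Suc k))"
        unfolding abs_mult using w(1)[of k] F[of k] by (intro mult_mono) auto
    qed
    also have "\<dots> = 2 * B * (w (Suc M) - w (Suc N))"
      unfolding sum_distrib_left[symmetric] using sum_Suc_diff[of "Suc M" N "\<lambda>k. - w k"] True by simp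
    finally show ?thesis by (simp add: algebra_simps)
  qed (use B w in simp)
qed

section \<open>Values of Dirichlet series of real characters\<close>

lemma dconv_wt:
  assumes "n > 0"
  shows "wt (dconv u v) s n = dconv (wt u s) (wt v s) n"
  unfolding dconv_def sum_distrib_right
proof (rule sum.cong[OF refl])
  fix d assume "d \<in> {d. d dvd n}"
  hence "real n = real d * real (n div d)" by (simp flip: of_nat_mult)
  hence "real n powr - s = real d powr - s * real (n div d) powr - s" by (simp add: powr_mult)
  thus "u d * v (n div d) * real n powr - s = wt u s d * wt v s (n div d)" by simp
qed

lemma psum_dconv_wt: "psum (wt (dconv u v) s) x = psum (dconv (wt u s) (wt v s)) x"
  by (intro sum.cong refl dconv_wt) (auto simp: upto_real_def)

lemma bounded_sums_nonneg: "bounded_sums f B \<Longrightarrow> B \<ge> 0"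
  unfolding bounded_sums_def by (metis abs_ge_zero order.trans)

lemma wt_tail_bound:
  assumes "bounded_sums f B" "s \<ge> 0"
  shows "\<bar>\<Sum>k=Suc M..N. wt f s k\<bar> \<le> 2 * B * real (Suc M) powr - s"
  using assms by (intro abel_bound) (auto intro!: powr_mono2')

lemma psum_wt_diff:
  assumes f: "bounded_sums f B" and s: "s \<ge> 0" and y: "0 < y" "y \<le> t"
  shows "\<bar>psum (wt f s) t - psum (wt f s) y\<bar> \<le> 2 * B * y powr - s"
proof -
  let ?M = "nat \<lfloor>y\<rfloor>" and ?N = "nat \<lfloor>t\<rfloor>"
  have "?M \<le> ?N" using y by (simp add: floor_mono nat_mono)
  hence "psum (wt f s) t = psum (wt f s) y + (\<Sum>k=Suc ?M..?N. wt f s k)"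
    unfolding upto_real_eq using sum.ub_add_nat[of 1 ?M "wt f s" "?N - ?M"] by simp
  moreover have "real (Suc ?M) powr - s \<le> y powr - s"
    using y s by (intro powr_mono2') (auto, linarith)
  hence "2 * B * real (Suc ?M) powr - s \<le> 2 * B * y powr - s"
    using bounded_sums_nonneg[OF f] by (intro mult_left_mono) auto
  ultimately show ?thesis using wt_tail_bound[OF f s, of ?M ?N] by linarith
qed

definition Lval :: "(nat \<Rightarrow> real) \<Rightarrow> real \<Rightarrow> real" where
  "Lval f s = (\<Sum>n. wt f s (Suc n))"

lemma sums_Lval:
  assumes f: "bounded_sums f B" and s: "s > 0"
  shows "(\<lambda>n. wt f s (Suc n)) sums Lval f s"
proof -
  have "summable (\<lambda>n. wt f s (Suc n))"
    unfolding summable_Cauchy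
  proof (intro allI impI)
    fix e :: real assume e: "e > 0"
    have "(\<lambda>M. 2 * B * real (Suc M) powr - s) \<longlonglongrightarrow> 0" using s by real_asymp
    hence "eventually (\<lambda>M. 2 * B * real (Suc M) powr - s < e) sequentially"
      using e by (rule order_tendstoD)
    then obtain N where N: "\<And>M. M \<ge> N \<Longrightarrow> 2 * B * real (Suc M) powr - s < e"
      by (auto simp: eventually_sequentially)
    show "\<exists>N. \<forall>m\<ge>N. \<forall>n. norm (\<Sum>n=m..<n. wt f s (Suc n)) < e"
    proof (intro exI[of _ N] allI impI)
      fix m n assume "m \<ge> N"
      have "(\<Sum>n=m..<n. wt f s (Suc n)) = (\<Sum>k=Suc m..n. wt f s k)"
        by (rule sum.reindex_bij_witness[of _ "\<lambda>k. k - 1" Suc]) auto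
      thus "norm (\<Sum>n=m..<n. wt f s (Suc n)) < e"
        using wt_tail_bound[OF f, of s m n] s N[OF \<open>m \<ge> N\<close>] by simp
    qed
  qed
  thus ?thesis unfolding Lval_def by (rule summable_sums)
qed

lemma Lval_tail:
  assumes f: "bounded_sums f B" and s: "s > 0" and t: "t > 0"
  shows "\<bar>psum (wt f s) t - Lval f s\<bar> \<le> 2 * B * t powr - s"
proof -
  have "(\<lambda>n. \<Sum>k=1..n. wt f s k) \<longlonglongrightarrow> Lval f s"
  proof -
    have "(\<Sum>k=1..n. wt f s k) = (\<Sum>k<n. wt f s (Suc k))" for n
      by (rule sum.reindex_bij_witness[of _ Suc "\<lambda>k. k - 1"]) auto
    thus ?thesis using sums_Lval[OF f s] unfolding sums_def by simp
  qed
  hence "(\<lambda>n. \<bar>psum (wt f s) t - (\<Sum>k=1..n. wt f s k)\<bar>) \<longlonglongrightarrow> \<bar>psum (wt f s) t - Lval f s\<bar>"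
    by (intro tendsto_intros)
  moreover have "eventually (\<lambda>n. \<bar>psum (wt f s) t - (\<Sum>k=1..n. wt f s k)\<bar> \<le> 2 * B * t powr - s) sequentially"
  proof (rule eventually_sequentiallyI[of "nat \<lceil>t\<rceil>"])
    fix n assume "nat \<lceil>t\<rceil> \<le> n"
    hence "t \<le> real n" by linarith
    thus "\<bar>psum (wt f s) t - (\<Sum>k=1..n. wt f s k)\<bar> \<le> 2 * B * t powr - s"
      using psum_wt_diff[OF f _ t, of s "real n"] s unfolding upto_real_of_nat by (simp add: abs_minus_commute)
  qed
  ultimately show ?thesis by (rule tendsto_upperbound) simp
qed

lemma abs_Lval_le:
  assumes f: "bounded_sums f B" and s: "s > 0"
  shows "\<bar>Lval f s\<bar> \<le> 2 * B"
proof -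

  have "(\<Sum>n<N. wt f s (Suc n)) = (\<Sum>k=Suc 0..N. wt f s k)" for N
    by (rule sum.reindex_bij_witness[of _ "\<lambda>k. k - 1" Suc]) auto
  hence "\<bar>\<Sum>n<N. wt f s (Suc n)\<bar> \<le> 2 * B" for N
    using wt_tail_bound[OF f, of s 0 N] s by simp
  moreover have "(\<lambda>N. \<bar>\<Sum>n<N. wt f s (Suc n)\<bar>) \<longlonglongrightarrow> \<bar>Lval f s\<bar>"
    using sums_Lval[OF f s] unfolding sums_def by (intro tendsto_intros)
  ultimately show ?thesis by (intro tendsto_upperbound) auto
qed

text \<open>Continuity produces a real zero between a negative value at \<open>s\<close> and the
  positive value at 1. The tail bound is uniform because \<open>a\<close> is the worst exponent in
  the interval.\<close>

lemma continuous_on_Lval: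
  assumes f: "bounded_sums f B" and a: "a > 0"
  shows "continuous_on {a..b} (Lval f)"
proof (rule uniform_limit_theorem)
  show "\<forall>\<^sub>F n in sequentially. continuous_on {a..b} (\<lambda>s. psum (wt f s) (real (Suc n)))"
    by (intro always_eventually allI continuous_intros) (auto simp: upto_real_def)
  show "uniform_limit {a..b} (\<lambda>n s. psum (wt f s) (real (Suc n))) (Lval f) sequentially"
    unfolding uniform_limit_iff
  proof (intro allI impI)
    fix e :: real assume e: "e > 0"
    have "(\<lambda>M. 2 * B * real (Suc M) powr - a) \<longlonglongrightarrow> 0" using a by real_asymp
    hence "eventually (\<lambda>M. 2 * B * real (Suc M) powr - a < e) sequentially"
      using e by (rule order_tendstoD)
    thus "\<forall>\<^sub>F n in sequentially. \<forall>s\<in>{a..b}. dist (psum (wt f s) (real (Suc n))) (Lval f s) < e"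
    proof eventually_elim
      case (elim n)
      show ?case
      proof
        fix s assume s: "s \<in> {a..b}"
        have "\<bar>psum (wt f s) (real (Suc n)) - Lval f s\<bar> \<le> 2 * B * real (Suc n) powr - s"
          using s a by (intro Lval_tail[OF f]) auto
        also have "\<dots> \<le> 2 * B * real (Suc n) powr - a"
          using s bounded_sums_nonneg[OF f] by (intro mult_left_mono powr_mono) auto
        finally show "dist (psum (wt f s) (real (Suc n))) (Lval f s) < e"
          using elim by (simp add: dist_real_def)
      qed
    qed
  qed
qed simp

section \<open>Convolutions with a real character\<close>

text \<open>A common template for three uses: \<open>u = 1\<close> with main term
  \<open>t powr (1 - s) / (1 - s)\<close> and constant \<zeta>(s); \<open>u\<close> a non-principal
  character, with main term 0 and constant L(s, u); and \<open>u = 1\<close> at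
  \<open>s = 0\<close>, which counts. The error consists of the sum over \<open>m \<le> y\<close> of
  the errors in \<open>u\<close> and of the tail of \<open>f\<close> beyond \<open>y\<close>. The
  bound on the power sum is left abstract as \<open>D\<close> because at \<open>s = 1\<close> it is
  logarithmic.\<close>

lemma hyperbola_char:
  assumes xy: "1 \<le> y" "y \<le> x" and s: "0 \<le> s"
    and U: "\<And>t. t \<ge> 1 \<Longrightarrow> \<bar>psum (wt u s) t - (\<alpha> * t powr (1 - s) + \<kappa>)\<bar> \<le> C * t powr - s"
    and u: "\<And>k. \<bar>u k\<bar> \<le> 1"
    and f: "\<And>k. \<bar>f k\<bar> \<le> 1" "bounded_sums f B"
    and D: "psum (\<lambda>k. real k powr - s) (x / y) \<le> D * (x / y) powr (1 - s)"
  shows "\<bar>psum (wt (dconv u f) s) x - (\<alpha> * x powr (1 - s) * psum (wt f 1) y + \<kappa> * psum (wt f s) y)\<bar>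
      \<le> C * x powr - s * y + 2 * B * D * x powr (1 - s) / y"
proof -
  have C: "C \<ge> 0" using U[of 1] by (simp add: order.trans[OF abs_ge_zero])
  have B: "B \<ge> 0" using f(2) by (rule bounded_sums_nonneg)
  have "\<bar>psum (dconv (wt u s) (wt f s)) x - (\<Sum>m\<in>upto_real y. wt f s m * (\<alpha> * (x / real m) powr (1 - s) + \<kappa>))\<bar>
     \<le> (\<Sum>m\<in>upto_real y. \<bar>wt f s m\<bar> * (C * (x / real m) powr - s))
      + psum (\<lambda>k. \<bar>wt u s k\<bar>) (x / y) * (2 * B * y powr - s)"
    using xy s by (intro hyperbola_bound U psum_wt_diff f) auto
  also have "(\<Sum>m\<in>upto_real y. wt f s m * (\<alpha> * (x / real m) powr (1 - s) + \<kappa>))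
     = \<alpha> * x powr (1 - s) * psum (wt f 1) y + \<kappa> * psum (wt f s) y"
    unfolding sum_distrib_left sum.distrib[symmetric]
  proof (rule sum.cong[OF refl])
    fix m assume "m \<in> upto_real y"
    hence m: "real m > 0" by (simp add: upto_real_def)
    have "(x / real m) powr (1 - s) = x powr (1 - s) * (real m powr s * real m powr - 1)"
      using m xy by (simp add: powr_divide powr_diff powr_minus field_simps)
    moreover have "real m powr - s * real m powr s = 1"
      using m by (simp flip: powr_add)
    ultimately show "wt f s m * (\<alpha> * (x / real m) powr (1 - s) + \<kappa>)
      = \<alpha> * x powr (1 - s) * wt f 1 m + \<kappa> * wt f s m"
      by (simp add: algebra_simps)
  qed
  also have "(\<Sum>m\<in>upto_real y. \<bar>wt f s m\<bar> * (C * (x / real m) powr - s)) \<le> (\<Sum>m\<in>upto_real y. C * x powr - s)"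
  proof (rule sum_mono)
    fix m assume "m \<in> upto_real y"
    hence m: "real m > 0" by (simp add: upto_real_def)
    have "\<bar>wt f s m\<bar> * (C * (x / real m) powr - s) = \<bar>f m\<bar> * (C * x powr - s)"
      using m xy by (simp add: abs_mult powr_divide)
    also have "\<dots> \<le> 1 * (C * x powr - s)" using f(1) C by (intro mult_right_mono) auto
    finally show "\<bar>wt f s m\<bar> * (C * (x / real m) powr - s) \<le> C * x powr - s" by simp
  qed
  also have "\<dots> \<le> C * x powr - s * y"
    using mult_right_mono[OF card_upto_real_le[of y], of "C * x powr - s"] xy C by (simp add: mult_ac)
  also have "psum (\<lambda>k. \<bar>wt u s k\<bar>) (x / y) * (2 * B * y powr - s) \<le> D * (x / y) powr (1 - s) * (2 * B * y powr - s)"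
  proof (intro mult_right_mono order.trans[OF _ D] sum_mono)
    show "\<bar>wt u s k\<bar> \<le> real k powr - s" for k
      using mult_right_mono[OF u, of "real k powr - s" k] by (simp add: abs_mult)
  qed (use B in auto)
  also have "D * (x / y) powr (1 - s) * (2 * B * y powr - s) = 2 * B * D * x powr (1 - s) / y"
  proof -
    have "(x / y) powr (1 - s) * y powr - s = x powr (1 - s) / y"
      using xy by (simp add: powr_divide powr_diff powr_minus field_simps)
    hence "2 * B * D * ((x / y) powr (1 - s) * y powr - s) = 2 * B * D * (x powr (1 - s) / y)" by simp
    thus ?thesis by (simp add: mult_ac)
  qed
  finally show ?thesis unfolding psum_dconv_wt by simp
qed

text \<open>The cut at \<open>sqrt x\<close> balances both errors. The two main terms come from the
  pole of \<zeta>(s) at 1 and from the value \<zeta>(s) L(s, f). The constants are chosen before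
  \<open>f\<close> and \<open>B\<close> because the result is applied to characters of varying
  modulus.\<close>

lemma rho_partial_sums:
  assumes s: "0 < s" "s < 1"
  shows "\<exists>z < 0. \<exists>C \<ge> 0. \<forall>f B x. real_char f \<longrightarrow> bounded_sums f B \<longrightarrow> B \<ge> 1 \<longrightarrow> x \<ge> 1 \<longrightarrow>
     \<bar>psum (wt (rho f) s) x - (Lval f 1 / (1 - s) * x powr (1 - s) + z * Lval f s)\<bar>
       \<le> C * B * x powr (1/2 - s)"
proof -
  obtain z where z: "z < 0" "\<And>t. t \<ge> 1 \<Longrightarrow> \<bar>psum (\<lambda>k. real k powr - s) t - t powr (1 - s) / (1 - s) - z\<bar> \<le> 2 * t powr - s"
    using zeta_partial_sums[OF s] by blast
  define C where "C = 2 + 2 / (1 - s) + 2 / (1 - s) + 2 * \<bar>z\<bar>"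
  have "\<bar>psum (wt (rho f) s) x - (Lval f 1 / (1 - s) * x powr (1 - s) + z * Lval f s)\<bar>
       \<le> C * B * x powr (1/2 - s)"
    if f: "real_char f" "bounded_sums f B" "B \<ge> 1" and x: "x \<ge> 1" for f B x
  proof -
    define y where "y = sqrt x"
    have y: "1 \<le> y" "y \<le> x" "y * y = x" unfolding y_def using x
      by (auto simp: power2_eq_square intro: real_le_lsqrt)
    have y2: "y = x powr (1/2)" using x by (simp add: y_def powr_half_sqrt)
    define E1 where "E1 = psum (wt (rho f) s) x - (1 / (1 - s) * x powr (1 - s) * psum (wt f 1) y + z * psum (wt f s) y)"
    define E2 where "E2 = psum (wt f 1) y - Lval f 1"
    define E3 where "E3 = psum (wt f s) y - Lval f s"
    have "\<bar>E1\<bar> \<le> 2 * x powr - s * y + 2 * B * (1 / (1 - s)) * x powr (1 - s) / y"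
      unfolding E1_def using f y s x z(2) psum_powr_le[of s "x / y"]
      by (intro hyperbola_char real_char_abs_le real_char_one) (auto simp: algebra_simps)
    also have "2 * x powr - s * y = 2 * x powr (1/2 - s)"
      using x by (simp add: y2 flip: powr_add)
    also have "2 * B * (1 / (1 - s)) * x powr (1 - s) / y = 2 / (1 - s) * B * x powr (1/2 - s)"
    proof -
      have "x powr (1 - s) / y = x powr (1/2 - s)" using x by (simp add: y2 flip: powr_diff)
      hence "2 / (1 - s) * B * (x powr (1 - s) / y) = 2 / (1 - s) * B * x powr (1/2 - s)" by simp
      thus ?thesis by (simp add: mult_ac)
    qed
    finally have E1: "\<bar>E1\<bar> \<le> 2 * x powr (1/2 - s) + 2 / (1 - s) * B * x powr (1/2 - s)" by simp
    have "\<bar>E2\<bar> \<le> 2 * B * y powr - 1" unfolding E2_def using y by (intro Lval_tail f) auto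
    hence "1 / (1 - s) * x powr (1 - s) * \<bar>E2\<bar> \<le> 1 / (1 - s) * x powr (1 - s) * (2 * B * y powr - 1)"
      using s by (intro mult_left_mono) auto
    also have "\<dots> = 2 / (1 - s) * B * (x powr (1 - s) * y powr - 1)" by simp
    also have "x powr (1 - s) * y powr - 1 = x powr (1/2 - s)"
      unfolding y2 powr_powr powr_add[symmetric] by (rule arg_cong[of _ _ "(powr) x"]) simp
    finally have E2: "\<bar>1 / (1 - s) * x powr (1 - s) * E2\<bar> \<le> 2 / (1 - s) * B * x powr (1/2 - s)"
      using s by (simp add: abs_mult)
    have "\<bar>E3\<bar> \<le> 2 * B * y powr - s" unfolding E3_def using y s by (intro Lval_tail f) auto
    also have "y powr - s \<le> x powr (1/2 - s)"
      unfolding y2 powr_powr using x s by (intro powr_mono) auto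
    finally have "\<bar>z\<bar> * \<bar>E3\<bar> \<le> \<bar>z\<bar> * (2 * B * x powr (1/2 - s))"
      using f by (intro mult_left_mono) auto
    hence E3: "\<bar>z * E3\<bar> \<le> 2 * \<bar>z\<bar> * B * x powr (1/2 - s)" by (simp add: abs_mult)
    have eq: "psum (wt (rho f) s) x - (Lval f 1 / (1 - s) * x powr (1 - s) + z * Lval f s)
       = E1 + 1 / (1 - s) * x powr (1 - s) * E2 + z * E3"
      unfolding E1_def E2_def E3_def by (simp add: algebra_simps)
    have "\<bar>E1 + 1 / (1 - s) * x powr (1 - s) * E2 + z * E3\<bar>
      \<le> \<bar>E1\<bar> + \<bar>1 / (1 - s) * x powr (1 - s) * E2\<bar> + \<bar>z * E3\<bar>"
      by (intro order.trans[OF abs_triangle_ineq] add_mono order.refl)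
    also have "\<dots> \<le> 2 * x powr (1/2 - s) + 2 / (1 - s) * B * x powr (1/2 - s) + 2 / (1 - s) * B * x powr (1/2 - s)
        + 2 * \<bar>z\<bar> * B * x powr (1/2 - s)" using E1 E2 E3 by linarith
    also have "2 * x powr (1/2 - s) \<le> 2 * B * x powr (1/2 - s)" using f by (intro mult_right_mono) auto
    finally show ?thesis unfolding eq by (simp add: C_def algebra_simps)
  qed
  moreover have "C \<ge> 0" using s by (simp add: C_def)
  ultimately show ?thesis using z(1) by blast
qed

section \<open>Lower bounds at 1\<close>

lemma rho_square_ge_1:
  assumes f: "real_char f" and m: "m > 0"
  shows "rho f (m ^ 2) \<ge> 1"
  using m
proof (induction m rule: prime_power_coprime_induct)
  case one
  show ?case using multiplicative_rho[OF f] by (simp add: multiplicative_def)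
next
  case (step q k n)
  have c: "coprime (q ^ (2 * k)) (n ^ 2)"
    using step by (simp add: prime_imp_coprime)
  have "(q ^ k * n) ^ 2 = q ^ (2 * k) * n ^ 2" by (simp add: power_mult_distrib power_even_eq)
  moreover have "rho f (q ^ (2 * k) * n ^ 2) = rho f (q ^ (2 * k)) * rho f (n ^ 2)"
    using multiplicative_rho[OF f] c step prime_gt_0_nat[of q] unfolding multiplicative_def by simp
  moreover have "rho f (q ^ (2 * k)) \<ge> 1"
    using real_char_cases[OF f, of q] rho_prime_power_1[OF f step(1), of "2 * k"]
      rho_prime_power_0[OF f step(1), of "2 * k"] rho_prime_power_m1[OF f step(1), of "2 * k"] by auto
  ultimately show ?case using step(5) mult_mono[of 1 "rho f (q ^ (2 * k))" 1 "rho f (n ^ 2)"] by simp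
qed

lemma rho_1: "real_char f \<Longrightarrow> rho f 1 = 1"
  using multiplicative_rho by (simp add: multiplicative_def)

lemma psum_ge_first:
  assumes "\<And>n. n > 0 \<Longrightarrow> u n \<ge> 0" "u 1 = 1" "x \<ge> 1"
  shows "psum (wt u s) x \<ge> 1"
proof -
  have "psum (wt u s) x \<ge> (\<Sum>k\<in>{1}. wt u s k)"
    using assms by (intro sum_mono2) (simp, auto simp: upto_real_def)
  thus ?thesis using assms by simp
qed

lemma bounded_sums_mono: "bounded_sums f B \<Longrightarrow> B \<le> C \<Longrightarrow> bounded_sums f C"
  unfolding bounded_sums_def by (meson order.trans)

text \<open>At \<open>s = 1/2\<close> the squares alone force the partial sums of \<open>rho f n / n powr s\<close> to grow like a logarithm, while
  \<open>L(1, f) \<le> 0\<close> would keep them bounded above.\<close>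

lemma Lval_1_pos:
  assumes f: "real_char f" and "bounded_sums f B"
  shows "Lval f 1 > 0"
proof (rule ccontr)
  assume neg: "\<not> Lval f 1 > 0"
  define B' where "B' = max B 1"
  have B': "bounded_sums f B'" "B' \<ge> 1"
    using assms by (auto simp: B'_def intro: bounded_sums_mono)
  have "0 < (1/2 :: real)" "(1/2 :: real) < 1" by simp_all
  from rho_partial_sums[OF this] obtain z C where
    "\<forall>f B x. real_char f \<longrightarrow> bounded_sums f B \<longrightarrow> B \<ge> 1 \<longrightarrow> x \<ge> 1 \<longrightarrow>
     \<bar>psum (wt (rho f) (1/2)) x - (Lval f 1 / (1 - 1/2) * x powr (1 - 1/2) + z * Lval f (1/2))\<bar>
       \<le> C * B * x powr (1/2 - 1/2)"
    by blast
  note zC = this[rule_format, OF f B']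
  define K where "K = z * Lval f (1/2) + C * B'"
  have "ln (real n + 1) \<le> K" if n: "n \<ge> 1" for n :: nat
  proof -
    have "ln (real n + 1) \<le> (\<Sum>m=1..n. inverse (real m))"
      using ln_le_harm[of n] by (simp add: harm_def)
    also have "\<dots> \<le> (\<Sum>m=1..n. wt (rho f) (1/2) (m ^ 2))"
    proof (rule sum_mono)
      fix m assume m: "m \<in> {1..n}"
      have "real (m ^ 2) powr - (1/2) = inverse (real m)"
        using m by (simp add: powr_minus powr_half_sqrt)
      thus "inverse (real m) \<le> wt (rho f) (1/2) (m ^ 2)"
        using rho_square_ge_1[OF f, of m] m mult_right_mono[of 1 "rho f (m ^ 2)" "inverse (real m)"] by simp
    qed
    also have "\<dots> = (\<Sum>k\<in>(\<lambda>m. m ^ 2) ` {1..n}. wt (rho f) (1/2) k)"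
      by (subst sum.reindex) (auto simp: inj_on_def)
    also have "\<dots> \<le> psum (wt (rho f) (1/2)) (real (n ^ 2))"
      by (intro sum_mono2) (simp, auto simp: upto_real_def rho_nonneg[OF f] power_mono simp flip: of_nat_power)
    also have "\<dots> \<le> Lval f 1 / (1 - 1/2) * real (n ^ 2) powr (1 - 1/2) + z * Lval f (1/2) + C * B'"
      using zC[of "real (n ^ 2)"] n by simp
    also have "\<dots> \<le> K" using neg by (simp add: K_def mult_nonpos_nonneg)
    finally show ?thesis .
  qed
  moreover have "filterlim (\<lambda>n. ln (real n + 1)) at_top sequentially" by real_asymp
  hence "eventually (\<lambda>n. ln (real n + 1) > K) sequentially"
    by (simp add: filterlim_at_top_dense)
  hence "eventually (\<lambda>n. ln (real n + 1) > K \<and> n \<ge> 1) sequentially"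
    using eventually_ge_at_top[of 1] by (rule eventually_conj)
  then obtain n :: nat where "ln (real n + 1) > K" "n \<ge> 1"
    by (metis (no_types, lifting) eventually_sequentially order_refl)
  ultimately show False by force
qed

text \<open>A non-negative value \<open>L(s, f)\<close> makes the secondary term \<open>\<zeta>(s) L(s, f)\<close> non-positive, so that
  \<open>L(1, f)\<close> alone has to account for the term \<open>n = 1\<close>.\<close>

lemma Lval_1_lower_bound_one_char:
  fixes s :: real
  assumes s: "7/8 < s" "s < 1"
  shows "\<exists>c > 0. \<exists>P. \<forall>f p. p \<ge> P \<longrightarrow> real_char f \<longrightarrow> bounded_sums f p \<longrightarrow> Lval f s \<ge> 0 \<longrightarrow>
            Lval f 1 \<ge> c * p powr (- 8 * (1 - s))"
proof -
  obtain z C where zC: "z < 0" "C \<ge> 0"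
     "\<And>f B x. real_char f \<Longrightarrow> bounded_sums f B \<Longrightarrow> B \<ge> 1 \<Longrightarrow> x \<ge> 1 \<Longrightarrow>
       \<bar>psum (wt (rho f) s) x - (Lval f 1 / (1 - s) * x powr (1 - s) + z * Lval f s)\<bar>
       \<le> C * B * x powr (1/2 - s)"
    using rho_partial_sums[of s] s by auto
  define P where "P = max 1 (2 * C)"
  have "Lval f 1 \<ge> ((1 - s) / 2) * p powr (- 8 * (1 - s))"
    if p: "p \<ge> P" and f: "real_char f" "bounded_sums f p" "Lval f s \<ge> 0" for f p
  proof -
    have p1: "p \<ge> 1" "p \<ge> 2 * C" using p by (auto simp: P_def)
    \<comment> \<open>The length \<open>p powr 8\<close> turns the error into
      \<open>C * p powr (5 - 8 * s)\<close>; with \<open>s > 7/8\<close> the factor \<open>p\<close>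
      lost to the trivial bound on the character sums is outweighed.\<close>
    have "1 \<le> psum (wt (rho f) s) (p powr 8)"
      using rho_nonneg[OF f(1)] rho_1[OF f(1)] ge_one_powr_ge_zero[of p 8] p1 by (intro psum_ge_first) auto
    also have "\<dots> \<le> Lval f 1 / (1 - s) * (p powr 8) powr (1 - s) + z * Lval f s + C * p * (p powr 8) powr (1/2 - s)"
      using zC(3)[OF f(1,2) p1(1), of "p powr 8"] ge_one_powr_ge_zero[of p 8] p1 by simp
    also have "z * Lval f s \<le> 0" using zC f by (simp add: mult_nonpos_nonneg)
    also have "C * p * (p powr 8) powr (1/2 - s) = C * p powr (5 - 8 * s)"
    proof -
      have "(p powr 8) powr (1/2 - s) = p powr (4 - 8 * s)"
        unfolding powr_powr by (simp add: algebra_simps)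
      moreover have "p * p powr (4 - 8 * s) = p powr (5 - 8 * s)"
        using powr_mult_base[of p "4 - 8 * s"] p1 by simp
      ultimately show ?thesis by (simp only: mult.assoc)
    qed
    also have "\<dots> \<le> C * p powr (- 1)"
      using zC p1 s by (intro mult_left_mono powr_mono) auto
    also have "\<dots> \<le> 1 / 2" using p1 by (simp add: powr_minus field_simps)
    finally have "1/2 \<le> Lval f 1 / (1 - s) * p powr (8 * (1 - s))"
      unfolding powr_powr by linarith
    hence "(1 - s) / 2 * p powr (- 8 * (1 - s)) \<le> (1 - s) * p powr (- 8 * (1 - s)) * (Lval f 1 / (1 - s) * p powr (8 * (1 - s)))"
      using mult_left_mono[of "1/2" "Lval f 1 / (1 - s) * p powr (8 * (1 - s))" "(1 - s) * p powr (- 8 * (1 - s))"] s by simp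
    also have "\<dots> = Lval f 1 * (p powr (- 8 * (1 - s)) * p powr (8 * (1 - s)))"
      using s by (simp add: field_simps)
    also have "\<dots> = Lval f 1" unfolding powr_add[symmetric] using p1 by simp
    finally show ?thesis .
  qed
  moreover have "(1 - s) / 2 > 0" using s by simp
  ultimately show ?thesis by blast
qed

text \<open>Neither factor has a pole, so the hyperbola method runs with main term 0 and constant
  L(s, f), and the product of the two L-values is all that remains. The case \<open>s = 1\<close> is
  included, which is why \<open>D\<close> is a parameter.\<close>

lemma dconv_chars_partial_sums:
  assumes f: "real_char f" "bounded_sums f B" and h: "real_char h" "bounded_sums h B"
    and B: "B \<ge> 1" and s: "0 < s" "s \<le> 1" and x: "x \<ge> 1" and D: "D \<ge> 0"
      "psum (\<lambda>k. real k powr - s) (sqrt x) \<le> D * sqrt x powr (1 - s)"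
  shows "\<bar>psum (wt (dconv f h) s) x - Lval f s * Lval h s\<bar> \<le> (6 + 2 * D) * B ^ 2 * x powr (1/2 - s)"
proof -
  define y where "y = sqrt x"
  have y: "1 \<le> y" "y \<le> x" "y * y = x" "x / y = y" unfolding y_def using x
    by (auto simp: power2_eq_square real_div_sqrt intro: real_le_lsqrt)
  have y2: "y = x powr (1/2)" using x by (simp add: y_def powr_half_sqrt)
  have "\<bar>psum (wt (dconv f h) s) x - (0 * x powr (1 - s) * psum (wt h 1) y + Lval f s * psum (wt h s) y)\<bar>
      \<le> 2 * B * x powr - s * y + 2 * B * D * x powr (1 - s) / y"
  proof (intro hyperbola_char real_char_abs_le f h y)
    show "\<bar>psum (wt f s) t - (0 * t powr (1 - s) + Lval f s)\<bar> \<le> 2 * B * t powr - s" if "1 \<le> t" for t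
      using Lval_tail[OF f(2), of s t] s that by simp
    show "psum (\<lambda>k. real k powr - s) (x / y) \<le> D * (x / y) powr (1 - s)"
      using D y by (simp add: y_def)
  qed (use s in auto)
  also have "2 * B * x powr - s * y = 2 * B * x powr (1/2 - s)"
    using x by (simp add: y2 mult.assoc flip: powr_add)
  also have "2 * B * D * x powr (1 - s) / y = 2 * B * D * x powr (1/2 - s)"
    using x by (simp add: y2 flip: powr_diff times_divide_eq_right)
  finally have 1: "\<bar>psum (wt (dconv f h) s) x - Lval f s * psum (wt h s) y\<bar>
      \<le> 2 * B * x powr (1/2 - s) + 2 * B * D * x powr (1/2 - s)" by simp
  have "\<bar>psum (wt h s) y - Lval h s\<bar> \<le> 2 * B * y powr - s"
    using y s by (intro Lval_tail h) auto
  also have "\<dots> \<le> 2 * B * x powr (1/2 - s)"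
    unfolding y2 powr_powr using x s B by (intro mult_left_mono powr_mono) auto
  finally have "\<bar>Lval f s * (psum (wt h s) y - Lval h s)\<bar> \<le> (2 * B) * (2 * B * x powr (1/2 - s))"
    unfolding abs_mult using abs_Lval_le[OF f(2) s(1)] B by (intro mult_mono) auto
  hence "\<bar>psum (wt (dconv f h) s) x - Lval f s * Lval h s\<bar>
     \<le> 2 * B * x powr (1/2 - s) + 2 * B * D * x powr (1/2 - s) + (2 * B) * (2 * B * x powr (1/2 - s))"
    using 1 unfolding right_diff_distrib by linarith
  also have "\<dots> = (2 * B * (1 + D) + 4 * B ^ 2) * x powr (1/2 - s)"
    by (simp add: algebra_simps power2_eq_square)
  also have "\<dots> \<le> (2 * B ^ 2 * (1 + D) + 4 * B ^ 2) * x powr (1/2 - s)"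
    using B D by (intro mult_right_mono add_mono mult_mono) (auto simp: power2_eq_square)
  also have "\<dots> = (6 + 2 * D) * B ^ 2 * x powr (1/2 - s)" by (simp add: algebra_simps)
  finally show ?thesis .
qed

text \<open>Cutting the series at \<open>B\<close> makes its tail at most 2, and the initial part is
  dominated by a harmonic sum.\<close>

lemma Lval_1_upper_bound:
  assumes f: "real_char f" "bounded_sums f B" and B: "B \<ge> 1"
  shows "Lval f 1 \<le> 3 + ln B"
proof -
  have "Lval f 1 \<le> psum (wt f 1) B + 2 * B * B powr - 1"
    using Lval_tail[OF f(2), of 1 B] B by simp
  also have "2 * B * B powr - 1 = 2" using B by (simp add: powr_minus field_simps)
  also have "psum (wt f 1) B \<le> psum (\<lambda>k. real k powr - 1) B"
  proof (rule sum_mono)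
    show "wt f 1 k \<le> real k powr - 1" for k
      using mult_right_mono[of "f k" 1 "real k powr - 1"] real_char_abs_le[OF f(1), of k] by simp
  qed
  also have "\<dots> \<le> 1 + ln B" using B by (rule psum_inverse_le)
  finally show ?thesis by simp
qed

text \<open>Thus the twist of \<open>rho f\<close> by \<open>h\<close> has the Dirichlet series L(s,
  h) L(s, h f), and its partial sums converge to the product of these values.\<close>

lemma dconv_char_twist:
  assumes "real_char h"
  shows "dconv h (\<lambda>m. h m * f m) n = h n * rho f n"
  unfolding dconv_def sum_distrib_left
proof (rule sum.cong[OF refl])
  fix d assume "d \<in> {d. d dvd n}"
  hence "n = d * (n div d)" by simp
  hence "h n = h d * h (n div d)" using assms unfolding real_char_def by metis
  thus "h d * (h (n div d) * f (n div d)) = h n * (1 * f (n div d))" by simp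
qed

text \<open>At a zero \<open>\<beta>\<close> of \<open>L(s, f)\<close> the constant \<open>\<zeta>(\<beta>) L(\<beta>, f)\<close> in the partial sums of \<open>rho f\<close> vanishes. In the
  hyperbola method for \<open>rho f\<close> and its twist by \<open>h\<close> only the term with \<open>L(1, h) L(1, h f)\<close> then survives.
  The cut-off \<open>p powr 32\<close> and the length \<open>p powr 64\<close> only have to be large powers of \<open>p\<close>.\<close>

lemma Lval_product_lower_bound:
  assumes f: "real_char f" "bounded_sums f B" and B: "B \<ge> 1"
    and \<beta>: "15/16 \<le> \<beta>" "\<beta> < 1" and zero: "Lval f \<beta> = 0"
  shows "\<exists>c > 0. \<exists>P. \<forall>h p. p \<ge> P \<longrightarrow> real_char h \<longrightarrow> bounded_sums h p \<longrightarrow>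
            bounded_sums (\<lambda>n. h n * f n) (B * p) \<longrightarrow>
            Lval h 1 * Lval (\<lambda>n. h n * f n) 1 \<ge> c * p powr (- 64 * (1 - \<beta>))"
proof -
  obtain z C where "\<forall>f B x. real_char f \<longrightarrow> bounded_sums f B \<longrightarrow> B \<ge> 1 \<longrightarrow> x \<ge> 1 \<longrightarrow>
     \<bar>psum (wt (rho f) \<beta>) x - (Lval f 1 / (1 - \<beta>) * x powr (1 - \<beta>) + z * Lval f \<beta>)\<bar>
       \<le> C * B * x powr (1/2 - \<beta>)" and C: "C \<ge> 0"
    using rho_partial_sums[of \<beta>] \<beta> by auto
  note U0 = this(1)[rule_format, OF f B, unfolded zero mult_zero_right add_0_right]
  define \<alpha> where "\<alpha> = Lval f 1 / (1 - \<beta>)"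
  define C1 where "C1 = C * B"
  have \<alpha>: "\<alpha> > 0" using Lval_1_pos[OF f] \<beta> by (simp add: \<alpha>_def)
  have C1: "C1 \<ge> 0" using C B by (simp add: C1_def)
  let ?u = "wt (rho f) \<beta>"
  have U: "\<bar>psum ?u t - \<alpha> * t powr (1 - \<beta>)\<bar> \<le> C1 * t powr (1/2 - \<beta>)" if "t \<ge> 1" for t
    using U0[OF that] by (simp add: \<alpha>_def C1_def)
  define C2 where "C2 = \<alpha> + C1"
  have C2: "C2 > 0" using \<alpha> C1 by (simp add: C2_def)
  have U2: "psum ?u t \<le> C2 * t powr (1 - \<beta>)" if t: "t \<ge> 1" for t
  proof -
    have "C1 * t powr (1/2 - \<beta>) \<le> C1 * t powr (1 - \<beta>)"
      using t C1 by (intro mult_left_mono powr_mono) auto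
    thus ?thesis using U[OF t] unfolding C2_def distrib_right by linarith
  qed
  define D where "D = 1 / (1 - \<beta>)"
  have D: "D \<ge> 0" using \<beta> by (simp add: D_def)
  define C3 where "C3 = C1 * C2 + C2 * (2 * (6 + 2 * D) * B ^ 2) + \<alpha> * (72 * B ^ 2)"
  have C3: "C3 \<ge> 0" using \<alpha> C1 C2 D by (simp add: C3_def)
  define c where "c = 1 / (2 * \<alpha>)"
  have "Lval h 1 * Lval (\<lambda>n. h n * f n) 1 \<ge> c * p powr (- 64 * (1 - \<beta>))"
    if p: "p \<ge> max 1 (2 * C3)" and h: "real_char h" "bounded_sums h p" and hf: "bounded_sums (\<lambda>n. h n * f n) (B * p)" for h p
  proof -
    have p1: "p \<ge> 1" "p \<ge> 2 * C3" using p by auto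
    define x where "x = p powr 64"
    define y where "y = p powr 32"
    have xy: "y \<ge> 1" "y \<le> x" "x / y = y" unfolding x_def y_def using p1
      by (auto intro!: ge_one_powr_ge_zero powr_mono simp flip: powr_diff simp del: powr_numeral)
    have hfc: "real_char (\<lambda>n. h n * f n)" using h f by (intro real_char_mult)
    have hB: "bounded_sums h (B * p)" using h(2) by (rule bounded_sums_mono) (use B p1 in simp)
    have Bp: "B * p \<ge> 1" using B p1 mult_mono[of 1 B 1 p] by simp
    let ?v = "wt (\<lambda>m. h m * rho f m) \<beta>"
    have vconv: "psum (wt (\<lambda>m. h m * rho f m) s) t = psum (wt (dconv h (\<lambda>m. h m * f m)) s) t" for s t
      by (simp add: dconv_char_twist[OF h(1)])
    have V: "\<bar>psum (wt (\<lambda>m. h m * rho f m) s) t - Lval h s * Lval (\<lambda>n. h n * f n) s\<bar>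
        \<le> (6 + 2 * D') * (B * p) ^ 2 * t powr (1/2 - s)"
      if "0 < s" "s \<le> 1" "t \<ge> 1" "D' \<ge> 0" "psum (\<lambda>k. real k powr - s) (sqrt t) \<le> D' * sqrt t powr (1 - s)" for s t D'
      unfolding vconv using that by (intro dconv_chars_partial_sums h hfc hB hf Bp)
    have V1: "\<bar>psum ?v t - Lval h \<beta> * Lval (\<lambda>n. h n * f n) \<beta>\<bar> \<le> (6 + 2 * D) * (B * p) ^ 2 * t powr (1/2 - \<beta>)"
      if "t \<ge> 1" for t
      using \<beta> that D psum_powr_le[of \<beta> "sqrt t"] by (intro V) (auto simp: D_def)
    \<comment> \<open>In a difference of two partial sums the product of the L-values at
      \<open>\<beta>\<close> cancels, so its size never enters.\<close>
    define T where "T = 2 * (6 + 2 * D) * (B * p) ^ 2 * y powr (1/2 - \<beta>)"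
    have T: "\<bar>psum ?v t - psum ?v y\<bar> \<le> T" if "t \<ge> y" for t
    proof -
      have "(6 + 2 * D) * (B * p) ^ 2 * t powr (1/2 - \<beta>) \<le> (6 + 2 * D) * (B * p) ^ 2 * y powr (1/2 - \<beta>)"
        using that xy D \<beta> by (intro mult_left_mono powr_mono2') auto
      thus ?thesis using V1[of t] V1[of y] xy that unfolding T_def by linarith
    qed
    have main: "\<bar>psum (dconv ?u ?v) x - (\<Sum>m\<in>upto_real y. ?v m * (\<alpha> * (x / real m) powr (1 - \<beta>)))\<bar>
       \<le> (\<Sum>m\<in>upto_real y. \<bar>?v m\<bar> * (C1 * (x / real m) powr (1/2 - \<beta>))) + psum (\<lambda>k. \<bar>?u k\<bar>) (x / y) * T"
      using xy by (intro hyperbola_bound U T) auto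
    have lhs: "psum (dconv ?u ?v) x \<ge> 1"
      unfolding psum_dconv_wt[symmetric]
    proof (rule psum_ge_first)
      show "dconv (rho f) (\<lambda>m. h m * rho f m) 1 = 1"
        using rho_1[OF f(1)] h(1) by (simp add: dconv_def real_char_def)
    qed (use xy dconv_rho_nonneg[OF f(1) h(1)] in auto)
    have main_eq: "(\<Sum>m\<in>upto_real y. ?v m * (\<alpha> * (x / real m) powr (1 - \<beta>)))
       = \<alpha> * x powr (1 - \<beta>) * psum (wt (\<lambda>m. h m * rho f m) 1) y"
      unfolding sum_distrib_left
    proof (rule sum.cong[OF refl])
      fix m assume "m \<in> upto_real y"
      hence m: "real m > 0" by (simp add: upto_real_def)
      have "real m powr - \<beta> * (x / real m) powr (1 - \<beta>) = x powr (1 - \<beta>) * real m powr - 1"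
        using m xy by (simp add: powr_divide powr_diff powr_minus field_simps)
      thus "?v m * (\<alpha> * (x / real m) powr (1 - \<beta>)) = \<alpha> * x powr (1 - \<beta>) * wt (\<lambda>m. h m * rho f m) 1 m"
        by (simp add: algebra_simps)
    qed
    have e1: "(\<Sum>m\<in>upto_real y. \<bar>?v m\<bar> * (C1 * (x / real m) powr (1/2 - \<beta>))) \<le> C1 * C2 * p powr (- 1)"
    proof -
      have "(\<Sum>m\<in>upto_real y. \<bar>?v m\<bar> * (C1 * (x / real m) powr (1/2 - \<beta>)))
         \<le> (\<Sum>m\<in>upto_real y. C1 * x powr (1/2 - \<beta>) * y powr (\<beta> - 1/2) * ?u m)"
      proof (rule sum_mono)
        fix m assume "m \<in> upto_real y"
        hence m: "m > 0" "real m \<le> y" by (auto simp: upto_real_def)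
        have "\<bar>?v m\<bar> \<le> ?u m"
          using rho_nonneg[OF f(1) m(1)] real_char_abs_le[OF h(1), of m]
            mult_right_mono[of "\<bar>h m\<bar>" 1 "rho f m * real m powr - \<beta>"] by (simp add: abs_mult mult.assoc)
        moreover have "(x / real m) powr (1/2 - \<beta>) = x powr (1/2 - \<beta>) * real m powr (\<beta> - 1/2)"
        proof -
          have "real m powr (\<beta> - 1/2) = inverse (real m powr (1/2 - \<beta>))"
            using powr_minus[of "real m" "1/2 - \<beta>"] by simp
          moreover have "(x / real m) powr (1/2 - \<beta>) = x powr (1/2 - \<beta>) / real m powr (1/2 - \<beta>)"
            by (rule powr_divide)
          ultimately show ?thesis by (simp only: divide_inverse)
        qed
        moreover have "real m powr (\<beta> - 1/2) \<le> y powr (\<beta> - 1/2)"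
          using m \<beta> by (intro powr_mono2) auto
        ultimately show "\<bar>?v m\<bar> * (C1 * (x / real m) powr (1/2 - \<beta>)) \<le> C1 * x powr (1/2 - \<beta>) * y powr (\<beta> - 1/2) * ?u m"
          using C1 mult_mono[of "\<bar>?v m\<bar>" "?u m" "C1 * x powr (1/2 - \<beta>) * real m powr (\<beta> - 1/2)" "C1 * x powr (1/2 - \<beta>) * y powr (\<beta> - 1/2)"]
          by (simp add: mult_ac mult_left_mono)
      qed
      also have "\<dots> = C1 * (x powr (1/2 - \<beta>) * y powr (\<beta> - 1/2)) * psum ?u y"
        by (simp add: sum_distrib_left mult_ac)
      also have "\<dots> \<le> C1 * (x powr (1/2 - \<beta>) * y powr (\<beta> - 1/2)) * (C2 * y powr (1 - \<beta>))"
        using C1 U2[of y] xy by (intro mult_left_mono) auto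
      also have "\<dots> = C1 * C2 * (x powr (1/2 - \<beta>) * y powr (\<beta> - 1/2) * y powr (1 - \<beta>))" by simp
      also have "x powr (1/2 - \<beta>) * y powr (\<beta> - 1/2) * y powr (1 - \<beta>) = p powr (48 - 64 * \<beta>)"
        unfolding x_def y_def powr_powr powr_add[symmetric] by (rule arg_cong[of _ _ "(powr) p"]) simp
      \<comment> \<open>Here \<open>15/16 \<le> \<beta>\<close> enters: the exponent is at most -12,
        and the exponents \<open>50 - 64 * \<beta>\<close> and \<open>54 - 64 * \<beta>\<close> of
        the other two errors are at most -10 and -6.\<close>
      also have "C1 * C2 * p powr (48 - 64 * \<beta>) \<le> C1 * C2 * p powr (- 1)"
        using C1 C2 p1 \<beta> by (intro mult_left_mono powr_mono) auto
      finally show ?thesis .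
    qed
    have e2: "psum (\<lambda>k. \<bar>?u k\<bar>) (x / y) * T \<le> C2 * (2 * (6 + 2 * D) * B ^ 2) * p powr (- 1)"
    proof -
      have T0: "T \<ge> 0" using D by (simp add: T_def)
      have "psum (\<lambda>k. \<bar>?u k\<bar>) (x / y) = psum ?u y"
        using rho_nonneg[OF f(1)] unfolding xy by (intro sum.cong refl) (auto simp: upto_real_def)
      also have "\<dots> \<le> C2 * y powr (1 - \<beta>)" using xy by (intro U2)
      finally have "psum (\<lambda>k. \<bar>?u k\<bar>) (x / y) * T \<le> C2 * y powr (1 - \<beta>) * T"
        using T0 by (rule mult_right_mono)
      also have "\<dots> = C2 * (2 * (6 + 2 * D) * B ^ 2) * (y powr (1 - \<beta>) * p powr 2 * y powr (1/2 - \<beta>))"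
        using p1 by (simp add: T_def power_mult_distrib)
      also have "y powr (1 - \<beta>) * p powr 2 * y powr (1/2 - \<beta>) = p powr (50 - 64 * \<beta>)"
        unfolding y_def powr_powr powr_add[symmetric] by (rule arg_cong[of _ _ "(powr) p"]) simp
      also have "C2 * (2 * (6 + 2 * D) * B ^ 2) * p powr (50 - 64 * \<beta>) \<le> C2 * (2 * (6 + 2 * D) * B ^ 2) * p powr (- 1)"
        using C2 D p1 \<beta> by (intro mult_left_mono powr_mono) auto
      finally show ?thesis .
    qed
    have e3: "\<alpha> * x powr (1 - \<beta>) * psum (wt (\<lambda>m. h m * rho f m) 1) y
        \<le> \<alpha> * x powr (1 - \<beta>) * (Lval h 1 * Lval (\<lambda>n. h n * f n) 1) + \<alpha> * (72 * B ^ 2) * p powr (- 1)"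
    proof -
      define D' where "D' = 1 + ln y"
      \<comment> \<open>At \<open>s = 1\<close> the power sum is logarithmic. Since
        \<open>y powr (1/8) = p powr 4\<close>, the factor \<open>6 + 2 * D' = 8 + 2 * ln y\<close>
        is at most \<open>24 * p powr 4\<close>.\<close>
      have ln: "0 \<le> ln y" "ln y \<le> 8 * y powr (1/8)" using ln_powr_bound[of y "1/8"] xy by auto
      have y18: "y powr (1/8) = p powr 4" unfolding y_def powr_powr by simp
      have p4: "p powr 4 \<ge> 1" using p1 by (intro ge_one_powr_ge_zero) auto
      have "psum (\<lambda>k. real k powr - 1) (sqrt y) \<le> 1 + ln (sqrt y)" using xy by (intro psum_inverse_le) auto
      also have "\<dots> \<le> D' * sqrt y powr (1 - 1)" using xy ln by (simp add: D'_def ln_sqrt)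
      finally have "\<bar>psum (wt (\<lambda>m. h m * rho f m) 1) y - Lval h 1 * Lval (\<lambda>n. h n * f n) 1\<bar>
        \<le> (6 + 2 * D') * (B * p) ^ 2 * y powr (1/2 - 1)"
        using xy ln by (intro V) (auto simp: D'_def)
      also have "\<dots> \<le> (24 * p powr 4) * (B * p) ^ 2 * y powr (1/2 - 1)"
        using ln y18 p4 by (intro mult_right_mono) (auto simp: D'_def)
      also have "\<dots> = (24 * B ^ 2) * (p powr 4 * p powr 2 * y powr (1/2 - 1))"
        using p1 by (simp add: power_mult_distrib mult_ac)
      also have "p powr 4 * p powr 2 * y powr (1/2 - 1) = p powr (- 10)"
        unfolding y_def powr_powr powr_add[symmetric] by (rule arg_cong[of _ _ "(powr) p"]) simp
      finally have "psum (wt (\<lambda>m. h m * rho f m) 1) y \<le> Lval h 1 * Lval (\<lambda>n. h n * f n) 1 + 24 * B ^ 2 * p powr (- 10)"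
        by linarith
      hence "\<alpha> * x powr (1 - \<beta>) * psum (wt (\<lambda>m. h m * rho f m) 1) y
         \<le> \<alpha> * x powr (1 - \<beta>) * (Lval h 1 * Lval (\<lambda>n. h n * f n) 1 + 24 * B ^ 2 * p powr (- 10))"
        using \<alpha> by (intro mult_left_mono) auto
      also have "\<dots> = \<alpha> * x powr (1 - \<beta>) * (Lval h 1 * Lval (\<lambda>n. h n * f n) 1)
          + \<alpha> * (24 * B ^ 2) * (x powr (1 - \<beta>) * p powr (- 10))" by (simp add: algebra_simps)
      also have "x powr (1 - \<beta>) * p powr (- 10) = p powr (54 - 64 * \<beta>)"
        unfolding x_def powr_powr powr_add[symmetric] by (rule arg_cong[of _ _ "(powr) p"]) simp
      also have "\<alpha> * (24 * B ^ 2) * p powr (54 - 64 * \<beta>) \<le> \<alpha> * (72 * B ^ 2) * p powr (- 1)"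
        using \<alpha> p1 \<beta> by (intro mult_mono powr_mono) auto
      finally show ?thesis by simp
    qed
    have "1 \<le> \<alpha> * x powr (1 - \<beta>) * (Lval h 1 * Lval (\<lambda>n. h n * f n) 1) + C3 * p powr (- 1)"
      using main lhs e1 e2 e3 unfolding main_eq C3_def distrib_right by linarith
    moreover have "C3 * p powr (- 1) \<le> 1 / 2" using p1 by (simp add: powr_minus field_simps)
    ultimately have "1 / 2 \<le> \<alpha> * x powr (1 - \<beta>) * (Lval h 1 * Lval (\<lambda>n. h n * f n) 1)" by linarith
    hence "(1 / 2) * (p powr (- 64 * (1 - \<beta>)) / \<alpha>) \<le> \<alpha> * x powr (1 - \<beta>) * (Lval h 1 * Lval (\<lambda>n. h n * f n) 1) * (p powr (- 64 * (1 - \<beta>)) / \<alpha>)"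
      using \<alpha> by (intro mult_right_mono) auto
    also have "\<dots> = (x powr (1 - \<beta>) * p powr (- 64 * (1 - \<beta>))) * (Lval h 1 * Lval (\<lambda>n. h n * f n) 1)"
      using \<alpha> by simp
    also have "x powr (1 - \<beta>) * p powr (- 64 * (1 - \<beta>)) = 1"
      unfolding x_def powr_powr powr_add[symmetric] using p1 by simp
    finally show ?thesis by (simp add: c_def)
  qed
  moreover have "c > 0" using \<alpha> by (simp add: c_def)
  ultimately show ?thesis by blast
qed

section \<open>The Legendre character\<close>

lemma bij_betw_mult_mod:
  fixes a N :: nat
  assumes "coprime a N" "N > 0"
  shows "bij_betw (\<lambda>n. a * n mod N) {..<N} {..<N}"
proof -
  have "inj_on (\<lambda>n. a * n mod N) {..<N}"
  proof (rule inj_onI)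
    fix m n assume mn: "m \<in> {..<N}" "n \<in> {..<N}" "a * m mod N = a * n mod N"
    hence "[a * m = a * n] (mod N)" unfolding Cong.cong_def by blast
    hence "[m = n] (mod N)" using assms cong_mult_lcancel_nat[of a N m n] by blast
    thus "m = n" using mn by (simp add: Cong.cong_def)
  qed
  moreover have "(\<lambda>n. a * n mod N) ` {..<N} \<subseteq> {..<N}" using assms by auto
  ultimately show ?thesis using endo_inj_surj[of "{..<N}"] by (simp add: bij_betw_def)
qed

lemma periodic_mod:
  fixes f :: "nat \<Rightarrow> 'a"
  assumes "\<And>n. f (n + N) = f n"
  shows "f (n mod N) = f n"
proof -
  have "f (m + k * N) = f m" for m k
  proof (induction k)
    case (Suc k)
    have "m + Suc k * N = (m + k * N) + N" by simp
    thus ?case using Suc assms by metis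
  qed simp
  from this[of "n mod N" "n div N"] show ?thesis by simp
qed

text \<open>Multiplication by \<open>a\<close> permutes the residues and changes the sign of
  \<open>f\<close>, so the sum over a full period equals its own negative and vanishes. Initial sums
  therefore reduce to fewer than \<open>N\<close> terms.\<close>

lemma bounded_sums_periodic:
  assumes f: "real_char f" and per: "\<And>n. f (n + N) = f n" and N: "N > 0"
    and a: "coprime a N" "f a = -1"
  shows "bounded_sums f (real N)"
proof -
  have "(\<Sum>n<N. f n) = (\<Sum>n<N. f (a * n mod N))"
    by (rule sum.reindex_bij_betw[symmetric]) (rule bij_betw_mult_mod[OF a(1) N])
  also have "\<dots> = (\<Sum>n<N. - f n)"
    using f a by (intro sum.cong) (auto simp: periodic_mod[of f N, OF per] real_char_def)
  finally have zero: "(\<Sum>n<N. f n) = 0" by (simp add: sum_negf)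
  have block: "(\<Sum>k=m..<m+N. f k) = 0" for m
  proof (induction m)
    case 0 then show ?case using zero by (simp add: atLeast0LessThan)
  next
    case (Suc m)
    have "(\<Sum>k=Suc m..<Suc m + N. f k) + f m = (\<Sum>k=m..<m+N. f k) + f (m + N)"
      using N sum.atLeast_Suc_lessThan[of m "m + N" f] by simp
    thus ?case using Suc per by simp
  qed
  have "\<bar>\<Sum>k=1..n. f k\<bar> \<le> real N" for n
  proof (induction n rule: less_induct)
    case (less n)
    show ?case
    proof (cases "n < N")
      case True
      have "\<bar>\<Sum>k=1..n. f k\<bar> \<le> (\<Sum>k=1..n. 1)"
        by (intro order.trans[OF sum_abs] sum_mono real_char_abs_le f)
      thus ?thesis using True by simp
    next
      case False
      have "(\<Sum>k=1..n. f k) = (\<Sum>k=1..n-N. f k) + (\<Sum>k=Suc(n-N)..<Suc(n-N)+N. f k)"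
      proof -
        have "{Suc (n - N)..<Suc (n - N) + N} = {Suc (n - N)..n}" using False by auto
        thus ?thesis using sum.ub_add_nat[of 1 "n - N" f N] False by simp
      qed
      thus ?thesis using block[of "Suc (n - N)"] less.IH[of "n - N"] N False by linarith
    qed
  qed
  thus ?thesis by (simp add: bounded_sums_def)
qed

section \<open>The Legendre symbol as a real character\<close>

definition chi :: "nat \<Rightarrow> nat \<Rightarrow> real" where
  "chi p n = real_of_int (Legendre (int n) (int p))"

lemma Legendre_in: "Legendre a p \<in> {-1, 0, 1}"
  by (simp add: Legendre_def)

text \<open>Euler's criterion gives the identity modulo \<open>p\<close>; both sides lie in {-1, 0,
  1}, so they differ by at most 2, which is less than \<open>p\<close>.\<close>

lemma Legendre_mult:
  assumes p: "prime p" "p > 2"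
  shows "Legendre (a * b) (int p) = Legendre a (int p) * Legendre b (int p)"
proof -
  have "[Legendre (a * b) (int p) = Legendre a (int p) * Legendre b (int p)] (mod int p)"
    using euler_criterion[OF p, of "a * b"] cong_mult[OF euler_criterion[OF p, of a] euler_criterion[OF p, of b]]
    by (metis cong_sym cong_trans power_mult_distrib)
  hence dvd: "int p dvd Legendre (a * b) (int p) - Legendre a (int p) * Legendre b (int p)"
    by (simp add: cong_iff_dvd_diff)
  have "\<bar>Legendre (a * b) (int p) - Legendre a (int p) * Legendre b (int p)\<bar> < int p"
    using Legendre_in[of "a * b" p] Legendre_in[of a p] Legendre_in[of b p] p(2) by auto
  thus ?thesis
    using dvd dvd_imp_le_int[of "Legendre (a * b) (int p) - Legendre a (int p) * Legendre b (int p)" "int p"] by force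
qed

lemma Legendre_cong: "[a = b] (mod p) \<Longrightarrow> Legendre a p = Legendre b p"
  by (simp add: Legendre_def QuadRes_def Cong.cong_def)

lemma Legendre_1: "p > 1 \<Longrightarrow> Legendre 1 (int p) = 1"
proof -
  assume p: "p > 1"
  have "\<not> [1 = 0] (mod int p)" using p by (simp add: cong_0_iff)
  moreover have "QuadRes (int p) 1" unfolding QuadRes_def by (rule exI[of _ 1]) simp
  ultimately show ?thesis by (simp add: Legendre_def)
qed

lemma real_char_chi:
  assumes p: "prime p" "p > 2"
  shows "real_char (chi p)"
  unfolding real_char_def
proof (intro conjI allI)
  show "chi p 1 = 1" using p Legendre_1[of p] by (simp add: chi_def)
  show "chi p (m * n) = chi p m * chi p n" for m n
    by (simp add: chi_def Legendre_mult[OF p])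
  show "chi p n \<in> {-1, 0, 1}" for n
    using Legendre_in[of "int n" "int p"] by (auto simp: chi_def)
qed

lemma chi_periodic: "chi p (n + p) = chi p n"
proof -
  have "[int (n + p) = int n] (mod int p)" unfolding Cong.cong_def by simp
  thus ?thesis unfolding chi_def by (simp only: Legendre_cong)
qed

lemma chi_eq_0_iff: "chi p n = 0 \<longleftrightarrow> p dvd n"
  by (auto simp: chi_def Legendre_def cong_0_iff)

text \<open>Since \<open>p - 1\<close> and 1 have the same square, the nonzero squares are already
  attained on \<open>{1..<p-1}\<close>, which has too few elements to cover all nonzero
  residues.\<close>

lemma exists_nonresidue:
  assumes p: "prime p" "p > 2"
  shows "\<exists>a>0. coprime a p \<and> chi p a = -1"
proof (rule ccontr)
  assume *: "\<not> ?thesis"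
  have sq: "{1..<p} \<subseteq> (\<lambda>x. x ^ 2 mod p) ` {1..<p-1}"
  proof
    fix a assume a: "a \<in> {1..<p}"
    hence nd: "\<not> p dvd a" by (auto dest: dvd_imp_le)
    hence "coprime a p" using p prime_imp_coprime coprime_commute by blast
    hence "Legendre (int a) (int p) = 1"
      using * a Legendre_in[of "int a" "int p"] nd chi_eq_0_iff[of p a] by (auto simp: chi_def)
    then obtain y where y: "[y ^ 2 = int a] (mod int p)"
      by (auto simp: Legendre_def QuadRes_def split: if_splits)
    define x where "x = nat (y mod int p)"
    have x: "int x = y mod int p" "x < p" using p by (auto simp: x_def nat_less_iff)
    have "int x ^ 2 mod int p = int a mod int p" using y unfolding x Cong.cong_def by (simp add: power_mod)
    hence "int (x ^ 2 mod p) = int (a mod p)" by (simp only: of_nat_mod of_nat_power)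
    hence xm: "x ^ 2 mod p = a" using a by simp
    have "x > 0" using xm a by (cases x) auto
    show "a \<in> (\<lambda>x. x ^ 2 mod p) ` {1..<p-1}"
    proof (cases "x = p - 1")
      case False
      thus ?thesis using xm x \<open>x > 0\<close> by (intro image_eqI[of _ _ x]) auto
    next
      case True
      have "(int p - 1) ^ 2 = 1 + int p * (int p - 2)" by (simp add: power2_eq_square algebra_simps)
      hence "(int p - 1) ^ 2 mod int p = 1 mod int p" by simp
      hence "int (x ^ 2 mod p) = int (1 mod p)" using True p by (simp add: of_nat_mod of_nat_diff)
      hence "a = 1" using xm p by simp
      thus ?thesis using p by (intro image_eqI[of _ _ 1]) auto
    qed
  qed
  have "card {1..<p} \<le> card {1..<p-1}"
    using card_mono[OF _ sq] card_image_le[of "{1..<p-1}" "\<lambda>x. x ^ 2 mod p"] by simp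
  thus False using p by simp
qed

lemma bounded_sums_chi:
  assumes p: "prime p" "p > 2"
  shows "bounded_sums (chi p) (real p)"
proof -
  obtain a where "coprime a p" "chi p a = -1" using exists_nonresidue[OF p] by blast
  thus ?thesis using p
    by (intro bounded_sums_periodic[of "chi p" p a] real_char_chi chi_periodic) auto
qed

text \<open>The Chinese remainder theorem supplies an \<open>a\<close> that is a non-residue modulo
  \<open>p\<close> and congruent to 1 modulo \<open>q\<close>; there the product character is -1, so
  the argument for periodic functions applies with period \<open>p * q\<close>.\<close>

lemma bounded_sums_chi_mult:
  assumes p: "prime p" "p > 2" and q: "prime q" "q > 2" and "p \<noteq> q"
  shows "bounded_sums (\<lambda>n. chi p n * chi q n) (real p * real q)"
proof -
  obtain b where b: "coprime b p" "chi p b = -1" using exists_nonresidue[OF p] by blast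
  have pq: "coprime p q" using assms by (simp add: primes_coprime)
  obtain a where a: "[a = b] (mod p)" "[a = 1] (mod q)"
    using binary_chinese_remainder_nat[OF pq, of b 1] by blast
  have ca: "chi p a = chi p b" "chi q a = chi q 1"
    using a Legendre_cong[of "int a" "int b" "int p"] Legendre_cong[of "int a" "int 1" "int q"]
    by (simp_all only: chi_def cong_int_iff)
  hence c0: "chi p a = -1" "chi q a = 1"
    using b(2) real_char_chi[OF q] by (auto simp: real_char_def)
  hence "\<not> p dvd a" "\<not> q dvd a" using chi_eq_0_iff by (metis zero_neq_neg_one zero_neq_one)+
  hence c: "coprime a p" "coprime a q"
    using p(1) q(1) prime_imp_coprime coprime_commute by blast+
  have "chi p (n + p * q) = chi p n" "chi q (n + p * q) = chi q n" for n
    using periodic_mod[of "chi p" p, OF chi_periodic, of "n + p * q"] periodic_mod[of "chi p" p, OF chi_periodic, of n]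
      periodic_mod[of "chi q" q, OF chi_periodic, of "n + p * q"] periodic_mod[of "chi q" q, OF chi_periodic, of n]
    by simp_all
  hence "bounded_sums (\<lambda>n. chi p n * chi q n) (real (p * q))"
    using c c0 assms by (intro bounded_sums_periodic real_char_mult real_char_chi) auto
  thus ?thesis by simp
qed

section \<open>The Polya-Vinogradov inequality\<close>

text \<open>Up to \<open>pi / 3\<close> the cosine is at least 1/2; beyond, the sine is at least
  \<open>sqrt 3 / 2\<close>, which exceeds \<open>pi / 4\<close>.\<close>

lemma sin_ge_half:
  assumes "0 \<le> x" "x \<le> pi / 2"
  shows "sin x \<ge> x / 2"
proof (cases "x \<le> pi / 3")
  case True
  show ?thesis
  proof (cases "x = 0")
    case False
    then obtain z where z: "z > 0" "z < x" "sin x - sin 0 = (x - 0) * cos z"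
      using MVT2[of 0 x sin cos] assms by auto
    have "cos z \<ge> cos (pi / 3)" using z True by (intro cos_monotone_0_pi_le) auto
    thus ?thesis using z assms mult_left_mono[of "1/2" "cos z" x] by (simp add: cos_60)
  qed simp
next
  case False
  have "sin x \<ge> sin (pi / 3)" using False assms by (intro sin_monotone_2pi_le) auto
  moreover have "17 / 10 \<le> sqrt 3" by (rule real_le_rsqrt) (simp add: power2_eq_square)
  ultimately show ?thesis using assms pi_less_4 pi_approx by (simp add: sin_60)
qed

text \<open>The sum is at most \<open>2 / norm (w - 1)\<close>, and
  \<open>norm (w - 1) = 2 * \<bar>sin t\<bar>\<close> is governed by the distance of
  \<open>j\<close> to the nearer of 0 and \<open>p\<close>. Adding the reciprocals of both distances
  replaces the minimum by an expression that sums over \<open>j\<close> to two harmonic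
  sums.\<close>

lemma norm_geometric_sum_cis_le:
  fixes j p n :: nat
  assumes j: "0 < j" "j < p"
  defines "w \<equiv> cis (2 * pi * real j / real p)"
  shows "norm (\<Sum>k=1..n. w ^ k) \<le> real p * (1 / real j + 1 / real (p - j))"
proof -
  define t where "t = pi * real j / real p"
  have d: "norm (w - 1) = 2 * \<bar>sin t\<bar>"
    using dist_exp_i_1[of "2 * t"] by (simp add: w_def t_def cis_conv_exp mult_ac)
  have s: "sin t \<ge> 1 / (real p * (1 / real j + 1 / real (p - j)))" and spos: "sin t > 0"
  proof -
    have m: "sin t \<ge> real m / real p" if "m = j \<or> m = p - j" "2 * m \<le> p" for m
    proof -
      have "sin t = sin (pi * real m / real p)"
      proof (cases "m = j")
        case False
        hence "pi * real m / real p = pi - t" using that j by (simp add: t_def of_nat_diff field_simps)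
        thus ?thesis by simp
      qed (simp add: t_def)
      also have "\<dots> \<ge> (pi * real m / real p) / 2"
        using that j by (intro sin_ge_half) (auto simp: field_simps)
      also have "(pi * real m / real p) / 2 \<ge> real m / real p"
        using pi_ge_two j mult_right_mono[of 2 pi "real m"] by (simp add: field_simps)
      finally show ?thesis .
    qed
    have key: "\<exists>m>0. sin t \<ge> real m / real p \<and> (m = j \<or> m = p - j)"
    proof (cases "2 * j \<le> p")
      case True thus ?thesis using m[of j] j by auto
    next
      case False thus ?thesis using m[of "p - j"] j by (intro exI[of _ "p - j"]) auto
    qed
    then obtain m where m: "m > 0" "sin t \<ge> real m / real p" "m = j \<or> m = p - j" by blast
    have "1 / real m \<le> 1 / real j + 1 / real (p - j)" using m j by auto
    hence "real p * (1 / real m) \<le> real p * (1 / real j + 1 / real (p - j))" by (intro mult_left_mono) auto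
    hence "1 / (real p * (1 / real j + 1 / real (p - j))) \<le> 1 / (real p * (1 / real m))"
      using m j by (intro divide_left_mono mult_pos_pos add_pos_pos) auto
    also have "\<dots> = real m / real p" by simp
    finally show "sin t \<ge> 1 / (real p * (1 / real j + 1 / real (p - j)))" using m by linarith
    show "sin t > 0" using m j by (auto intro: less_le_trans[OF _ m(2)])
  qed
  have "w \<noteq> 1" using d spos by auto
  have "(w - 1) * (\<Sum>k=1..n. w ^ k) = w ^ Suc n - w" 
    by (induction n) (simp_all add: algebra_simps)
  hence "norm (w - 1) * norm (\<Sum>k=1..n. w ^ k) \<le> 2"
  proof -
    assume "(w - 1) * (\<Sum>k=1..n. w ^ k) = w ^ Suc n - w"
    moreover have "norm (w ^ Suc n) = 1" "norm w = 1"
      unfolding norm_power by (simp_all add: w_def)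
    ultimately show ?thesis using norm_triangle_ineq4[of "w ^ Suc n" w]
      by (simp only: norm_mult[symmetric] one_add_one)
  qed
  hence "norm (\<Sum>k=1..n. w ^ k) \<le> 1 / sin t" using d spos by (simp add: field_simps)
  also have "\<dots> \<le> 1 / (1 / (real p * (1 / real j + 1 / real (p - j))))"
    using s spos j by (intro divide_left_mono mult_pos_pos divide_pos_pos add_pos_pos) auto
  finally show ?thesis by simp
qed

lemma sum_powers_root_of_unity:
  fixes w :: complex
  assumes "w ^ p = 1"
  shows "(\<Sum>a<p. w ^ a) = (if w = 1 then of_nat p else 0)"
  using assms by (auto simp: geometric_sum)

text \<open>The finite Fourier transform \<open>S\<close> of \<open>chi p\<close> is
  \<open>chi p\<close> times the Gauss sum \<open>S 1\<close>, which has absolute value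
  \<open>sqrt p\<close>. Multiplying an incomplete sum by \<open>S 1\<close> thus turns it into a
  combination of geometric sums, of total size \<open>p\<close> times a logarithm.\<close>

lemma polya_vinogradov:
  assumes p: "prime p" "p > 2"
  shows "bounded_sums (chi p) (2 * sqrt (real p) * (1 + ln (real p)))"
proof -
  define z where "z = cis (2 * pi / real p)"
  define S where "S = (\<lambda>a. \<Sum>k<p. of_real (chi p k) * z ^ (a * k))"
  have p0: "p > 0" using p by simp
  have zp: "z ^ p = 1" using p0 by (simp add: z_def Complex.DeMoivre)
  have zpow: "z ^ k = cis (2 * pi * real k / real p)" for k
    by (simp add: z_def Complex.DeMoivre field_simps)
  have zmod: "z ^ (k mod p) = z ^ k" for k
    by (rule periodic_mod) (simp add: power_add zp)
  have nz: "norm (z ^ k) = 1" for k by (simp add: zpow)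
  have zinj: "k = l" if "z ^ k = z ^ l" "k < p" "l < p" for k l
    using bij_betw_imp_inj_on[OF Complex.bij_betw_roots_unity[OF p0]] that
    by (auto simp: inj_on_def zpow)
  have sumchi: "(\<Sum>k<p. chi p k) = 0"
  proof -
    obtain a where a: "coprime a p" "chi p a = -1" using exists_nonresidue[OF p] by blast
    have "(\<Sum>n<p. chi p n) = (\<Sum>n<p. chi p (a * n mod p))"
      by (rule sum.reindex_bij_betw[symmetric]) (rule bij_betw_mult_mod[OF a(1) p0])
    also have "\<dots> = (\<Sum>n<p. - chi p n)"
      using a real_char_chi[OF p]
      by (intro sum.cong) (auto simp: periodic_mod[of "chi p" p, OF chi_periodic] real_char_def)
    finally show ?thesis by (simp add: sum_negf)
  qed
  have Sa: "S a = of_real (chi p a) * S 1" for a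
  proof (cases "p dvd a")
    case True
    then obtain b where "a = p * b" by blast
    hence "z ^ (a * k) = 1" for k by (simp add: power_mult zp)
    hence "S a = of_real (\<Sum>k<p. chi p k)" by (simp add: S_def)
    thus ?thesis using sumchi True chi_eq_0_iff[of p a] by simp
  next
    case False
    hence cop: "coprime a p" using p prime_imp_coprime coprime_commute by blast
    have "S 1 = (\<Sum>k<p. of_real (chi p (a * k mod p)) * z ^ (1 * (a * k mod p)))"
      unfolding S_def by (rule sum.reindex_bij_betw[symmetric]) (rule bij_betw_mult_mod[OF cop p0])
    also have "\<dots> = (\<Sum>k<p. of_real (chi p a) * (of_real (chi p k) * z ^ (a * k)))"
      using real_char_chi[OF p]
      by (intro sum.cong) (auto simp: zmod periodic_mod[of "chi p" p, OF chi_periodic] real_char_def)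
    also have "\<dots> = of_real (chi p a) * S a" by (simp add: S_def sum_distrib_left)
    finally have "of_real (chi p a) * S 1 = of_real (chi p a * chi p a) * S a" by simp
    moreover have "chi p a * chi p a = 1"
      using False chi_eq_0_iff[of p a] real_char_cases[OF real_char_chi[OF p], of a] by auto
    ultimately show ?thesis by simp
  qed
  \<comment> \<open>The sum of the squares of the absolute values is computed twice: orthogonality
    gives \<open>p\<close> times the sum of \<open>chi p k ^ 2\<close>, and \<open>Sa\<close> gives
    \<open>(norm (S 1))\<^sup>2\<close> times the same sum, which is positive and cancels.\<close>
  have parseval: "(\<Sum>a<p. S a * cnj (S a)) = of_nat p * of_real (\<Sum>k<p. chi p k ^ 2)"
  proof -
    have "(\<Sum>a<p. S a * cnj (S a))
       = (\<Sum>a<p. \<Sum>k<p. \<Sum>l<p. of_real (chi p k * chi p l) * (z ^ k * cnj (z ^ l)) ^ a)"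
      unfolding S_def cnj_sum sum_product
      by (intro sum.cong refl) (simp add: power_mult_distrib mult_ac flip: power_mult)
    also have "\<dots> = (\<Sum>k<p. \<Sum>l<p. \<Sum>a<p. of_real (chi p k * chi p l) * (z ^ k * cnj (z ^ l)) ^ a)"
      by (subst sum.swap, intro sum.cong refl sum.swap)
    also have "\<dots> = (\<Sum>k<p. \<Sum>l<p. if k = l then of_real (chi p k * chi p l) * of_nat p else 0)"
    proof (intro sum.cong refl)
      fix k l assume kl: "k \<in> {..<p}" "l \<in> {..<p}"
      let ?w = "z ^ k * cnj (z ^ l)"
      have "(z ^ m) ^ p = 1" for m using zp by (metis mult.commute power_mult power_one)
      hence w1: "?w ^ p = 1" by (simp add: power_mult_distrib flip: complex_cnj_power)
      have "?w = 1 \<longleftrightarrow> k = l"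
      proof
        assume "?w = 1"
        hence "z ^ k * (cnj (z ^ l) * z ^ l) = z ^ l" by (simp only: mult.assoc[symmetric] mult_1_left)
        moreover have "cnj (z ^ l) * z ^ l = 1"
          using complex_norm_square[of "z ^ l"] nz[of l] by (simp add: mult.commute)
        ultimately have "z ^ k = z ^ l" by (simp only: mult_1_right)
        thus "k = l" using kl by (intro zinj) auto
      next
        assume "k = l"
        thus "?w = 1" using complex_norm_square[of "z ^ l"] nz[of l] by simp
      qed
      thus "(\<Sum>a<p. of_real (chi p k * chi p l) * ?w ^ a) = (if k = l then of_real (chi p k * chi p l) * of_nat p else 0)"
        unfolding sum_distrib_left[symmetric] sum_powers_root_of_unity[OF w1] by simp
    qed
    also have "\<dots> = (\<Sum>k<p. of_real (chi p k * chi p k) * of_nat p)"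
      by (intro sum.cong refl) (simp add: sum.delta)
    finally show ?thesis by (simp add: sum_distrib_left power2_eq_square mult_ac)
  qed
  have "(\<Sum>a<p. S a * cnj (S a)) = of_real (\<Sum>a<p. chi p a ^ 2) * (S 1 * cnj (S 1))"
    unfolding of_real_sum sum_distrib_right
  proof (intro sum.cong refl)
    show "S a * cnj (S a) = of_real (chi p a ^ 2) * (S 1 * cnj (S 1))" for a
      unfolding Sa[of a] by (simp add: power2_eq_square mult_ac)
  qed
  hence "of_real (\<Sum>a<p. chi p a ^ 2) * of_real ((norm (S 1))\<^sup>2) = (of_nat p * of_real (\<Sum>k<p. chi p k ^ 2) :: complex)"
    using parseval by (simp only: complex_norm_square)
  hence eq: "(\<Sum>a<p. chi p a ^ 2) * (norm (S 1))\<^sup>2 = real p * (\<Sum>k<p. chi p k ^ 2)"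
    by (metis (no_types, lifting) of_real_eq_iff of_real_mult of_real_of_nat_eq)
  have "(\<Sum>a<p. chi p a ^ 2) \<ge> (\<Sum>a\<in>{1}. chi p a ^ 2)"
    using p by (intro sum_mono2) auto
  hence "(\<Sum>a<p. chi p a ^ 2) > 0" using real_char_chi[OF p] by (simp add: real_char_def)
  hence "(norm (S 1))\<^sup>2 = real p" using eq by simp
  hence tau: "norm (S 1) = sqrt (real p)" by (metis norm_ge_zero real_sqrt_unique)
  show ?thesis
    unfolding bounded_sums_def
  proof
    fix n
    have "\<bar>\<Sum>k=1..n. chi p k\<bar> * sqrt (real p) = norm (of_real (\<Sum>k=1..n. chi p k) * S 1)"
      unfolding norm_mult tau norm_of_real ..
    also have "of_real (\<Sum>k=1..n. chi p k) * S 1 = (\<Sum>k=1..n. S k)"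
      by (simp only: of_real_sum sum_distrib_right Sa[symmetric])
    also have "\<dots> = (\<Sum>j<p. of_real (chi p j) * (\<Sum>k=1..n. (z ^ j) ^ k))"
      unfolding S_def by (subst sum.swap) (simp add: sum_distrib_left mult.commute flip: power_mult)
    also have "norm \<dots> \<le> (\<Sum>j<p. norm (of_real (chi p j) * (\<Sum>k=1..n. (z ^ j) ^ k)))"
      by (rule norm_sum)
    also have "\<dots> = (\<Sum>j\<in>{1..<p}. norm (of_real (chi p j) * (\<Sum>k=1..n. (z ^ j) ^ k)))"
      using chi_eq_0_iff[of p 0] by (intro sum.mono_neutral_right) (auto simp: not_less_eq_eq)
    also have "\<dots> \<le> (\<Sum>j\<in>{1..<p}. real p * (1 / real j + 1 / real (p - j)))"
    proof (rule sum_mono)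
      fix j assume j: "j \<in> {1..<p}"
      have "norm (of_real (chi p j) * (\<Sum>k=1..n. (z ^ j) ^ k)) \<le> 1 * norm (\<Sum>k=1..n. (z ^ j) ^ k)"
        unfolding norm_mult using real_char_abs_le[OF real_char_chi[OF p], of j] by (intro mult_right_mono) auto
      also have "\<dots> \<le> real p * (1 / real j + 1 / real (p - j))"
        using norm_geometric_sum_cis_le[of j p n] j by (simp add: zpow)
      finally show "norm (of_real (chi p j) * (\<Sum>k=1..n. (z ^ j) ^ k)) \<le> real p * (1 / real j + 1 / real (p - j))" .
    qed
    also have "\<dots> = real p * ((\<Sum>j\<in>{1..<p}. 1 / real j) + (\<Sum>j\<in>{1..<p}. 1 / real (p - j)))"
      by (simp add: sum_distrib_left sum.distrib distrib_left)
    also have "(\<Sum>j\<in>{1..<p}. 1 / real (p - j)) = (\<Sum>j\<in>{1..<p}. 1 / real j)"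
      by (rule sum.reindex_bij_witness[of _ "\<lambda>j. p - j" "\<lambda>j. p - j"]) auto
    also have "real p * ((\<Sum>j\<in>{1..<p}. 1 / real j) + (\<Sum>j\<in>{1..<p}. 1 / real j)) \<le> real p * (2 * (1 + ln (real p)))"
    proof -
      have "(\<Sum>j\<in>{1..<p}. 1 / real j) = (\<Sum>j\<in>{1..<p}. real j powr - 1)"
        by (intro sum.cong) (auto simp: powr_minus_divide)
      also have "\<dots> \<le> (\<Sum>j=1..p. real j powr - 1)" by (intro sum_mono2) auto
      also have "\<dots> \<le> 1 + ln (real p)"
        using psum_inverse_le[of "real p"] p unfolding upto_real_of_nat by simp
      finally show ?thesis by (intro mult_left_mono) auto
    qed
    finally have "\<bar>\<Sum>k=1..n. chi p k\<bar> * sqrt (real p) \<le> real p * (2 * (1 + ln (real p)))" .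
    also have "\<dots> = (2 * sqrt (real p) * (1 + ln (real p))) * sqrt (real p)"
    proof -
      have "real p * (2 * (1 + ln (real p))) = (sqrt (real p) * sqrt (real p)) * (2 * (1 + ln (real p)))" by simp
      thus ?thesis by (simp only: mult_ac)
    qed
    finally show "\<bar>\<Sum>k=1..n. chi p k\<bar> \<le> 2 * sqrt (real p) * (1 + ln (real p))"
      using p by (simp add: mult_ac)
  qed
qed

section \<open>Siegel's theorem for Legendre characters\<close>

lemma eventually_powr_le:
  fixes c a b :: real
  assumes "c > 0" "a < b"
  shows "eventually (\<lambda>p. p powr - b \<le> c * p powr - a) at_top"
proof -
  have "((\<lambda>p::real. p powr - (b - a)) \<longlongrightarrow> 0) at_top"
    using assms by (intro tendsto_neg_powr filterlim_ident) auto
  hence "eventually (\<lambda>p::real. p powr - (b - a) < c) at_top"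
    using assms by (intro order_tendstoD) auto
  thus ?thesis
  proof (rule eventually_mono)
    fix p :: real assume "p powr - (b - a) < c"
    hence "p powr - (b - a) * p powr - a \<le> c * p powr - a" by (intro mult_right_mono) auto
    thus "p powr - b \<le> c * p powr - a" by (simp flip: powr_add)
  qed
qed

text \<open>Either L(s, chi p) is non-negative for all large \<open>p\<close>, and the bound for a
  single character applies to each of them; or some \<open>q\<close> has a negative value, hence a
  zero between \<open>s\<close> and 1, and the bound for a product applies to every larger
  \<open>p\<close> with this fixed \<open>q\<close>. In the first case the threshold beyond which
  the values are non-negative is merely assumed to exist.\<close>

lemma siegel:
  fixes \<eta> :: real
  assumes \<eta>: "\<eta> > 0"
  shows "\<exists>P. \<forall>p. prime p \<longrightarrow> real p \<ge> P \<longrightarrow> Lval (chi p) 1 \<ge> real p powr - \<eta>"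
proof -
  \<comment> \<open>The bound for two characters needs zeros beyond 15/16 and loses
    \<open>p powr (64 * (1 - \<beta>))\<close>, which must be at most
    \<open>p powr (\<eta> / 2)\<close>. The other \<open>\<eta> / 2\<close> absorbs the logarithm in
    the upper bound for L(1, chi p chi q).\<close>
  define s where "s = 1 - min (1/16) (\<eta> / 128)"
  have s: "15/16 \<le> s" "s < 1" "64 * (1 - s) \<le> \<eta> / 2" using \<eta> by (auto simp: s_def)
  have "\<exists>P. \<forall>p. prime p \<longrightarrow> p > 2 \<longrightarrow> real p \<ge> P \<longrightarrow> Lval (chi p) 1 \<ge> real p powr - \<eta>"
  proof (cases "\<exists>P. \<forall>p. prime p \<longrightarrow> p > 2 \<longrightarrow> p \<ge> P \<longrightarrow> Lval (chi p) s \<ge> 0")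
    case True
    then obtain P where P: "\<And>p. prime p \<Longrightarrow> p > 2 \<Longrightarrow> p \<ge> P \<Longrightarrow> Lval (chi p) s \<ge> 0" by blast
    obtain c P' where c: "c > 0" "\<And>f p. p \<ge> P' \<Longrightarrow> real_char f \<Longrightarrow> bounded_sums f p \<Longrightarrow> Lval f s \<ge> 0 \<Longrightarrow>
            Lval f 1 \<ge> c * p powr (- 8 * (1 - s))"
      using Lval_1_lower_bound_one_char[of s] s by auto
    have "8 * (1 - s) < \<eta>" using s \<eta> by linarith
    then obtain P'' where P'': "\<And>p. p \<ge> P'' \<Longrightarrow> p powr - \<eta> \<le> c * p powr - (8 * (1 - s))"
      using eventually_powr_le[OF c(1) \<open>8 * (1 - s) < \<eta>\<close>] unfolding eventually_at_top_linorder by blast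
    show ?thesis
    proof (intro exI[of _ "max (real P) (max P' P'')"] allI impI)
      fix p :: nat assume p: "prime p" "p > 2" "real p \<ge> max (real P) (max P' P'')"
      have "real p powr - \<eta> \<le> c * real p powr - (8 * (1 - s))" using p by (intro P'') auto
      also have "\<dots> \<le> Lval (chi p) 1"
        using c(2)[of "real p" "chi p"] p real_char_chi[OF p(1,2)] bounded_sums_chi[OF p(1,2)] P[of p] by simp
      finally show "real p powr - \<eta> \<le> Lval (chi p) 1" .
    qed
  next
    case False
    then obtain q where q: "prime q" "q > 2" "Lval (chi q) s < 0"
      by (metis linorder_not_le order_refl)
    have qc: "real_char (chi q)" "bounded_sums (chi q) (real q)"
      using real_char_chi bounded_sums_chi q by auto
    have "\<exists>\<beta>\<ge>s. \<beta> \<le> 1 \<and> Lval (chi q) \<beta> = 0"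
      using q Lval_1_pos[OF qc] continuous_on_Lval[OF qc(2), of s 1] s by (intro IVT') auto
    then obtain \<beta> where \<beta>: "\<beta> \<ge> s" "\<beta> \<le> 1" "Lval (chi q) \<beta> = 0" by blast
    have "\<beta> < 1" using \<beta> Lval_1_pos[OF qc] by (cases "\<beta> = 1") auto
    then obtain c P where c: "c > 0" and P: "\<And>h p. p \<ge> P \<Longrightarrow> real_char h \<Longrightarrow> bounded_sums h p \<Longrightarrow>
            bounded_sums (\<lambda>n. h n * chi q n) (real q * p) \<Longrightarrow>
            Lval h 1 * Lval (\<lambda>n. h n * chi q n) 1 \<ge> c * p powr (- 64 * (1 - \<beta>))"
      using Lval_product_lower_bound[OF qc, of \<beta>] \<beta> s q by auto
    have "((\<lambda>p. (3 + ln (real q * p)) * p powr (- \<eta> / 2)) \<longlongrightarrow> 0) at_top"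
      using \<eta> q by real_asymp
    hence "eventually (\<lambda>p. (3 + ln (real q * p)) * p powr (- \<eta> / 2) < c) at_top"
      using c by (intro order_tendstoD) auto
    then obtain P' where P': "\<And>p. p \<ge> P' \<Longrightarrow> (3 + ln (real q * p)) * p powr (- \<eta> / 2) < c"
      by (auto simp: eventually_at_top_linorder)
    show ?thesis
    proof (intro exI[of _ "max (real q + 1) (max P P')"] allI impI)
      fix p :: nat assume p: "prime p" "p > 2" "real p \<ge> max (real q + 1) (max P P')"
      have pc: "real_char (chi p)" "bounded_sums (chi p) (real p)"
        using real_char_chi bounded_sums_chi p by auto
      have pq: "bounded_sums (\<lambda>n. chi p n * chi q n) (real q * real p)"
        using bounded_sums_chi_mult[OF p(1,2) q(1,2)] p(3) by (auto simp: mult.commute)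
      have Lp: "Lval (chi p) 1 > 0" using Lval_1_pos[OF pc] .
      define M where "M = 3 + ln (real q * real p)"
      have "1 * 1 \<le> real q * real p" using p q by (intro mult_mono) auto
      hence qp: "real q * real p \<ge> 1" by simp
      hence M: "M \<ge> 3" by (simp add: M_def)
      have "c * real p powr (- \<eta> / 2) \<le> c * real p powr (- 64 * (1 - \<beta>))"
        using c p s \<beta> by (intro mult_left_mono powr_mono) auto
      also have "\<dots> \<le> Lval (chi p) 1 * Lval (\<lambda>n. chi p n * chi q n) 1"
        using P[of "real p" "chi p"] p pc pq by simp
      also have "\<dots> \<le> Lval (chi p) 1 * M"
        using Lval_1_upper_bound[OF real_char_mult[OF pc(1) qc(1)] pq qp] Lp
        unfolding M_def by (intro mult_left_mono) auto
      finally have 1: "c * real p powr (- \<eta> / 2) \<le> Lval (chi p) 1 * M" .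
      have "M * real p powr (- \<eta> / 2) \<le> c" using P'[of "real p"] p by (simp add: M_def)
      hence "M * real p powr (- \<eta> / 2) * real p powr (- \<eta> / 2) \<le> c * real p powr (- \<eta> / 2)"
        by (intro mult_right_mono) auto
      also have "M * real p powr (- \<eta> / 2) * real p powr (- \<eta> / 2) = M * real p powr - \<eta>"
        by (simp add: mult.assoc flip: powr_add)
      finally have "real p powr - \<eta> * M \<le> Lval (chi p) 1 * M" using 1 by (simp add: mult.commute)
      thus "real p powr - \<eta> \<le> Lval (chi p) 1" using M by simp
    qed
  qed
  then obtain P where P: "\<And>p. prime p \<Longrightarrow> p > 2 \<Longrightarrow> real p \<ge> P \<Longrightarrow> Lval (chi p) 1 \<ge> real p powr - \<eta>" by blast
  show ?thesis
    by (rule exI[of _ "max P 3"]) (auto intro!: P)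
qed

section \<open>Integers composed of split primes\<close>

lemma Legendre_power:
  assumes "prime p" "p > 2"
  shows "Legendre (a ^ k) (int p) = Legendre a (int p) ^ k"
  using assms by (induction k) (auto simp: Legendre_mult Legendre_1)

lemma Legendre_minus_1:
  assumes q: "prime q" "q > 2"
  shows "Legendre (-1) (int q) = (-1) ^ ((q - 1) div 2)"
proof -
  have "[Legendre (-1) (int q) = (-1) ^ ((q - 1) div 2)] (mod int q)"
    by (rule euler_criterion[OF q])
  hence dvd: "int q dvd Legendre (-1) (int q) - (-1) ^ ((q - 1) div 2)"
    by (simp add: cong_iff_dvd_diff)
  have "\<bar>Legendre (-1) (int q) - (-1) ^ ((q - 1) div 2)\<bar> < int q"
    using Legendre_in[of "-1" "int q"] q(2) by (cases "even ((q - 1) div 2)") auto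
  thus ?thesis using dvd dvd_imp_le_int[of "Legendre (-1) (int q) - (-1) ^ ((q - 1) div 2)" "int q"] by force
qed

text \<open>Quadratic reciprocity with its sign absorbed into the discriminant. The sign depends on
  \<open>p\<close> alone, so one polynomial serves all odd \<open>q\<close>.\<close>

lemma Legendre_pstar:
  assumes p: "prime p" "p > 2" and q: "prime q" "q > 2" and "p \<noteq> q"
  shows "Legendre ((-1) ^ ((p - 1) div 2) * int p) (int q) = Legendre (int q) (int p)"
proof -
  define e :: int where "e = (-1) ^ ((p - 1) div 2 * ((q - 1) div 2))"
  have "Legendre ((-1) ^ ((p - 1) div 2) * int p) (int q) = e * Legendre (int p) (int q)"
    unfolding Legendre_mult[OF q] Legendre_power[OF q] Legendre_minus_1[OF q] e_def
    by (simp add: mult.commute flip: power_mult)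
  also have "\<not> int q dvd int p"
    using p q \<open>p \<noteq> q\<close> primes_dvd_imp_eq[of q p] unfolding of_nat_dvd_iff by blast
  hence "Legendre (int p) (int q) \<noteq> 0" by (simp add: Legendre_def cong_0_iff)
  hence "Legendre (int p) (int q) * Legendre (int p) (int q) = 1"
    using Legendre_in[of "int p" "int q"] by auto
  hence "Legendre (int q) (int p) = Legendre (int p) (int q) * e"
    using Quadratic_Reciprocity[of p q] assms unfolding e_def by (metis mult.assoc mult.commute mult_1)
  hence "e * Legendre (int p) (int q) = Legendre (int q) (int p)" by (simp add: mult.commute)
  finally show ?thesis .
qed

text \<open>Excludes \<open>p mod 8 = 3\<close> when 2 is split, leaving \<open>-p\<close> congruent
  to 1 modulo 8. In Gauss's lemma the doubles that exceed \<open>(p - 1) / 2\<close> come from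
  \<open>2 k + 1\<close> to \<open>4 k + 1\<close>, an odd number of them.\<close>

lemma Legendre_2:
  assumes p: "prime p" "p mod 8 = 3"
  shows "Legendre 2 (int p) = -1"
proof -
  obtain k where k: "p = 8 * k + 3" using p(2) by (metis mult_div_mod_eq)
  have p2: "p > 2" using k by simp
  interpret GAUSS p 2
  proof
    show "[2 \<noteq> 0] (mod int p)" using p2 by (auto simp: cong_0_iff dest: zdvd_imp_le)
  qed (use p p2 in auto)
  have half: "(int p - 1) div 2 = 4 * int k + 1" unfolding k by simp
  have "E = (\<lambda>x. x * 2) ` {2 * int k + 1..4 * int k + 1}"
  proof (intro equalityI subsetI)
    fix y assume "y \<in> E"
    then obtain x where x: "0 < x" "x \<le> 4 * int k + 1" "y = x * 2 mod int p" "y > 4 * int k + 1"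
      unfolding E_def C_def B_def A_def half by auto
    have "x * 2 mod int p = x * 2" using x k by (intro mod_pos_pos_trivial) auto
    thus "y \<in> (\<lambda>x. x * 2) ` {2 * int k + 1..4 * int k + 1}" using x by auto
  next
    fix y assume "y \<in> (\<lambda>x. x * 2) ` {2 * int k + 1..4 * int k + 1}"
    then obtain x where x: "2 * int k + 1 \<le> x" "x \<le> 4 * int k + 1" "y = x * 2" by auto
    have "x * 2 mod int p = x * 2" using x k by (intro mod_pos_pos_trivial) auto
    hence "y = x * 2 mod int p" using x by simp
    moreover have "x \<in> {0<..4 * int k + 1}" using x by simp
    ultimately show "y \<in> E" unfolding E_def C_def B_def A_def half using x by auto
  qed
  hence "card E = card {2 * int k + 1..4 * int k + 1}"
    using card_image[of "\<lambda>x::int. x * 2" "{2 * int k + 1..4 * int k + 1}"] by (simp add: inj_on_def)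
  hence "card E = 2 * k + 1" by simp
  thus ?thesis using gauss_lemma by simp
qed

section \<open>Square roots of the discriminant modulo prime powers\<close>

text \<open>A Newton step: the derivative \<open>2 * b\<close> is invertible modulo
  \<open>q\<close>, since \<open>q\<close> is odd and a root divisible by \<open>q\<close> would
  force \<open>q\<close> to divide \<open>D\<close>.\<close>

lemma hensel_odd:
  fixes q D :: int
  assumes q: "prime q" "odd q" and D: "\<not> q dvd D" and b: "q dvd b ^ 2 - D" and k: "k > 0"
  shows "\<exists>b. q ^ k dvd b ^ 2 - D"
  using k
proof (induction k)
  case (Suc k)
  show ?case
  proof (cases "k = 0")
    case False
    then obtain b where b: "q ^ k dvd b ^ 2 - D" using Suc by auto
    then obtain t where t: "b ^ 2 - D = q ^ k * t" by blast
    have qb: "\<not> q dvd 2 * b"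
    proof
      assume "q dvd 2 * b"
      moreover have "\<not> q dvd 2" using q primes_dvd_imp_eq[of q 2] by auto
      ultimately have "q dvd b" using q prime_dvd_mult_iff by blast
      hence "q dvd b ^ 2" by (simp add: power2_eq_square)
      moreover have "q dvd b ^ 2 - D" using b False by (meson dvd_power dvd_trans gr0I)
      ultimately have "q dvd b ^ 2 - (b ^ 2 - D)" by (rule dvd_diff)
      thus False using D by simp
    qed
    hence "coprime (2 * b) q" using q by (metis coprime_commute prime_imp_coprime)
    then obtain z where z: "[2 * b * z = - t] (mod q)"
      by (metis cong_solve_coprime_int cong_scalar_right mult.assoc mult_1)
    then obtain w where w: "2 * b * z + t = q * w"
      by (metis cong_iff_dvd_diff diff_minus_eq_add dvdE)
    have "(b + q ^ k * z) ^ 2 - D = (b ^ 2 - D) + q ^ k * (2 * b * z) + q ^ k * q ^ k * z ^ 2"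
      by (simp add: power2_eq_square algebra_simps)
    also have "\<dots> = q ^ k * (2 * b * z + t) + q ^ k * q ^ k * z ^ 2"
      unfolding t by (simp add: algebra_simps)
    also have "\<dots> = q ^ Suc k * w + q ^ Suc k * (q ^ (k - 1) * z ^ 2)"
    proof -
      have "q ^ k = q * q ^ (k - 1)" using False by (simp add: power_eq_if)
      thus ?thesis unfolding w by (simp add: algebra_simps)
    qed
    finally show ?thesis by (metis dvd_add dvd_triv_left)
  qed (use b in auto)
qed simp

text \<open>The derivative \<open>2 * b\<close> is even here, so the correction is
  \<open>2 ^ (k - 1) * t\<close>. It leaves \<open>2 ^ k * t * (1 + b)\<close> with
  \<open>1 + b\<close> even, plus a term divisible by \<open>2 ^ (2 * k - 2)\<close>; the latter is
  harmless because \<open>k \<ge> 3\<close>.\<close>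

lemma square_mod_power_2:
  fixes D :: int
  assumes D: "8 dvd D - 1" and k: "k \<ge> 3"
  shows "\<exists>b. odd b \<and> 2 ^ k dvd b ^ 2 - D"
  using k
proof (induction k rule: dec_induct)
  case base
  have "(2::int) ^ 3 dvd 1 ^ 2 - D" using D by (simp add: dvd_diff_commute)
  thus ?case by (intro exI[of _ 1]) simp
next
  case (step k)
  then obtain b where b: "odd b" "2 ^ k dvd b ^ 2 - D" by auto
  then obtain t where t: "b ^ 2 - D = 2 ^ k * t" by blast
  define c where "c = b + 2 ^ (k - 1) * t"
  have k: "(2::int) ^ k = 2 * 2 ^ (k - 1)" "(2::int) ^ (k - 1) = 4 * 2 ^ (k - 3)"
  proof -
    obtain j where "k = j + 3" using step(1) by (metis le_add_diff_inverse2)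
    thus "(2::int) ^ k = 2 * 2 ^ (k - 1)" "(2::int) ^ (k - 1) = 4 * 2 ^ (k - 3)"
      by (simp_all add: power_add)
  qed
  have "odd c" using b k(2) by (simp add: c_def)
  have "c ^ 2 - D = (b ^ 2 - D) + 2 * 2 ^ (k - 1) * b * t + 2 ^ (k - 1) * 2 ^ (k - 1) * t ^ 2"
    by (simp add: c_def power2_eq_square algebra_simps)
  also have "\<dots> = 2 ^ k * (t * (1 + b)) + 2 * 2 ^ k * (2 ^ (k - 3) * t ^ 2)"
    unfolding t k by (simp add: algebra_simps)
  also have "even (1 + b)" using b by simp
  then obtain r where "1 + b = 2 * r" by blast
  hence "2 ^ k * (t * (1 + b)) + 2 * 2 ^ k * (2 ^ (k - 3) * t ^ 2) = 2 ^ Suc k * (t * r + 2 ^ (k - 3) * t ^ 2)"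
    by (simp add: algebra_simps)
  finally show ?case using \<open>odd c\<close> by (metis dvd_triv_left)
qed

lemma dvd_square_diff_cong:
  fixes D :: int
  assumes "m dvd b ^ 2 - D" "[c = b] (mod m)"
  shows "m dvd c ^ 2 - D"
proof -
  have "[c ^ 2 = b ^ 2] (mod m)" using assms(2) by (rule cong_pow)
  moreover have "[b ^ 2 = D] (mod m)" using assms(1) by (simp add: cong_iff_dvd_diff)
  ultimately show ?thesis using cong_trans cong_iff_dvd_diff by blast
qed

text \<open>The root is the middle coefficient of a form with leading coefficient \<open>s\<close>
  and discriminant \<open>-p\<close>. Local roots exist by reciprocity and lifting, and are glued by
  the Chinese remainder theorem.\<close>

lemma square_root_mod_split:
  fixes s :: nat
  assumes p: "prime p" "p mod 4 = 3" and s: "s > 0" and split: "\<And>q. prime q \<Longrightarrow> q dvd s \<Longrightarrow> chi p q = 1"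
  shows "\<exists>b::int. 4 * int s dvd b ^ 2 + int p"
  using s split
proof (induction s rule: prime_power_coprime_induct)
  case one
  have "4 dvd 1 + int p" using p(2) by presburger
  hence "4 dvd 1 ^ 2 + int p" by simp
  thus ?case by (intro exI[of _ 1]) simp
next
  case (step q k n)
  have p2: "p > 2" using p(2) by (cases "p \<le> 2") (auto simp: le_Suc_eq numeral_2_eq_2)
  have "\<exists>b::int. 4 * int n dvd b ^ 2 + int p" using step.prems by (intro step.IH) auto
  then obtain b1 :: int where b1: "4 * int n dvd b1 ^ 2 - (- int p)" by auto
  have chi: "chi p q = 1" using step by simp
  hence "p \<noteq> q" using chi_eq_0_iff[of p q] by auto
  have cop: "coprime (int q ^ k) (int n)"
    using step by (simp add: prime_imp_coprime)
  have "\<exists>b. 4 * (int q ^ k * int n) dvd b ^ 2 - (- int p)"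
  proof (cases "q = 2")
    case True
    have "p mod 8 = 3 \<or> p mod 8 = 7" using p(2) by presburger
    hence "p mod 8 = 7" using chi True Legendre_2[of p] p by (auto simp: chi_def)
    hence "8 dvd - int p - 1" by presburger
    \<comment> \<open>The exponent \<open>k + 2\<close> carries the factor 4, so from
      \<open>b1\<close> only its property modulo the odd number \<open>n\<close> is used.\<close>
    then obtain b2 :: int where b2: "2 ^ (k + 2) dvd b2 ^ 2 - (- int p)"
      using square_mod_power_2[of "- int p" "k + 2"] step(2) by auto
    have "coprime (int n) 2" using step(3) True by simp
    hence c: "coprime (int n) (2 ^ (k + 2))" using coprime_power_right_iff[of "int n" 2 "k + 2"] by blast
    obtain b where b: "[b = b1] (mod int n)" "[b = b2] (mod 2 ^ (k + 2))"
      using binary_chinese_remainder_int[OF c] by blast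
    have "int n dvd b1 ^ 2 - (- int p)" using b1 by (rule dvd_mult_right)
    hence "int n dvd b ^ 2 - (- int p)" using b(1) by (rule dvd_square_diff_cong)
    moreover have "2 ^ (k + 2) dvd b ^ 2 - (- int p)" using b2 b(2) by (rule dvd_square_diff_cong)
    ultimately have "int n * 2 ^ (k + 2) dvd b ^ 2 - (- int p)" using c by (rule divides_mult)
    moreover have "int n * 2 ^ (k + 2) = 4 * (int q ^ k * int n)" using True by simp
    ultimately show ?thesis by metis
  next
    case False
    hence q2: "q > 2" using step(1) prime_ge_2_nat[of q] by simp
    hence oddq: "odd q" using step(1) prime_odd_nat by blast
    have "odd ((p - 1) div 2)" using p(2) by presburger
    hence "Legendre (- int p) (int q) = 1"
      using Legendre_pstar[OF p(1) p2 step(1) q2 \<open>p \<noteq> q\<close>] chi by (simp add: chi_def)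
    then obtain b0 where b0: "[b0 ^ 2 = - int p] (mod int q)" "\<not> [- int p = 0] (mod int q)"
      by (auto simp: Legendre_def QuadRes_def split: if_splits)
    hence "\<not> int q dvd - int p" "int q dvd b0 ^ 2 - (- int p)" by (auto simp: cong_0_iff cong_iff_dvd_diff)
    then obtain b2 where b2: "int q ^ k dvd b2 ^ 2 - (- int p)"
      using hensel_odd[of "int q" "- int p" b0 k] step(1,2) oddq by auto
    have "coprime (int q ^ k) 4"
    proof -
      have "coprime (int q) (2 ^ 2)" using oddq by (subst coprime_power_right_iff) simp
      thus ?thesis by simp
    qed
    hence c: "coprime (4 * int n) (int q ^ k)" using cop by (simp add: coprime_commute)
    obtain b where b: "[b = b1] (mod 4 * int n)" "[b = b2] (mod int q ^ k)"
      using binary_chinese_remainder_int[OF c] by blast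
    have "4 * int n dvd b ^ 2 - (- int p)" using b1 b(1) by (rule dvd_square_diff_cong)
    moreover have "int q ^ k dvd b ^ 2 - (- int p)" using b2 b(2) by (rule dvd_square_diff_cong)
    ultimately have "4 * int n * int q ^ k dvd b ^ 2 - (- int p)" using c by (rule divides_mult)
    moreover have "4 * int n * int q ^ k = 4 * (int q ^ k * int n)" by simp
    ultimately show ?thesis by metis
  qed
  thus ?case by simp
qed

text \<open>\<open>m ^ 2\<close> collects the primes with \<open>chi p q = -1\<close>, which must occur to even powers.\<close>

lemma rho_split_decomposition:
  assumes p: "prime p" "p > 2" and n: "n > 0" "\<not> p dvd n" "rho (chi p) n \<noteq> 0"
  shows "\<exists>s m. s > 0 \<and> m > 0 \<and> n = s * m ^ 2 \<and> (\<forall>q. prime q \<longrightarrow> q dvd s \<longrightarrow> chi p q = 1)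
     \<and> rho (chi p) n \<le> rho (\<lambda>_. 1) s"
  using n
proof (induction n rule: prime_power_coprime_induct)
  case one
  show ?case
    using rho_1[OF real_char_chi[OF p]] rho_1[OF real_char_one]
    by (intro exI[of _ 1]) auto
next
  case (step q k n)
  note rc = real_char_chi[OF p]
  have cop: "coprime (q ^ k) n" using step by (simp add: prime_imp_coprime)
  have rho_mult: "rho f (q ^ k * n') = rho f (q ^ k) * rho f n'"
    if "real_char f" "\<not> q dvd n'" "n' > 0" for f n'
    using multiplicative_rho[OF that(1)] that step(1) prime_gt_0_nat[of q] prime_imp_coprime[of q n']
    unfolding multiplicative_def by simp
  have rn: "rho (chi p) (q ^ k * n) = rho (chi p) (q ^ k) * rho (chi p) n"
    using step rc by (intro rho_mult) auto
  have "\<not> p dvd n" "rho (chi p) n \<noteq> 0" using step rn by auto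
  then obtain s m where sm: "s > 0" "m > 0" "n = s * m ^ 2" "\<And>q. prime q \<Longrightarrow> q dvd s \<Longrightarrow> chi p q = 1"
     "rho (chi p) n \<le> rho (\<lambda>_. 1) s" using step.IH by blast
  have qs: "\<not> q dvd s" using step(3) sm(3) by auto
  have "\<not> p dvd q ^ k * n" by fact
  hence "\<not> p dvd q" using step(2) by (meson dvd_mult2 dvd_power dvd_trans)
  hence "chi p q \<noteq> 0" by (simp add: chi_eq_0_iff)
  then consider "chi p q = 1" | "chi p q = -1" using real_char_cases[OF rc, of q] by blast
  thus ?case
  proof cases
    case 1
    have "rho (chi p) (q ^ k * n) \<le> rho (\<lambda>_. 1) (q ^ k * s)"
      unfolding rn rho_mult[OF real_char_one qs sm(1)]
      using sm(5) rho_prime_power_1[OF rc step(1) 1, of k] rho_prime_power_1[OF real_char_one step(1), of k]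
      by (simp add: mult_left_mono)
    moreover have "chi p r = 1" if "prime r" "r dvd q ^ k * s" for r
    proof -
      have "r dvd q ^ k \<or> r dvd s" using that prime_dvd_mult_iff by blast
      thus ?thesis using that step(1) sm(4) 1 by (metis prime_dvd_power primes_dvd_imp_eq)
    qed
    ultimately show ?thesis using sm step(1) prime_gt_0_nat
      by (intro exI[of _ "q ^ k * s"] exI[of _ m]) auto
  next
    case 2
    hence ek: "even k" using step.prems(2) rho_prime_power_m1[OF rc step(1) 2, of k] unfolding rn by (auto split: if_splits)
    hence "q ^ k = (q ^ (k div 2)) ^ 2" by (simp flip: power_mult)
    moreover have "rho (chi p) (q ^ k * n) = rho (chi p) n"
      unfolding rn rho_prime_power_m1[OF rc step(1) 2] using ek by simp
    ultimately show ?thesis using sm step(1) prime_gt_0_nat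
      by (intro exI[of _ s] exI[of _ "q ^ (k div 2) * m"]) (auto simp: power_mult_distrib)
  qed
qed

section \<open>A form with balanced leading coefficient\<close>

lemma psum_divisor_half_le:
  assumes y: "y \<ge> 1"
  shows "psum (wt (rho (\<lambda>_. 1)) (1/2)) y \<le> 2 * sqrt y * (1 + ln y)"
proof -
  let ?w = "\<lambda>k. real k powr - (1/2)"
  have "psum (wt (rho (\<lambda>_. 1)) (1/2)) y = psum (dconv ?w ?w) y"
    using psum_dconv_wt[of "\<lambda>_. 1" "\<lambda>_. 1" "1/2" y] by simp
  also have "\<dots> = (\<Sum>m\<in>upto_real y. ?w m * psum ?w (y / real m))
     + (\<Sum>k\<in>upto_real (y / y). ?w k * (psum ?w (y / real k) - psum ?w y))"
    using y by (intro hyperbola) auto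
  \<comment> \<open>Cutting at \<open>y\<close> itself leaves only \<open>k = 1\<close>, whose term
    is zero.\<close>
  also have "(\<Sum>k\<in>upto_real (y / y). ?w k * (psum ?w (y / real k) - psum ?w y)) = 0"
  proof (rule sum.neutral, rule)
    fix k assume "k \<in> upto_real (y / y)"
    hence "k = 1" using y by (auto simp: upto_real_def)
    thus "?w k * (psum ?w (y / real k) - psum ?w y) = 0" by simp
  qed
  also have "(\<Sum>m\<in>upto_real y. ?w m * psum ?w (y / real m)) \<le> (\<Sum>m\<in>upto_real y. 2 * sqrt y * real m powr - 1)"
  proof (rule sum_mono)
    fix m assume "m \<in> upto_real y"
    hence m: "real m > 0" by (simp add: upto_real_def)
    have "psum ?w (y / real m) \<le> (y / real m) powr (1 - 1/2) / (1 - 1/2)"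
      using y by (intro psum_powr_le) auto
    also have "\<dots> = 2 * (sqrt y * ?w m)"
    proof -
      have "(y / real m) powr (1/2) = y powr (1/2) / real m powr (1/2)" by (rule powr_divide)
      moreover have "?w m = 1 / real m powr (1/2)" by (rule powr_minus_divide)
      moreover have "y powr (1/2) = sqrt y" using y by (simp add: powr_half_sqrt)
      ultimately show ?thesis by simp
    qed
    finally have "?w m * psum ?w (y / real m) \<le> ?w m * (2 * (sqrt y * ?w m))"
      by (intro mult_left_mono) auto
    also have "\<dots> = 2 * sqrt y * (?w m * ?w m)" by simp
    also have "?w m * ?w m = real m powr - 1" by (simp flip: powr_add)
    finally show "?w m * psum ?w (y / real m) \<le> 2 * sqrt y * real m powr - 1" .
  qed
  also have "\<dots> = 2 * sqrt y * psum (\<lambda>k. real k powr - 1) y" by (simp add: sum_distrib_left)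
  also have "\<dots> \<le> 2 * sqrt y * (1 + ln y)"
    using psum_inverse_le[OF y] y by (intro mult_left_mono) auto
  finally show ?thesis by simp
qed

text \<open>Since \<open>x < p\<close>, every \<open>n\<close> with a nonzero term is
  \<open>s * m ^ 2\<close> with \<open>s\<close> composed of split primes, hence
  \<open>s \<le> y\<close>. For each \<open>s\<close> there are at most \<open>sqrt (x / s)\<close>
  choices of \<open>m\<close>, and it remains to sum the number of divisors of \<open>s\<close> over
  \<open>sqrt s\<close>.\<close>

lemma psum_rho_chi_upper:
  assumes p: "prime p" "p > 2" and x: "0 \<le> x" "x < real p" and y: "1 \<le> y"
    and split: "\<And>s. s > 0 \<Longrightarrow> real s \<le> x \<Longrightarrow> (\<And>q. prime q \<Longrightarrow> q dvd s \<Longrightarrow> chi p q = 1) \<Longrightarrow> real s \<le> y"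
  shows "psum (rho (chi p)) x \<le> 2 * sqrt (x * y) * (1 + ln y)"
proof -
  define T where "T = {n \<in> upto_real x. rho (chi p) n \<noteq> 0}"
  have "\<forall>n\<in>T. \<exists>sm. fst sm > 0 \<and> snd sm > 0 \<and> n = fst sm * snd sm ^ 2 \<and> (\<forall>q. prime q \<longrightarrow> q dvd fst sm \<longrightarrow> chi p q = 1)
     \<and> rho (chi p) n \<le> rho (\<lambda>_. 1) (fst sm)"
  proof
    fix n assume n: "n \<in> T"
    hence "\<not> p dvd n" using x by (auto simp: T_def upto_real_def dest!: dvd_imp_le)
    thus "\<exists>sm. fst sm > 0 \<and> snd sm > 0 \<and> n = fst sm * snd sm ^ 2 \<and> (\<forall>q. prime q \<longrightarrow> q dvd fst sm \<longrightarrow> chi p q = 1)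
     \<and> rho (chi p) n \<le> rho (\<lambda>_. 1) (fst sm)"
      using rho_split_decomposition[OF p, of n] n by (auto simp: T_def upto_real_def)
  qed
  from bchoice[OF this] obtain F where F: "\<And>n. n \<in> T \<Longrightarrow> fst (F n) > 0" "\<And>n. n \<in> T \<Longrightarrow> snd (F n) > 0"
     "\<And>n. n \<in> T \<Longrightarrow> n = fst (F n) * snd (F n) ^ 2"
     "\<And>n q. n \<in> T \<Longrightarrow> prime q \<Longrightarrow> q dvd fst (F n) \<Longrightarrow> chi p q = 1"
     "\<And>n. n \<in> T \<Longrightarrow> rho (chi p) n \<le> rho (\<lambda>_. 1) (fst (F n))" by blast
  have fin: "finite T" by (simp add: T_def)
  have inj: "inj_on F T" by (rule inj_onI) (metis F(3))
  let ?R = "Sigma (upto_real y) (\<lambda>s. upto_real (sqrt (x / real s)))"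
  have sub: "F ` T \<subseteq> ?R"
  proof
    fix z assume "z \<in> F ` T"
    then obtain n where n: "n \<in> T" "z = F n" by blast
    define s m where "s = fst (F n)" and "m = snd (F n)"
    have sm: "s > 0" "m > 0" "n = s * m ^ 2" using F(1-3)[OF n(1)] by (auto simp: s_def m_def)
    have "real (s * m ^ 2) \<le> x" using n(1) sm(3) by (auto simp: T_def upto_real_def)
    hence le: "real s * real m ^ 2 \<le> x" by simp
    have "real m ^ 2 \<ge> 1" using sm(2) by simp
    hence "real s \<le> real s * real m ^ 2" using sm(1) mult_left_mono[of 1 "real m ^ 2" "real s"] by simp
    hence "real s \<le> x" using le by linarith
    hence "real s \<le> y" using split[OF sm(1)] F(4)[OF n(1), folded s_def] by blast
    moreover have "real m \<le> sqrt (x / real s)"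
      using le sm(1) by (intro real_le_rsqrt) (simp add: field_simps)
    moreover have "z = (s, m)" using n by (simp add: s_def m_def)
    ultimately show "z \<in> ?R" using sm by (auto simp: upto_real_def)
  qed
  have "psum (rho (chi p)) x = (\<Sum>n\<in>T. rho (chi p) n)"
    by (rule sum.mono_neutral_right) (auto simp: T_def)
  also have "\<dots> \<le> (\<Sum>n\<in>T. rho (\<lambda>_. 1) (fst (F n)))" by (intro sum_mono F)
  also have "\<dots> = (\<Sum>z\<in>F ` T. rho (\<lambda>_. 1) (fst z))" by (simp add: sum.reindex[OF inj])
  also have "\<dots> \<le> (\<Sum>z\<in>?R. rho (\<lambda>_. 1) (fst z))"
    by (rule sum_mono2[OF _ sub]) (simp, auto intro!: rho_nonneg[OF real_char_one] simp: upto_real_def[of y])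
  also have "\<dots> = (\<Sum>s\<in>upto_real y. rho (\<lambda>_. 1) s * real (card (upto_real (sqrt (x / real s)))))"
    using sum.Sigma[of "upto_real y" "\<lambda>s. upto_real (sqrt (x / real s))" "\<lambda>s m. rho (\<lambda>_. 1) s"]
    by (simp add: case_prod_beta mult.commute)
  also have "\<dots> \<le> (\<Sum>s\<in>upto_real y. sqrt x * wt (rho (\<lambda>_. 1)) (1/2) s)"
  proof (rule sum_mono)
    fix s assume "s \<in> upto_real y"
    hence s: "s > 0" by (simp add: upto_real_def)
    show "rho (\<lambda>_. 1) s * real (card (upto_real (sqrt (x / real s)))) \<le> sqrt x * wt (rho (\<lambda>_. 1)) (1/2) s"
    proof -
      have "real (card (upto_real (sqrt (x / real s)))) \<le> sqrt (x / real s)"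
        using x by (intro card_upto_real_le) auto
      also have "\<dots> = sqrt x * real s powr - (1/2)"
      proof -
        have "real s powr - (1/2) = 1 / real s powr (1/2)" by (rule powr_minus_divide)
        thus ?thesis by (simp add: real_sqrt_divide powr_half_sqrt)
      qed
      finally have "rho (\<lambda>_. 1) s * real (card (upto_real (sqrt (x / real s)))) \<le> rho (\<lambda>_. 1) s * (sqrt x * real s powr - (1/2))"
        using rho_nonneg[OF real_char_one s] by (intro mult_left_mono) auto
      thus ?thesis by (simp add: mult_ac)
    qed
  qed
  also have "\<dots> = sqrt x * psum (wt (rho (\<lambda>_. 1)) (1/2)) y" by (simp add: sum_distrib_left)
  also have "\<dots> \<le> sqrt x * (2 * sqrt y * (1 + ln y))"
    using psum_divisor_half_le[OF y] x by (intro mult_left_mono) auto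
  also have "\<dots> = 2 * sqrt (x * y) * (1 + ln y)" by (simp add: real_sqrt_mult)
  finally show ?thesis .
qed

text \<open>With the cut \<open>y = sqrt (x * B)\<close> the floors cost \<open>y\<close>, the tail
  of the character \<open>2 * B * x / y = 2 * y\<close>, and completing the truncated series to L(1,
  chi p) another \<open>2 * y\<close>.\<close>

lemma psum_rho_chi_lower:
  assumes p: "prime p" "p > 2" and B: "bounded_sums (chi p) B" "1 \<le> B" "B \<le> x"
  shows "psum (rho (chi p)) x \<ge> x * Lval (chi p) 1 - 5 * sqrt (x * B)"
proof -
  note rc = real_char_chi[OF p]
  have x: "x \<ge> 1" using B by simp
  define y where "y = sqrt (x * B)"
  have y: "1 \<le> y" "y \<le> x" "y * y = x * B"
  proof -
    have "1 * 1 \<le> x * B" using B by (intro mult_mono) auto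
    thus "1 \<le> y" by (simp add: y_def)
    show "y \<le> x" unfolding y_def using B by (intro real_le_lsqrt) (auto simp: power2_eq_square)
    show "y * y = x * B" using B by (simp add: y_def)
  qed
  have "\<bar>psum (wt (dconv (\<lambda>_. 1) (chi p)) 0) x - (1 * x powr (1 - 0) * psum (wt (chi p) 1) y + 0 * psum (wt (chi p) 0) y)\<bar>
      \<le> 1 * x powr - 0 * y + 2 * B * 1 * x powr (1 - 0) / y"
  proof (intro hyperbola_char y B real_char_abs_le[OF rc] real_char_abs_le[OF real_char_one])
    fix t :: real assume t: "t \<ge> 1"
    have "psum (wt (\<lambda>_. 1) 0) t = (\<Sum>k\<in>upto_real t. 1)"
      by (intro sum.cong) (auto simp: upto_real_def)
    also have "\<dots> = real (nat \<lfloor>t\<rfloor>)" by (simp add: upto_real_eq)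
    finally have eq: "psum (wt (\<lambda>_. 1) 0) t = real (nat \<lfloor>t\<rfloor>)" .
    show "\<bar>psum (wt (\<lambda>_. 1) 0) t - (1 * t powr (1 - 0) + 0)\<bar> \<le> 1 * t powr - 0"
      unfolding eq using t by simp linarith
  next
    show "psum (\<lambda>k. real k powr - 0) (x / y) \<le> 1 * (x / y) powr (1 - 0)"
      using psum_powr_le[of 0 "x / y"] x y by simp
  qed auto
  moreover have "psum (wt (dconv (\<lambda>_. 1) (chi p)) 0) x = psum (rho (chi p)) x"
    by (intro sum.cong) (auto simp: upto_real_def)
  moreover have By: "B * x / y = y" using y by (simp add: field_simps)
  ultimately have 1: "psum (rho (chi p)) x \<ge> x * psum (wt (chi p) 1) y - 3 * y"
    using x by (simp add: mult.assoc)
  have "\<bar>psum (wt (chi p) 1) y - Lval (chi p) 1\<bar> \<le> 2 * B * y powr - 1"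
    using y by (intro Lval_tail B) auto
  hence "x * (Lval (chi p) 1 - psum (wt (chi p) 1) y) \<le> x * (2 * B * y powr - 1)"
    using x by (intro mult_left_mono) auto
  also have "x * (2 * B * y powr - 1) = 2 * (B * x / y)" using y by (simp add: powr_minus_divide)
  finally have "x * Lval (chi p) 1 - x * psum (wt (chi p) 1) y \<le> 2 * y" unfolding By by (simp add: algebra_simps)
  thus ?thesis using 1 unfolding y_def by linarith
qed

text \<open>The ends of the window satisfy \<open>x * y = p\<close>. Without a suitable integer in
  it the divisor sums total at most \<open>sqrt p\<close> up to a logarithm, whereas Siegel's
  theorem with exponent \<open>\<delta> / 4\<close> gives a main term of at least
  \<open>p powr (1/2 + 3 * \<delta> / 4)\<close> with error
  \<open>5 * p powr (1/2 + 9 * \<delta> / 16)\<close>.\<close>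

lemma exists_form_in_window:
  fixes \<delta> :: real
  assumes \<delta>: "0 < \<delta>" "\<delta> < 1/2"
  shows "\<exists>P. \<forall>p. prime p \<longrightarrow> p mod 4 = 3 \<longrightarrow> real p \<ge> P \<longrightarrow>
     (\<exists>a>0. \<exists>b::int. real p powr (1/2 - \<delta>) \<le> real a \<and> real a \<le> real p powr (1/2 + \<delta>) \<and> 4 * int a dvd b ^ 2 + int p)"
proof -
  obtain P1 where P1: "\<And>p. prime p \<Longrightarrow> real p \<ge> P1 \<Longrightarrow> Lval (chi p) 1 \<ge> real p powr - (\<delta> / 4)"
    using siegel[of "\<delta> / 4"] \<delta> by auto
  have "((\<lambda>p::real. 4 * (1 + ln p) ^ 2 * p powr - (\<delta> / 8)) \<longlongrightarrow> 0) at_top"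
    using \<delta> by real_asymp
  hence "eventually (\<lambda>p::real. 4 * (1 + ln p) ^ 2 * p powr - (\<delta> / 8) < 1) at_top"
    by (rule order_tendstoD) simp
  moreover have "((\<lambda>p::real. 6 * p powr - (3 * \<delta> / 16)) \<longlongrightarrow> 0) at_top"
    using \<delta> by real_asymp
  hence "eventually (\<lambda>p::real. 6 * p powr - (3 * \<delta> / 16) < 1) at_top"
    by (rule order_tendstoD) simp
  ultimately have "eventually (\<lambda>p::real. 4 * (1 + ln p) ^ 2 * p powr - (\<delta> / 8) < 1 \<and> 6 * p powr - (3 * \<delta> / 16) < 1) at_top"
    by (rule eventually_conj)
  then obtain P2 where P2: "\<And>p::real. p \<ge> P2 \<Longrightarrow> 4 * (1 + ln p) ^ 2 * p powr - (\<delta> / 8) < 1"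
     "\<And>p::real. p \<ge> P2 \<Longrightarrow> 6 * p powr - (3 * \<delta> / 16) < 1"
    unfolding eventually_at_top_linorder by blast
  have "\<exists>a>0. \<exists>b::int. real p powr (1/2 - \<delta>) \<le> real a \<and> real a \<le> real p powr (1/2 + \<delta>) \<and> 4 * int a dvd b ^ 2 + int p"
    if p: "prime p" "p mod 4 = 3" "real p \<ge> max 3 (max P1 P2)" for p
  proof (rule ccontr)
    assume neg: "\<not> ?thesis"
    have p2: "p > 2" using p by simp
    define r where "r = real p"
    have r: "r > 1" using p by (simp add: r_def)
    define x where "x = r powr (1/2 + \<delta>)"
    define y where "y = r powr (1/2 - \<delta>)"
    define l where "l = 1 + ln r"
    define B where "B = 2 * sqrt r * l"
    have l: "l \<ge> 1" using r by (simp add: l_def)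
    have l4: "4 * l ^ 2 \<le> r powr (\<delta> / 8)"
    proof -
      have "4 * l ^ 2 * r powr - (\<delta> / 8) \<le> 1" using P2(1)[of r] p by (simp add: r_def l_def)
      hence "4 * l ^ 2 * r powr - (\<delta> / 8) * r powr (\<delta> / 8) \<le> 1 * r powr (\<delta> / 8)"
        by (intro mult_right_mono) auto
      also have "4 * l ^ 2 * r powr - (\<delta> / 8) * r powr (\<delta> / 8) = 4 * l ^ 2"
        using r by (simp add: mult.assoc flip: powr_add)
      finally show ?thesis by simp
    qed
    have l1: "2 * l \<le> r powr (\<delta> / 8)" using l4 l by (auto intro: order.trans[OF _ l4] simp: power2_eq_square)
    have x1: "1 \<le> y" "0 \<le> x" "x < r"
    proof -
      show "1 \<le> y" using r \<delta> by (auto simp: y_def intro: ge_one_powr_ge_zero)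
      show "0 \<le> x" by (simp add: x_def)
      have "x < r powr 1" unfolding x_def using r \<delta> by (intro powr_less_mono) auto
      thus "x < r" using r by simp
    qed
    have Bb: "bounded_sums (chi p) B"
      using polya_vinogradov[OF p(1) p2] by (simp add: B_def r_def l_def)
    have sr: "sqrt r = r powr (1/2)" using r by (simp add: powr_half_sqrt)
    have B1: "1 \<le> B"
    proof -
      have "sqrt r \<ge> 1" using r by simp
      hence "1 \<le> 2 * sqrt r" by linarith
      hence "1 * 1 \<le> (2 * sqrt r) * l" using l r by (intro mult_mono) auto
      thus ?thesis by (simp add: B_def)
    qed
    have Ble: "B \<le> r powr (1/2 + \<delta> / 8)"
    proof -
      have "B = r powr (1/2) * (2 * l)" by (simp add: B_def sr)
      also have "\<dots> \<le> r powr (1/2) * r powr (\<delta> / 8)" using l1 by (intro mult_left_mono) auto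
      finally show ?thesis by (simp flip: powr_add)
    qed
    also have "\<dots> \<le> x" unfolding x_def using r \<delta> by (intro powr_mono) auto
    finally have Bx: "B \<le> x" .
    have lower: "x * Lval (chi p) 1 - 5 * sqrt (x * B) \<le> psum (rho (chi p)) x"
      by (rule psum_rho_chi_lower[OF p(1) p2 Bb B1 Bx])
    have upper: "psum (rho (chi p)) x \<le> 2 * sqrt (x * y) * (1 + ln y)"
    proof (rule psum_rho_chi_upper[OF p(1) p2 x1(2)])
      show "x < real p" using x1 by (simp add: r_def)
      show "1 \<le> y" by (rule x1)
      fix s assume s: "s > 0" "real s \<le> x" "\<And>q. prime q \<Longrightarrow> q dvd s \<Longrightarrow> chi p q = 1"
      obtain b :: int where "4 * int s dvd b ^ 2 + int p"
        using square_root_mod_split[OF p(1,2) s(1,3)] by blast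
      hence "\<not> y \<le> real s" using neg s(1,2) unfolding x_def y_def r_def by blast
      thus "real s \<le> y" by simp
    qed
    have "x * r powr - (\<delta> / 4) \<le> x * Lval (chi p) 1"
      using P1[of p] p x1 by (intro mult_left_mono) (auto simp: r_def)
    moreover have "x * r powr - (\<delta> / 4) = r powr (1/2 + 3 * \<delta> / 4)"
      unfolding x_def powr_add[symmetric] by (rule arg_cong[of _ _ "(powr) r"]) simp
    moreover have "sqrt (x * B) \<le> r powr (1/2 + 9 * \<delta> / 16)"
    proof -
      have "x * B \<le> x * r powr (1/2 + \<delta> / 8)" using Ble x1 by (intro mult_left_mono) auto
      also have "\<dots> = r powr (1 + 9 * \<delta> / 8)"
        unfolding x_def powr_add[symmetric] by (rule arg_cong[of _ _ "(powr) r"]) simp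
      also have "\<dots> = (r powr (1/2 + 9 * \<delta> / 16)) ^ 2"
        unfolding power2_eq_square powr_add[symmetric] by (rule arg_cong[of _ _ "(powr) r"]) simp
      finally show ?thesis by (intro real_le_lsqrt) auto
    qed
    moreover have "2 * sqrt (x * y) * (1 + ln y) \<le> r powr (1/2 + 9 * \<delta> / 16)"
    proof -
      have "x * y = r powr 1" unfolding x_def y_def powr_add[symmetric] by (rule arg_cong[of _ _ "(powr) r"]) simp
      hence xy: "sqrt (x * y) = r powr (1/2)" using r sr by simp
      have "ln y = (1/2 - \<delta>) * ln r" using r by (simp add: y_def ln_powr)
      also have "\<dots> \<le> 1 * ln r" using r \<delta> by (intro mult_right_mono) auto
      finally have "2 * (1 + ln y) \<le> r powr (\<delta> / 8)" using l1 by (simp add: l_def)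
      hence "r powr (1/2) * (2 * (1 + ln y)) \<le> r powr (1/2) * r powr (\<delta> / 8)" by (intro mult_left_mono) auto
      also have "\<dots> \<le> r powr (1/2 + 9 * \<delta> / 16)"
        unfolding powr_add[symmetric] using r \<delta> by (intro powr_mono) auto
      finally show ?thesis unfolding xy by (simp only: mult_ac)
    qed
    \<comment> \<open>The factor 6 is 5 from the error of the lower bound and 1 from the upper
      bound; the exponents differ by \<open>3 * \<delta> / 16\<close>.\<close>
    ultimately have "r powr (1/2 + 3 * \<delta> / 4) \<le> 6 * r powr (1/2 + 9 * \<delta> / 16)"
      using lower upper by linarith
    also have "\<dots> = r powr (1/2 + 3 * \<delta> / 4) * (6 * r powr - (3 * \<delta> / 16))"
    proof -
      have "r powr (1/2 + 3 * \<delta> / 4) * r powr - (3 * \<delta> / 16) = r powr (1/2 + 9 * \<delta> / 16)"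
        unfolding powr_add[symmetric] by (rule arg_cong[of _ _ "(powr) r"]) simp
      thus ?thesis by simp
    qed
    also have "\<dots> < r powr (1/2 + 3 * \<delta> / 4) * 1"
      using P2(2)[of r] p r by (intro mult_strict_left_mono) (auto simp: r_def)
    finally show False by simp
  qed
  thus ?thesis by blast
qed

section \<open>Prime factors of quadratic polynomial values\<close>

text \<open>For two roots, \<open>q ^ j\<close> divides \<open>(x - y) * (a * (x + y) + b)\<close>.
  The prime cannot divide both factors, as it would then divide \<open>2 * a * x + b\<close> and so
  the discriminant; hence all of \<open>q ^ j\<close> falls on the second factor. Subtracting two
  such relations leaves \<open>a * (n2 - n3)\<close>. The argument includes
  \<open>q = 2\<close>.\<close>

lemma quadratic_roots_prime_power:
  fixes a b c q :: int
  assumes q: "prime q" and D: "\<not> q dvd b ^ 2 - 4 * a * c" and j: "j > 0"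
    and n: "n1 \<noteq> n2" "n1 \<noteq> n3" "n2 \<noteq> n3"
      "\<bar>n1 - n2\<bar> < q ^ j" "\<bar>n1 - n3\<bar> < q ^ j" "\<bar>n2 - n3\<bar> < q ^ j"
    and root: "q ^ j dvd a * n1 ^ 2 + b * n1 + c" "q ^ j dvd a * n2 ^ 2 + b * n2 + c" "q ^ j dvd a * n3 ^ 2 + b * n3 + c"
  shows False
proof -
  have qj: "q dvd q ^ j" using j by simp
  have nd: "\<not> q ^ j dvd d" if "d \<noteq> 0" "\<bar>d\<bar> < q ^ j" for d
    using that dvd_imp_le_int[of d "q ^ j"] by (auto simp: not_le)
  have nb: "\<not> (q dvd x - y \<and> q dvd a * (x + y) + b)" if "q ^ j dvd a * x ^ 2 + b * x + c" for x y
  proof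
    assume *: "q dvd x - y \<and> q dvd a * (x + y) + b"
    have "q dvd a * (x - y)" using * by (metis dvd_mult)
    hence "q dvd a * (x - y) + (a * (x + y) + b)" using * by (metis dvd_add)
    also have "a * (x - y) + (a * (x + y) + b) = 2 * a * x + b" by (simp add: algebra_simps)
    finally have 1: "q dvd (2 * a * x + b) ^ 2" by (simp add: power2_eq_square)
    have 2: "q dvd 4 * a * (a * x ^ 2 + b * x + c)" using that qj by (meson dvd_mult dvd_trans)
    have "(2 * a * x + b) ^ 2 - 4 * a * (a * x ^ 2 + b * x + c) = b ^ 2 - 4 * a * c"
      by (simp add: power2_eq_square algebra_simps)
    thus False using dvd_diff[OF 1 2] D by simp
  qed
  have key: "q ^ j dvd a * (x + y) + b"
    if xy: "x \<noteq> y" "\<bar>x - y\<bar> < q ^ j" "q ^ j dvd a * x ^ 2 + b * x + c" "q ^ j dvd a * y ^ 2 + b * y + c" for x y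
  proof -
    have "q ^ j dvd (a * x ^ 2 + b * x + c) - (a * y ^ 2 + b * y + c)" using xy by (intro dvd_diff)
    also have "(a * x ^ 2 + b * x + c) - (a * y ^ 2 + b * y + c) = (x - y) * (a * (x + y) + b)"
      by (simp add: power2_eq_square algebra_simps)
    finally have d: "q ^ j dvd (x - y) * (a * (x + y) + b)" .
    have "\<not> q ^ j dvd x - y" using xy by (intro nd) auto
    have "q dvd a * (x + y) + b"
    proof (rule ccontr)
      assume "\<not> ?thesis"
      hence "coprime (q ^ j) (a * (x + y) + b)" using q by (simp add: prime_imp_coprime)
      hence "q ^ j dvd x - y" using d by (simp add: coprime_dvd_mult_left_iff)
      thus False using \<open>\<not> q ^ j dvd x - y\<close> by blast
    qed
    hence "\<not> q dvd x - y" using nb[OF xy(3)] by blast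
    hence "coprime (q ^ j) (x - y)" using q by (simp add: prime_imp_coprime)
    thus ?thesis using d by (simp add: coprime_dvd_mult_right_iff)
  qed
  have k12: "q ^ j dvd a * (n1 + n2) + b" and k13: "q ^ j dvd a * (n1 + n3) + b"
    using n root by (auto intro!: key)
  have "\<not> q dvd a"
  proof
    assume "q dvd a"
    hence "q dvd a * (n1 + n2) + b - a * (n1 + n2)" using k12 qj by (meson dvd_diff dvd_mult2 dvd_trans)
    hence "q dvd b" by simp
    hence "q dvd b * b - 4 * a * c" using \<open>q dvd a\<close> by (intro dvd_diff dvd_mult dvd_mult2)
    thus False using D by (simp add: power2_eq_square)
  qed
  hence cop: "coprime (q ^ j) a" using q by (simp add: prime_imp_coprime)
  have "q ^ j dvd (a * (n1 + n2) + b) - (a * (n1 + n3) + b)" using k12 k13 by (rule dvd_diff)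
  also have "(a * (n1 + n2) + b) - (a * (n1 + n3) + b) = a * (n2 - n3)" by (simp add: algebra_simps)
  finally have "q ^ j dvd n2 - n3" using cop by (simp add: coprime_dvd_mult_right_iff)
  thus False using nd[of "n2 - n3"] n by simp
qed

text \<open>Half-open blocks of length \<open>q ^ j\<close> keep any two members less than
  \<open>q ^ j\<close> apart, so each holds at most two roots; \<open>K div q ^ j + 1\<close> blocks
  cover \<open>{1..K}\<close>.\<close>

lemma card_quadratic_roots_le:
  fixes a b c :: int and q :: nat
  assumes q: "prime q" and D: "\<not> int q dvd b ^ 2 - 4 * a * c" and j: "j > 0"
  shows "card {n \<in> {1..K}. int q ^ j dvd a * int n ^ 2 + b * int n + c} \<le> 2 * (K div q ^ j + 1)"
proof -
  define R where "R = (\<lambda>n::nat. int q ^ j dvd a * int n ^ 2 + b * int n + c)"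
  have q0: "q ^ j > 0" using q prime_gt_0_nat by simp
  have block: "card {n \<in> {i * q ^ j<..(i + 1) * q ^ j}. R n} \<le> 2" for i
  proof (rule ccontr)
    assume "\<not> ?thesis"
    then obtain T where T: "T \<subseteq> {n \<in> {i * q ^ j<..(i + 1) * q ^ j}. R n}" "card T = 3"
      using obtain_subset_with_card_n[of 3 "{n \<in> {i * q ^ j<..(i + 1) * q ^ j}. R n}"] by (auto simp: not_le)
    then obtain x y z where xyz: "T = {x, y, z}" "x \<noteq> y" "x \<noteq> z" "y \<noteq> z"
      by (auto simp: card_3_iff)
    have close: "\<bar>int u - int v\<bar> < int q ^ j" if "u \<in> T" "v \<in> T" for u v
    proof -
      have "i * q ^ j < u" "u \<le> i * q ^ j + q ^ j" "i * q ^ j < v" "v \<le> i * q ^ j + q ^ j"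
        using that T by auto
      hence "\<bar>int u - int v\<bar> < int (q ^ j)" by linarith
      thus ?thesis by simp
    qed
    have R: "R x" "R y" "R z" using T xyz by auto
    show False
      by (rule quadratic_roots_prime_power[of "int q" b a c j "int x" "int y" "int z"])
        (use q D j xyz R close in \<open>auto simp: R_def\<close>)
  qed
  have "{n \<in> {1..K}. R n} \<subseteq> (\<Union>i\<in>{..K div q ^ j}. {n \<in> {i * q ^ j<..(i + 1) * q ^ j}. R n})"
  proof
    fix n assume n: "n \<in> {n \<in> {1..K}. R n}"
    define i where "i = (n - 1) div q ^ j"
    have "i * q ^ j + (n - 1) mod q ^ j = n - 1" unfolding i_def by (rule div_mult_mod_eq)
    moreover have "(n - 1) mod q ^ j < q ^ j" using q0 by simp
    moreover have "n \<ge> 1" using n by simp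
    ultimately have "i * q ^ j < n" "n \<le> i * q ^ j + q ^ j" by linarith+
    moreover have "i \<le> K div q ^ j" unfolding i_def using n by (intro div_le_mono) auto
    ultimately show "n \<in> (\<Union>i\<in>{..K div q ^ j}. {n \<in> {i * q ^ j<..(i + 1) * q ^ j}. R n})"
      using n by auto
  qed
  hence "card {n \<in> {1..K}. R n} \<le> card (\<Union>i\<in>{..K div q ^ j}. {n \<in> {i * q ^ j<..(i + 1) * q ^ j}. R n})"
    by (intro card_mono) auto
  also have "\<dots> \<le> (\<Sum>i\<in>{..K div q ^ j}. card {n \<in> {i * q ^ j<..(i + 1) * q ^ j}. R n})"
    by (rule card_UN_le) simp
  also have "\<dots> \<le> (\<Sum>i\<in>{..K div q ^ j}. 2)" by (intro sum_mono block)
  finally show ?thesis by (simp add: R_def)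
qed

section \<open>Counting the prime factors of a product of values\<close>

lemma ln_eq_sum_multiplicity:
  fixes m :: nat
  assumes S: "finite S" "\<And>q. q \<in> S \<Longrightarrow> prime q" and m: "m > 0" "prime_factors m \<subseteq> S"
  shows "ln (real m) = (\<Sum>q\<in>S. real (multiplicity q m) * ln (real q))"
proof -
  have "m = (\<Prod>q\<in>prime_factors m. q ^ multiplicity q m)"
    using prod_prime_factors[of m] m by simp
  also have "\<dots> = (\<Prod>q\<in>S. q ^ multiplicity q m)"
    using S m by (intro prod.mono_neutral_left) (auto simp: prime_factors_multiplicity)
  finally have "real m = (\<Prod>q\<in>S. real q ^ multiplicity q m)" by (metis (no_types, lifting) of_nat_power of_nat_prod prod.cong)
  hence "ln (real m) = (\<Sum>q\<in>S. ln (real q ^ multiplicity q m))"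
    using S prime_gt_0_nat by (simp add: ln_prod)
  also have "\<dots> = (\<Sum>q\<in>S. real (multiplicity q m) * ln (real q))"
    using S prime_gt_0_nat by (intro sum.cong) (auto simp: ln_realpow)
  finally show ?thesis .
qed

text \<open>The multiplicity counts the exponents \<open>j\<close> with
  \<open>q ^ j dvd g n\<close>, and these are at most \<open>ln U / ln q\<close>. In
  \<open>2 * (K / q ^ j + 1)\<close> the first part sums to a geometric series, bounded by
  \<open>4 * K / q\<close>, and the second contributes \<open>2 * ln U\<close> after multiplication
  by \<open>ln q\<close>.\<close>

lemma sum_multiplicity_le:
  fixes g :: "nat \<Rightarrow> nat"
  assumes q: "prime q" and g: "\<And>n. n \<in> {1..K} \<Longrightarrow> g n > 0 \<and> real (g n) \<le> U" and U: "U \<ge> 1"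
    and roots: "\<And>j. j > 0 \<Longrightarrow> card {n \<in> {1..K}. q ^ j dvd g n} \<le> 2 * (K div q ^ j + 1)"
  shows "(\<Sum>n=1..K. real (multiplicity q (g n))) * ln (real q) \<le> 4 * real K * (ln (real q) / real q) + 2 * ln U"
proof -
  have q2: "real q \<ge> 2" using prime_ge_2_nat[OF q] by simp
  have lq: "ln (real q) > 0" using q2 by simp
  define J where "J = nat \<lfloor>ln U / ln (real q)\<rfloor>"
  have J: "real J * ln (real q) \<le> ln U"
  proof -
    have "real J \<le> ln U / ln (real q)" unfolding J_def using U lq by simp
    thus ?thesis using lq by (simp add: field_simps)
  qed
  have mult: "multiplicity q (g n) = card {j \<in> {1..J}. q ^ j dvd g n}" if n: "n \<in> {1..K}" for n
  proof -
    have "q ^ multiplicity q (g n) dvd g n" by (rule multiplicity_dvd)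
    hence "q ^ multiplicity q (g n) \<le> g n" using g[OF n] by (intro dvd_imp_le) auto
    hence "real q ^ multiplicity q (g n) \<le> U" using g[OF n] by (metis of_nat_le_iff of_nat_power order.trans)
    hence "ln (real q ^ multiplicity q (g n)) \<le> ln U" using q2 U by (subst ln_le_cancel_iff) auto
    hence "real (multiplicity q (g n)) * ln (real q) \<le> ln U" using q2 by (simp add: ln_realpow)
    hence "real (multiplicity q (g n)) \<le> ln U / ln (real q)" using lq by (simp add: field_simps)
    hence le: "multiplicity q (g n) \<le> J" unfolding J_def by (simp add: le_nat_floor)
    have "{j \<in> {1..J}. q ^ j dvd g n} = {1..multiplicity q (g n)}"
    proof -
      have "\<not> is_unit q" using q not_prime_unit by blast
      hence "q ^ x dvd g n \<longleftrightarrow> x \<le> multiplicity q (g n)" for x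
        using g[OF n] by (intro power_dvd_iff_le_multiplicity) auto
      hence "{j \<in> {1..J}. q ^ j dvd g n} = {j \<in> {1..J}. j \<le> multiplicity q (g n)}"
        by (simp only:)
      also have "\<dots> = {1..multiplicity q (g n)}" using le by auto
      finally show ?thesis .
    qed
    thus ?thesis by simp
  qed
  have "(\<Sum>n=1..K. real (multiplicity q (g n))) = (\<Sum>n=1..K. \<Sum>j=1..J. if q ^ j dvd g n then 1 else 0)"
    by (intro sum.cong refl) (simp add: mult sum.If_cases Int_def)
  also have "\<dots> = (\<Sum>j=1..J. \<Sum>n=1..K. if q ^ j dvd g n then 1 else 0)" by (rule sum.swap)
  also have "\<dots> = (\<Sum>j=1..J. real (card {n \<in> {1..K}. q ^ j dvd g n}))"
    by (intro sum.cong refl) (simp add: sum.If_cases Int_def)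
  also have "\<dots> \<le> (\<Sum>j=1..J. 2 * (real K * (1 / real q) ^ j) + 2)"
  proof (rule sum_mono)
    fix j assume "j \<in> {1..J}"
    hence "real (card {n \<in> {1..K}. q ^ j dvd g n}) \<le> real (2 * (K div q ^ j + 1))"
      using roots[of j] by (simp only: of_nat_le_iff atLeastAtMost_iff) simp
    also have "\<dots> = 2 * real (K div q ^ j) + 2" by simp
    also have "real (K div q ^ j) \<le> real K / real (q ^ j)" by (rule of_nat_div_le_of_nat)
    finally show "real (card {n \<in> {1..K}. q ^ j dvd g n}) \<le> 2 * (real K * (1 / real q) ^ j) + 2"
      by (simp add: power_divide)
  qed
  also have "\<dots> = 2 * real K * (\<Sum>j=1..J. (1 / real q) ^ j) + 2 * real J"
    by (simp add: sum.distrib sum_distrib_left mult.assoc)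
  also have "(\<Sum>j=1..J. (1 / real q) ^ j) \<le> 2 / real q"
  proof -
    have "(\<Sum>j=1..J. (1 / real q) ^ j) * (1 - 1 / real q) \<le> 1 / real q"
    proof -
      have "(\<Sum>j=1..J. (1 / real q) ^ j) * (1 - 1 / real q) = 1 / real q - (1 / real q) ^ Suc J"
      proof -
        have "(\<Sum>j=1..J. x ^ j) * (1 - x) = x - x ^ Suc J" for x :: real
        proof (induction J)
          case (Suc J)
          have "(\<Sum>j=1..Suc J. x ^ j) * (1 - x) = (\<Sum>j=1..J. x ^ j) * (1 - x) + x ^ Suc J * (1 - x)"
            by (simp add: distrib_right)
          also have "\<dots> = x - x ^ Suc (Suc J)" unfolding Suc.IH by (simp add: algebra_simps)
          finally show ?case .
        qed simp
        thus ?thesis by blast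
      qed
      thus ?thesis by simp
    qed
    moreover have "(\<Sum>j=1..J. (1 / real q) ^ j) * (1 / 2) \<le> (\<Sum>j=1..J. (1 / real q) ^ j) * (1 - 1 / real q)"
      using q2 by (intro mult_left_mono sum_nonneg) (auto simp: field_simps)
    ultimately have "(\<Sum>j=1..J. (1 / real q) ^ j) \<le> 2 * (1 / real q)" by linarith
    thus ?thesis by simp
  qed
  finally have "(\<Sum>n=1..K. real (multiplicity q (g n))) \<le> 2 * real K * (2 / real q) + 2 * real J"
    by (simp add: mult_left_mono)
  hence "(\<Sum>n=1..K. real (multiplicity q (g n))) * ln (real q) \<le> (2 * real K * (2 / real q) + 2 * real J) * ln (real q)"
    using lq by (intro mult_right_mono) auto
  also have "\<dots> = 4 * real K * (ln (real q) / real q) + 2 * (real J * ln (real q))" by (simp add: algebra_simps)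
  finally show ?thesis using J by linarith
qed

text \<open>Half of Mertens' theorem: the logarithm of \<open>N!\<close>, at most
  \<open>N * ln N\<close>, is at least the sum of \<open>real (N div q) * ln (real q)\<close>, and
  \<open>N div q\<close> is at least \<open>N / (2 * q)\<close> because
  \<open>q \<le> N\<close>.\<close>

lemma sum_ln_prime_over_prime_le:
  fixes N :: nat
  assumes N: "N \<ge> 1"
  shows "(\<Sum>q | prime q \<and> q \<le> N. ln (real q) / real q) \<le> 2 * ln (real N)"
proof -
  let ?P = "{q. prime q \<and> q \<le> N}"
  have fin: "finite ?P" by (rule finite_subset[of _ "{..N}"]) auto
  have "(\<Sum>q\<in>?P. real (N div q) * ln (real q)) = (\<Sum>q\<in>?P. \<Sum>k=1..N. if q dvd k then ln (real q) else 0)"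
  proof (intro sum.cong refl)
    fix q assume q: "q \<in> ?P"
    have "{k \<in> {1..N}. q dvd k} = (\<lambda>i. q * i) ` {1..N div q}"
      using q prime_gt_0_nat[of q] by (auto simp: image_iff less_eq_div_iff_mult_less_eq mult.commute elim!: dvdE)
    moreover have "inj_on (\<lambda>i. q * i) {1..N div q}" using q prime_gt_0_nat[of q] by (auto simp: inj_on_def)
    ultimately have "card {k \<in> {1..N}. q dvd k} = N div q" by (simp add: card_image)
    thus "real (N div q) * ln (real q) = (\<Sum>k=1..N. if q dvd k then ln (real q) else 0)"
      by (simp add: sum.If_cases Int_def)
  qed
  also have "\<dots> = (\<Sum>k=1..N. \<Sum>q\<in>?P. if q dvd k then ln (real q) else 0)" by (rule sum.swap)
  also have "\<dots> \<le> (\<Sum>k=1..N. ln (real N))"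
  proof (rule sum_mono)
    fix k assume k: "k \<in> {1..N}"
    have "(\<Sum>q\<in>?P. if q dvd k then ln (real q) else 0) \<le> (\<Sum>q\<in>?P. real (multiplicity q k) * ln (real q))"
    proof (rule sum_mono)
      fix q assume q: "q \<in> ?P"
      have "multiplicity q k \<ge> 1" if "q dvd k"
        using that q k by (simp add: prime_multiplicity_gt_zero_iff Suc_le_eq)
      moreover have "ln (real q) \<ge> 0" using q prime_ge_1_nat[of q] by simp
      ultimately show "(if q dvd k then ln (real q) else 0) \<le> real (multiplicity q k) * ln (real q)"
        using mult_right_mono[of 1 "real (multiplicity q k)" "ln (real q)"] by auto
    qed
    also have "\<dots> = ln (real k)"
      using k fin
      by (intro ln_eq_sum_multiplicity[symmetric]) (auto simp: in_prime_factors_iff intro: order.trans[OF dvd_imp_le])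
    also have "\<dots> \<le> ln (real N)" using k by (subst ln_le_cancel_iff) auto
    finally show "(\<Sum>q\<in>?P. if q dvd k then ln (real q) else 0) \<le> ln (real N)" .
  qed
  finally have 1: "(\<Sum>q\<in>?P. real (N div q) * ln (real q)) \<le> real N * ln (real N)" by simp
  have "real N / 2 * (\<Sum>q\<in>?P. ln (real q) / real q) = (\<Sum>q\<in>?P. real N / (2 * real q) * ln (real q))"
    by (simp add: sum_distrib_left)
  also have "\<dots> \<le> (\<Sum>q\<in>?P. real (N div q) * ln (real q))"
  proof (intro sum_mono mult_right_mono)
    fix q assume q: "q \<in> ?P"
    hence q0: "q > 0" using prime_gt_0_nat by auto
    have "N div q \<ge> 1" using q q0 by (simp add: div_greater_zero_iff Suc_le_eq)
    have "N = q * (N div q) + N mod q" by simp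
    moreover have "N mod q < q" using q0 by simp
    moreover have "q * 1 \<le> q * (N div q)" using \<open>N div q \<ge> 1\<close> by (intro mult_left_mono) auto
    ultimately have "N \<le> 2 * q * (N div q)" by linarith
    hence "real N \<le> real (2 * q * (N div q))" by (simp only: of_nat_le_iff)
    thus "real N / (2 * real q) \<le> real (N div q)" using q0 by (simp add: field_simps)
    show "ln (real q) \<ge> 0" using q prime_ge_1_nat[of q] by simp
  qed
  finally have "real N / 2 * (\<Sum>q\<in>?P. ln (real q) / real q) \<le> real N / 2 * (2 * ln (real N))"
    using 1 by simp
  thus ?thesis using N by simp
qed

text \<open>The primes up to \<open>M ^ 2\<close> are handled by the factorization of \<open>(M ^ 2)!\<close>, the others trivially.\<close>

lemma sum_ln_over_primes_le:
  fixes M :: nat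
  assumes S: "finite S" "\<And>q. q \<in> S \<Longrightarrow> prime q" "card S \<le> M" and M: "M \<ge> 1"
  shows "(\<Sum>q\<in>S. ln (real q) / real q) \<le> 4 * ln (real M) + 2"
proof -
  have "(\<Sum>q\<in>S. ln (real q) / real q) = (\<Sum>q\<in>{q\<in>S. q \<le> M ^ 2}. ln (real q) / real q) + (\<Sum>q\<in>{q\<in>S. \<not> q \<le> M ^ 2}. ln (real q) / real q)"
    using S(1) by (subst sum.union_disjoint[symmetric]) (auto intro!: sum.cong)
  also have "(\<Sum>q\<in>{q\<in>S. q \<le> M ^ 2}. ln (real q) / real q) \<le> (\<Sum>q | prime q \<and> q \<le> M ^ 2. ln (real q) / real q)"
  proof (rule sum_mono2)
    show "finite {q. prime q \<and> q \<le> M ^ 2}" by (rule finite_subset[of _ "{..M ^ 2}"]) auto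
    show "{q \<in> S. q \<le> M ^ 2} \<subseteq> {q. prime q \<and> q \<le> M ^ 2}" using S by auto
    show "0 \<le> ln (real q) / real q" if "q \<in> {q. prime q \<and> q \<le> M ^ 2} - {q \<in> S. q \<le> M ^ 2}" for q
      using that prime_ge_1_nat[of q] by simp
  qed
  also have "\<dots> \<le> 2 * ln (real (M ^ 2))" using M by (intro sum_ln_prime_over_prime_le) auto
  also have "\<dots> = 4 * ln (real M)" using M by (simp add: ln_realpow)
  \<comment> \<open>Beyond \<open>M ^ 2\<close> each term is at most \<open>2 / sqrt q\<close>,
    hence at most \<open>2 / M\<close>, and there are at most \<open>M\<close> of them.\<close>
  also have "(\<Sum>q\<in>{q\<in>S. \<not> q \<le> M ^ 2}. ln (real q) / real q) \<le> (\<Sum>q\<in>{q\<in>S. \<not> q \<le> M ^ 2}. 2 / real M)"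
  proof (rule sum_mono)
    fix q assume q: "q \<in> {q\<in>S. \<not> q \<le> M ^ 2}"
    hence "real (M ^ 2) \<le> real q" by (simp only: of_nat_le_iff) simp
    hence sq: "real M \<le> sqrt (real q)" by (intro real_le_rsqrt) simp
    have q1: "real q \<ge> 1" using q S prime_ge_1_nat by auto
    have "ln (real q) \<le> real q powr (1/2) / (1/2)" using q1 by (intro ln_powr_bound) auto
    hence "ln (real q) \<le> 2 * sqrt (real q)" by (simp add: powr_half_sqrt)
    hence "ln (real q) / real q \<le> 2 * sqrt (real q) / real q" using q1 by (intro divide_right_mono) auto
    also have "2 * sqrt (real q) / real q = 2 / sqrt (real q)"
      using q1 real_div_sqrt[of "real q"] by (simp add: field_simps)
    also have "\<dots> \<le> 2 / real M" using sq M q1 by (intro divide_left_mono mult_pos_pos) auto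
    finally show "ln (real q) / real q \<le> 2 / real M" .
  qed
  also have "\<dots> = real (card {q\<in>S. \<not> q \<le> M ^ 2}) * (2 / real M)" by simp
  also have "\<dots> \<le> real M * (2 / real M)"
    using card_mono[OF S(1), of "{q\<in>S. \<not> q \<le> M ^ 2}"] S(3) by (intro mult_right_mono) auto
  also have "\<dots> = 2" using M by simp
  finally show ?thesis by simp
qed

text \<open>The logarithm of the product of all \<open>g n\<close> is at least
  \<open>K * ln L\<close>. Factored over \<open>S\<close>, a prime \<open>q\<close> accounts for at
  most \<open>4 * K * ln q / q + 2 * ln U\<close>. Since \<open>M\<close> primes have total
  \<open>ln q / q\<close> only of order \<open>ln M\<close>, a small \<open>M\<close> contradicts
  this once \<open>K\<close> is large.\<close>

lemma count_prime_divisors_bound: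
  fixes g :: "nat \<Rightarrow> nat" and L U :: real
  assumes S: "finite S" "\<And>q. q \<in> S \<Longrightarrow> prime q" "card S \<le> M" and M: "M \<ge> 1"
    and g: "\<And>n. n \<in> {1..K} \<Longrightarrow> L \<le> real (g n) \<and> real (g n) \<le> U \<and> prime_factors (g n) \<subseteq> S"
    and L: "L > 0" and U: "U \<ge> 1"
    and roots: "\<And>q j. q \<in> S \<Longrightarrow> j > 0 \<Longrightarrow> card {n \<in> {1..K}. q ^ j dvd g n} \<le> 2 * (K div q ^ j + 1)"
  shows "real K * ln L \<le> 4 * real K * (4 * ln (real M) + 2) + 2 * real M * ln U"
proof -
  have gpos: "g n > 0" if "n \<in> {1..K}" for n using g[OF that] L by (cases "g n") auto
  have "real K * ln L = (\<Sum>n=1..K. ln L)" by simp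
  also have "\<dots> \<le> (\<Sum>n=1..K. ln (real (g n)))"
    using g gpos L by (intro sum_mono) (simp del: atLeastAtMost_iff)
  also have "\<dots> = (\<Sum>n=1..K. \<Sum>q\<in>S. real (multiplicity q (g n)) * ln (real q))"
    using S g gpos by (intro sum.cong refl ln_eq_sum_multiplicity) auto
  also have "\<dots> = (\<Sum>q\<in>S. (\<Sum>n=1..K. real (multiplicity q (g n))) * ln (real q))"
    by (subst sum.swap) (simp add: sum_distrib_right)
  also have "\<dots> \<le> (\<Sum>q\<in>S. 4 * real K * (ln (real q) / real q) + 2 * ln U)"
    using S g gpos U roots by (intro sum_mono sum_multiplicity_le) auto
  also have "\<dots> = 4 * real K * (\<Sum>q\<in>S. ln (real q) / real q) + 2 * real (card S) * ln U"
    by (simp add: sum.distrib sum_distrib_left)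
  also have "\<dots> \<le> 4 * real K * (4 * ln (real M) + 2) + 2 * real M * ln U"
    using sum_ln_over_primes_le[OF S M] S(3) U by (intro add_mono mult_left_mono mult_right_mono) auto
  finally show ?thesis .
qed

section \<open>Prime residues from quadratic forms\<close>

text \<open>\<open>4 * a\<close> times the value is a square minus the discriminant, which is
  therefore a square modulo \<open>q\<close>; \<open>Legendre_pstar\<close> transfers this to
  \<open>q\<close> modulo \<open>p\<close>.\<close>

lemma quad_residue_if_dvd_form:
  fixes a b c :: int
  assumes p: "prime p" "p > 2" and q: "prime q" "q > 2" and "p \<noteq> q"
    and D: "b ^ 2 - 4 * a * c = (-1) ^ ((p - 1) div 2) * int p"
    and dvd: "int q dvd a * n ^ 2 + b * n + c"
  shows "quad_residue (int q) (int p)"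
proof -
  let ?D = "(-1) ^ ((p - 1) div 2) * int p"
  have "int q dvd 4 * a * (a * n ^ 2 + b * n + c)" using dvd by (rule dvd_mult)
  also have "4 * a * (a * n ^ 2 + b * n + c) = (2 * a * n + b) ^ 2 - ?D"
    unfolding D[symmetric] by (simp add: power2_eq_square algebra_simps)
  finally have "[(2 * a * n + b) ^ 2 = ?D] (mod int q)" by (simp add: cong_iff_dvd_diff)
  hence QR: "QuadRes (int q) ?D" unfolding QuadRes_def by blast
  have "\<not> q dvd p" using p q \<open>p \<noteq> q\<close> primes_dvd_imp_eq[of q p] by blast
  hence "\<not> int q dvd ?D" by (cases "even ((p - 1) div 2)") auto
  hence "Legendre ?D (int q) = 1" using QR by (simp add: Legendre_def cong_0_iff)
  hence "Legendre (int q) (int p) = 1" using Legendre_pstar[OF p q \<open>p \<noteq> q\<close>] by simp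
  hence nz: "\<not> [int q = 0] (mod int p)" and "QuadRes (int p) (int q)"
    by (auto simp: Legendre_def split: if_splits)
  then obtain y where y: "[y ^ 2 = int q] (mod int p)" unfolding QuadRes_def by blast
  have "\<not> int p dvd y"
  proof
    assume "int p dvd y"
    hence "[y ^ 2 = 0] (mod int p)" by (simp add: cong_0_iff power2_eq_square)
    hence "[int q = 0] (mod int p)" using y by (meson cong_sym cong_trans)
    thus False using nz by blast
  qed
  thus ?thesis unfolding quad_residue_def using y cong_sym by blast
qed

text \<open>If there were at most \<open>r powr (\<epsilon> / 25)\<close> residues, the counting
  bound would give, per value, \<open>7/16 * ln r\<close> at most about \<open>16 * ln M\<close>. As
  \<open>\<epsilon> \<le> 1/2\<close>, that is about \<open>16/50 * ln r\<close>, and 16/50 is below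
  7/16: this is where the constant 25 is spent.\<close>

lemma many_residues_if_form:
  fixes \<epsilon> :: real
  assumes \<epsilon>: "0 < \<epsilon>" "\<epsilon> \<le> 1/2"
  shows "\<exists>P. \<forall>p a b c K. prime p \<longrightarrow> p > 2 \<longrightarrow> real p \<ge> P \<longrightarrow>
     b ^ 2 - 4 * a * c = (-1) ^ ((p - 1) div 2) * int p \<longrightarrow>
     real p powr (3 * \<epsilon> / 8) / 2 \<le> real K \<longrightarrow>
     (\<forall>n\<in>{1..K}. real p powr (7/16) / 4 \<le> of_int (a * int n ^ 2 + b * int n + c) \<and>
         of_int (a * int n ^ 2 + b * int n + c) < real p powr (1/2 + \<epsilon>)) \<longrightarrow>
     real (card {q. prime q \<and> real q < real p powr (1/2 + \<epsilon>) \<and> quad_residue (int q) (int p)}) > real p powr (\<epsilon> / 25)"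
proof -
  have "((\<lambda>r::real. r powr - (\<epsilon> / 4) * ln r) \<longlongrightarrow> 0) at_top" using \<epsilon> by real_asymp
  hence "eventually (\<lambda>r::real. r powr - (\<epsilon> / 4) * ln r < 1) at_top" by (rule order_tendstoD) simp
  moreover have "eventually (\<lambda>r::real. ln r > 300) at_top" by real_asymp
  ultimately have "eventually (\<lambda>r::real. r powr - (\<epsilon> / 4) * ln r < 1 \<and> ln r > 300) at_top"
    by (rule eventually_conj)
  then obtain P where P: "\<And>r::real. r \<ge> P \<Longrightarrow> r powr - (\<epsilon> / 4) * ln r < 1" "\<And>r::real. r \<ge> P \<Longrightarrow> ln r > 300"
    unfolding eventually_at_top_linorder by blast
  show ?thesis
  proof (intro exI[of _ P] allI impI)
    fix p K :: nat and a b c :: int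
    assume p: "prime p" "p > 2" "real p \<ge> P" and D: "b ^ 2 - 4 * a * c = (-1) ^ ((p - 1) div 2) * int p"
      and K: "real p powr (3 * \<epsilon> / 8) / 2 \<le> real K"
      and f: "\<forall>n\<in>{1..K}. real p powr (7/16) / 4 \<le> of_int (a * int n ^ 2 + b * int n + c) \<and>
         of_int (a * int n ^ 2 + b * int n + c) < real p powr (1/2 + \<epsilon>)"
    define r where "r = real p"
    define Q where "Q = {q. prime q \<and> real q < r powr (1/2 + \<epsilon>) \<and> quad_residue (int q) (int p)}"
    define g where "g = (\<lambda>n::nat. nat (a * int n ^ 2 + b * int n + c))"
    define S where "S = insert 2 Q"
    have r: "r > 2" using p by (simp add: r_def)
    have lnr: "ln r > 300" using P(2) p by (simp add: r_def)
    have up: "r powr (1/2 + \<epsilon>) \<le> r" using powr_mono[of "1/2 + \<epsilon>" 1 r] r \<epsilon> by simp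
    have "Q \<subseteq> {..p}" using up by (auto simp: Q_def r_def)
    hence finQ: "finite Q" by (rule finite_subset) simp
    have gf: "int (g n) = a * int n ^ 2 + b * int n + c" "r powr (7/16) / 4 \<le> real (g n)" "real (g n) < r powr (1/2 + \<epsilon>)"
      if n: "n \<in> {1..K}" for n
    proof -
      have fn: "r powr (7/16) / 4 \<le> of_int (a * int n ^ 2 + b * int n + c)"
         "of_int (a * int n ^ 2 + b * int n + c) < r powr (1/2 + \<epsilon>)" using f n by (auto simp: r_def)
      have "(0::real) < r powr (7/16) / 4" using r by simp
      hence "0 < real_of_int (a * int n ^ 2 + b * int n + c)" using fn(1) by linarith
      hence "a * int n ^ 2 + b * int n + c > 0" by (simp only: of_int_0_less_iff)
      thus eq: "int (g n) = a * int n ^ 2 + b * int n + c" unfolding g_def by simp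
      have "real (g n) = of_int (a * int n ^ 2 + b * int n + c)" unfolding eq[symmetric] by simp
      thus "r powr (7/16) / 4 \<le> real (g n)" "real (g n) < r powr (1/2 + \<epsilon>)" using fn by simp_all
    qed
    show "real (card {q. prime q \<and> real q < real p powr (1/2 + \<epsilon>) \<and> quad_residue (int q) (int p)}) > real p powr (\<epsilon> / 25)"
    proof (rule ccontr)
      assume "\<not> ?thesis"
      hence cQ: "real (card Q) \<le> r powr (\<epsilon> / 25)" by (simp add: Q_def r_def)
      \<comment> \<open>The added 1 makes room for the prime 2.\<close>
      define M where "M = nat \<lfloor>r powr (\<epsilon> / 25)\<rfloor> + 1"
      have re1: "1 \<le> r powr (\<epsilon> / 25)" using r \<epsilon> by (intro ge_one_powr_ge_zero) auto
      have M: "M \<ge> 1" "real M \<le> 2 * r powr (\<epsilon> / 25)" using re1 by (auto simp: M_def) linarith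
      have "card Q \<le> nat \<lfloor>r powr (\<epsilon> / 25)\<rfloor>" using cQ by (simp add: le_nat_floor)
      hence cS: "card S \<le> M" by (simp add: S_def M_def card_insert_if finQ)
      have "(0::real) < r powr (7/16) / 4" using r by simp
      hence main: "real K * ln (r powr (7/16) / 4) \<le> 4 * real K * (4 * ln (real M) + 2) + 2 * real M * ln r"
      proof (intro count_prime_divisors_bound[where S = S and g = g])
        show "finite S" using finQ by (simp add: S_def)
        show "prime q" if "q \<in> S" for q using that by (auto simp: S_def Q_def)
        show "card S \<le> M" by fact
        show "M \<ge> 1" by fact
        show "1 \<le> r" using r by simp
        show "r powr (7/16) / 4 \<le> real (g n) \<and> real (g n) \<le> r \<and> prime_factors (g n) \<subseteq> S" if n: "n \<in> {1..K}" for n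
        proof (intro conjI subsetI)
          show "r powr (7/16) / 4 \<le> real (g n)" by (rule gf[OF n])
          show "real (g n) \<le> r" using gf(3)[OF n] up by linarith
          fix q assume "q \<in> prime_factors (g n)"
          hence q: "prime q" "q dvd g n" "g n > 0" by (auto simp: prime_factors_dvd intro: gr0I)
          have "q \<le> g n" using q by (intro dvd_imp_le) auto
          hence ql: "real q < r powr (1/2 + \<epsilon>)" using gf(3)[OF n] by linarith
          hence "q \<noteq> p" using up by (auto simp: r_def)
          show "q \<in> S"
          proof (cases "q = 2")
            case False
            hence "q > 2" using prime_ge_2_nat[OF q(1)] by simp
            moreover have "int q dvd a * int n ^ 2 + b * int n + c"
              using q(2) unfolding gf(1)[OF n, symmetric] by simp
            ultimately have "quad_residue (int q) (int p)"
              using quad_residue_if_dvd_form[OF p(1,2) q(1) _ _ D] \<open>q \<noteq> p\<close> by blast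
            thus ?thesis using q(1) ql by (simp add: S_def Q_def)
          qed (simp add: S_def)
        qed
        show "card {n \<in> {1..K}. q ^ j dvd g n} \<le> 2 * (K div q ^ j + 1)" if q: "q \<in> S" and j: "j > 0" for q j
        proof -
          have pq: "prime q" using q by (auto simp: S_def Q_def)
          have "q \<noteq> p" using q up p(2) by (auto simp: S_def Q_def r_def)
          hence "\<not> q dvd p" using p(1) pq primes_dvd_imp_eq[of q p] by blast
          hence "\<not> int q dvd b ^ 2 - 4 * a * c" unfolding D by (cases "even ((p - 1) div 2)") auto
          hence "card {n \<in> {1..K}. int q ^ j dvd a * int n ^ 2 + b * int n + c} \<le> 2 * (K div q ^ j + 1)"
            using pq j by (intro card_quadratic_roots_le)
          also have "{n \<in> {1..K}. int q ^ j dvd a * int n ^ 2 + b * int n + c} = {n \<in> {1..K}. q ^ j dvd g n}"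
          proof (intro Collect_cong conj_cong refl)
            fix n assume "n \<in> {1..K}"
            show "int q ^ j dvd a * int n ^ 2 + b * int n + c \<longleftrightarrow> q ^ j dvd g n"
              unfolding gf(1)[OF \<open>n \<in> {1..K}\<close>, symmetric] by (simp flip: of_nat_power)
          qed
          finally show ?thesis .
        qed
      qed
      have lnL: "ln (r powr (7/16) / 4) = 7/16 * ln r - ln 4"
        using r by (simp add: ln_div ln_powr)
      have lnM: "ln (real M) \<le> ln 2 + 1/50 * ln r"
      proof -
        have "ln (real M) \<le> ln (2 * r powr (\<epsilon> / 25))" using M by (subst ln_le_cancel_iff) auto
        also have "\<dots> = ln 2 + \<epsilon> / 25 * ln r" using r by (simp add: ln_mult ln_powr)
        also have "\<epsilon> / 25 * ln r \<le> 1/50 * ln r" using \<epsilon> lnr by (intro mult_right_mono) auto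
        finally show ?thesis by simp
      qed
      have "4 * real K * (4 * ln (real M) + 2) \<le> 4 * real K * (4 * (ln 2 + 1/50 * ln r) + 2)"
        using lnM by (intro mult_left_mono) auto
      moreover have "2 * real M * ln r \<le> 8 * real K"
      proof -
        have "2 * real M * ln r \<le> 2 * (2 * r powr (\<epsilon> / 25)) * ln r"
          using M lnr by (intro mult_right_mono mult_left_mono) auto
        \<comment> \<open>\<open>\<epsilon> / 25\<close> is below
          \<open>3 * \<epsilon> / 8 - \<epsilon> / 4\<close>; the split-off factor
          \<open>r powr - (\<epsilon> / 4)\<close> absorbs \<open>ln r\<close>, and the rest is at
          most \<open>2 * K\<close>.\<close>
        also have "r powr (\<epsilon> / 25) \<le> r powr (3 * \<epsilon> / 8 + - (\<epsilon> / 4))"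
          using r \<epsilon> by (intro powr_mono) auto
        hence "2 * (2 * r powr (\<epsilon> / 25)) * ln r \<le> 2 * (2 * r powr (3 * \<epsilon> / 8 + - (\<epsilon> / 4))) * ln r"
          using lnr by (intro mult_right_mono mult_left_mono) auto
        also have "\<dots> = 4 * r powr (3 * \<epsilon> / 8) * (r powr - (\<epsilon> / 4) * ln r)"
          by (simp only: powr_add)
        also have "\<dots> \<le> 4 * r powr (3 * \<epsilon> / 8) * 1"
          using P(1)[of r] p by (intro mult_left_mono) (auto simp: r_def)
        also have "\<dots> \<le> 8 * real K" using K by (simp add: r_def)
        finally show ?thesis .
      qed
      ultimately have "real K * (7/16 * ln r - ln 4) \<le> 4 * real K * (4 * (ln 2 + 1/50 * ln r) + 2) + 8 * real K"
        using main unfolding lnL by linarith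
      hence "real K * (7/16 * ln r - ln 4) \<le> real K * (4 * (4 * (ln 2 + 1/50 * ln r) + 2) + 8)"
        by (simp add: algebra_simps)
      moreover have "0 < r powr (3 * \<epsilon> / 8) / 2" using r by simp
      hence "real K > 0" using K unfolding r_def by linarith
      ultimately have fin: "7/16 * ln r - ln 4 \<le> 4 * (4 * (ln 2 + 1/50 * ln r) + 2) + 8" by simp
      have ln4: "ln (4::real) = 2 * ln 2" using ln_realpow[of 2 2] by simp
      have ln2: "ln (2::real) \<le> 1" using ln_le_minus_one[of 2] by simp
      \<comment> \<open>Collecting terms leaves \<open>47/400 * x \<le> 16 + 18 * y\<close>, hence
        \<open>x < 290\<close>; the threshold 300 for \<open>ln r\<close> was fixed with this in
        view.\<close>
      have "x \<le> 300" if "7/16 * x - 2 * y \<le> 4 * (4 * (y + 1/50 * x) + 2) + 8" "y \<le> 1" for x y :: real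
        using that by (simp add: field_simps)
      from this[OF fin[unfolded ln4] ln2] show False using lnr by linarith
    qed
  qed
qed

section \<open>Suitable polynomials for the two classes of p modulo 4\<close>

text \<open>The larger root \<open>(sqrt p - b) / 2\<close> of \<open>n ^ 2 + b * n + c\<close> lies
  in [-1, 0), so for \<open>1 \<le> n \<le> K\<close> the values are of order
  \<open>n * sqrt p\<close>.\<close>

lemma residues_1_mod_4:
  fixes \<epsilon> :: real
  assumes \<epsilon>: "0 < \<epsilon>" "\<epsilon> \<le> 1/2"
  shows "\<exists>P. \<forall>p. prime p \<longrightarrow> p mod 4 = 1 \<longrightarrow> real p \<ge> P \<longrightarrow>
     real (card {q. prime q \<and> real q < real p powr (1/2 + \<epsilon>) \<and> quad_residue (int q) (int p)}) > real p powr (\<epsilon> / 25)"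
proof -
  obtain P1 where P1: "\<And>p a b c K. prime p \<Longrightarrow> p > 2 \<Longrightarrow> real p \<ge> P1 \<Longrightarrow>
     b ^ 2 - 4 * a * c = (-1) ^ ((p - 1) div 2) * int p \<Longrightarrow>
     real p powr (3 * \<epsilon> / 8) / 2 \<le> real K \<Longrightarrow>
     (\<forall>n\<in>{1..K}. real p powr (7/16) / 4 \<le> of_int (a * int n ^ 2 + b * int n + c) \<and>
         of_int (a * int n ^ 2 + b * int n + c) < real p powr (1/2 + \<epsilon>)) \<Longrightarrow>
     real (card {q. prime q \<and> real q < real p powr (1/2 + \<epsilon>) \<and> quad_residue (int q) (int p)}) > real p powr (\<epsilon> / 25)"
    using many_residues_if_form[OF \<epsilon>] by blast
  have "((\<lambda>r::real. 8 * r powr - (\<epsilon> / 2)) \<longlongrightarrow> 0) at_top" using \<epsilon> by real_asymp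
  hence "eventually (\<lambda>r::real. 8 * r powr - (\<epsilon> / 2) < 1) at_top" by (rule order_tendstoD) simp
  then obtain P2 where P2: "\<And>r::real. r \<ge> P2 \<Longrightarrow> 8 * r powr - (\<epsilon> / 2) < 1"
    unfolding eventually_at_top_linorder by blast
  show ?thesis
  proof (intro exI[of _ "max 16 (max P1 P2)"] allI impI)
    fix p :: nat assume p: "prime p" "p mod 4 = 1" "real p \<ge> max 16 (max P1 P2)"
    define r where "r = real p"
    have r: "r \<ge> 16" using p by (simp add: r_def)
    have sr: "sqrt r = r powr (1/2)" using r by (simp add: powr_half_sqrt)
    have sr4: "sqrt r \<ge> 4" using r real_sqrt_le_mono[of "4 ^ 2" r] by simp
    define m where "m = nat \<lfloor>sqrt r\<rfloor>"
    have m: "real m \<le> sqrt r" "sqrt r < real m + 1" unfolding m_def using sr4 by linarith+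
    \<comment> \<open>The least odd integer above \<open>sqrt r\<close>. It makes
      \<open>c = (b ^ 2 - p) / 4\<close> an integer between 0 and \<open>2 * sqrt r\<close>.\<close>
    define b :: int where "b = (if even m then int m + 1 else int m + 2)"
    have b: "odd b" "of_int b > sqrt r" "of_int b \<le> sqrt r + 2" using m by (auto simp: b_def)
    obtain t where t: "b = 2 * t + 1" using b(1) by (elim oddE)
    obtain u where u: "int p = 4 * u + 1" using p(2) by (metis mult_div_mod_eq of_nat_1 of_nat_add of_nat_mult of_nat_numeral)
    define c where "c = t ^ 2 + t - u"
    have c: "4 * c = b ^ 2 - int p" unfolding c_def t u by (simp add: power2_eq_square algebra_simps)
    have rc: "4 * real_of_int c = (of_int b) ^ 2 - r"
      using arg_cong[OF c, of real_of_int] by (simp add: r_def)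
    have c0: "real_of_int c \<ge> 0"
    proof -
      have "(of_int b) ^ 2 \<ge> (sqrt r) ^ 2" using b(2) r by (intro power_mono) auto
      thus ?thesis using rc r by simp
    qed
    have c1: "real_of_int c \<le> 2 * sqrt r"
    proof -
      have "real_of_int b \<ge> 0" using b(2) sr4 by linarith
      hence "(of_int b) ^ 2 \<le> (sqrt r + 2) ^ 2" using b(3) by (intro power_mono)
      also have "\<dots> = r + 4 * sqrt r + 4" using r by (simp add: power2_eq_square algebra_simps)
      finally show ?thesis using rc sr4 by linarith
    qed
    define K where "K = nat \<lfloor>r powr (3 * \<epsilon> / 8)\<rfloor>"
    have rK: "1 \<le> r powr (3 * \<epsilon> / 8)" using r \<epsilon> by (intro ge_one_powr_ge_zero) auto
    have "1 \<le> \<lfloor>r powr (3 * \<epsilon> / 8)\<rfloor>" using rK by (simp add: le_floor_iff)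
    hence K: "real K \<le> r powr (3 * \<epsilon> / 8)" "r powr (3 * \<epsilon> / 8) / 2 \<le> real K"
      unfolding K_def by linarith+
    have Ks: "real K \<le> sqrt r"
    proof -
      have "r powr (3 * \<epsilon> / 8) \<le> r powr (1/2)" using r \<epsilon> by (intro powr_mono) auto
      thus ?thesis using K sr by simp
    qed
    have "real p powr (7/16) / 4 \<le> of_int (1 * int n ^ 2 + b * int n + c) \<and>
         of_int (1 * int n ^ 2 + b * int n + c) < real p powr (1/2 + \<epsilon>)" if n: "n \<in> {1..K}" for n
    proof
      have n1: "real n \<ge> 1" "real n \<le> real K" using n by auto
      have e: "real_of_int (1 * int n ^ 2 + b * int n + c) = real n ^ 2 + of_int b * real n + of_int c" by simp
      have "sqrt r * 1 \<le> of_int b * real n" using b n1 sr4 by (intro mult_mono) auto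
      hence low: "sqrt r \<le> real_of_int (1 * int n ^ 2 + b * int n + c)" unfolding e using c0 zero_le_power2[of "real n"] by linarith
      have "r powr (7/16) \<le> sqrt r" unfolding sr using r by (intro powr_mono) auto
      hence "r powr (7/16) / 4 \<le> sqrt r" using sr4 by linarith
      thus "real p powr (7/16) / 4 \<le> of_int (1 * int n ^ 2 + b * int n + c)" using low unfolding r_def by linarith
      have s0: "0 \<le> sqrt r" using r by simp
      have "real n ^ 2 \<le> real K * sqrt r" unfolding power2_eq_square using n1 Ks s0 by (intro mult_mono) auto
      moreover have "of_int b * real n \<le> (2 * sqrt r) * real K" using b n1 sr4 s0  by (intro mult_mono) auto
      hence "of_int b * real n \<le> 2 * (real K * sqrt r)" by (simp only: mult_ac)
      moreover have "0 \<le> real K * sqrt r" using s0 by simp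
      moreover have "1 * sqrt r \<le> real K * sqrt r" using n1 s0 by (intro mult_right_mono) auto
      ultimately have "real_of_int (1 * int n ^ 2 + b * int n + c) \<le> 8 * (real K * sqrt r)"
        unfolding e using c1 by linarith
      also have "\<dots> \<le> 8 * (r powr (3 * \<epsilon> / 8) * sqrt r)" using K s0 by (intro mult_left_mono mult_right_mono) auto
      also have "\<dots> = 8 * r powr (1/2 + 3 * \<epsilon> / 8)" unfolding sr by (simp add: mult.commute flip: powr_add)
      also have "\<dots> \<le> 8 * r powr (1/2 + \<epsilon> + - (\<epsilon> / 2))" using r \<epsilon> by (intro mult_left_mono powr_mono) auto
      also have "\<dots> = r powr (1/2 + \<epsilon>) * (8 * r powr - (\<epsilon> / 2))" by (simp only: powr_add mult_ac)
      also have "\<dots> < r powr (1/2 + \<epsilon>) * 1" using P2[of r] p r by (intro mult_strict_left_mono) (auto simp: r_def)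
      finally show "of_int (1 * int n ^ 2 + b * int n + c) < real p powr (1/2 + \<epsilon>)" by (simp add: r_def)
    qed
    moreover have "b ^ 2 - 4 * 1 * c = (-1) ^ ((p - 1) div 2) * int p"
    proof -
      have "even ((p - 1) div 2)" using p(2) by presburger
      thus ?thesis using c by simp
    qed
    ultimately show "real (card {q. prime q \<and> real q < real p powr (1/2 + \<epsilon>) \<and> quad_residue (int q) (int p)}) > real p powr (\<epsilon> / 25)"
      using p r K by (intro P1[of p b 1 c K]) (auto simp: r_def)
  qed
qed

text \<open>\<open>4 * a\<close> times a value is a square plus \<open>p\<close>, so every value is
  at least \<open>p / (4 * a)\<close>; the upper end of the window for \<open>a\<close> makes this
  large enough. The lower end gives \<open>p \<le> a * x\<close>, which keeps \<open>c\<close> of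
  order \<open>x\<close>.\<close>

lemma residues_3_mod_4:
  fixes \<epsilon> :: real
  assumes \<epsilon>: "0 < \<epsilon>" "\<epsilon> \<le> 1/2"
  shows "\<exists>P. \<forall>p. prime p \<longrightarrow> p mod 4 = 3 \<longrightarrow> real p \<ge> P \<longrightarrow>
     real (card {q. prime q \<and> real q < real p powr (1/2 + \<epsilon>) \<and> quad_residue (int q) (int p)}) > real p powr (\<epsilon> / 25)"
proof -
  obtain P1 where P1: "\<And>p a b c K. prime p \<Longrightarrow> p > 2 \<Longrightarrow> real p \<ge> P1 \<Longrightarrow>
     b ^ 2 - 4 * a * c = (-1) ^ ((p - 1) div 2) * int p \<Longrightarrow>
     real p powr (3 * \<epsilon> / 8) / 2 \<le> real K \<Longrightarrow>
     (\<forall>n\<in>{1..K}. real p powr (7/16) / 4 \<le> of_int (a * int n ^ 2 + b * int n + c) \<and>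
         of_int (a * int n ^ 2 + b * int n + c) < real p powr (1/2 + \<epsilon>)) \<Longrightarrow>
     real (card {q. prime q \<and> real q < real p powr (1/2 + \<epsilon>) \<and> quad_residue (int q) (int p)}) > real p powr (\<epsilon> / 25)"
    using many_residues_if_form[OF \<epsilon>] by blast
  have "0 < \<epsilon> / 8" "\<epsilon> / 8 < 1/2" using \<epsilon> by auto
  then obtain P3 where P3: "\<And>p. prime p \<Longrightarrow> p mod 4 = 3 \<Longrightarrow> real p \<ge> P3 \<Longrightarrow>
     \<exists>a>0. \<exists>b::int. real p powr (1/2 - \<epsilon> / 8) \<le> real a \<and> real a \<le> real p powr (1/2 + \<epsilon> / 8) \<and> 4 * int a dvd b ^ 2 + int p"
    using exists_form_in_window by blast
  have "((\<lambda>r::real. 5 * r powr - (\<epsilon> / 8)) \<longlongrightarrow> 0) at_top" using \<epsilon> by real_asymp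
  hence "eventually (\<lambda>r::real. 5 * r powr - (\<epsilon> / 8) < 1) at_top" by (rule order_tendstoD) simp
  then obtain P2 where P2: "\<And>r::real. r \<ge> P2 \<Longrightarrow> 5 * r powr - (\<epsilon> / 8) < 1"
    unfolding eventually_at_top_linorder by blast
  show ?thesis
  proof (intro exI[of _ "max 3 (max P1 (max P2 P3))"] allI impI)
    fix p :: nat assume p: "prime p" "p mod 4 = 3" "real p \<ge> max 3 (max P1 (max P2 P3))"
    define r where "r = real p"
    have r: "r \<ge> 3" using p by (simp add: r_def)
    obtain a b0 where a: "a > 0" "r powr (1/2 - \<epsilon> / 8) \<le> real a" "real a \<le> r powr (1/2 + \<epsilon> / 8)" "4 * int a dvd b0 ^ 2 + int p"
      using P3[of p] p by (auto simp: r_def)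
    define x where "x = r powr (1/2 + \<epsilon> / 8)"
    have x0: "x \<ge> 1" unfolding x_def using r \<epsilon> by (intro ge_one_powr_ge_zero) auto
    \<comment> \<open>A translation of \<open>n\<close> changes the middle coefficient by a multiple
      of \<open>2 * a\<close>, so it can be reduced; then all three coefficients are of order
      \<open>x\<close>.\<close>
    define b where "b = b0 mod (2 * int a)"
    have b: "0 \<le> b" "b < 2 * int a" using a(1) by (simp_all add: b_def)
    have "4 * int a dvd b ^ 2 + int p"
    proof -
      have "b0 = b + 2 * int a * (b0 div (2 * int a))" by (simp add: b_def)
      then obtain k where "b0 = b + 2 * int a * k" by blast
      hence "b0 ^ 2 + int p = (b ^ 2 + int p) + 4 * int a * (k * b + int a * k ^ 2)"
        by (simp add: power2_eq_square algebra_simps)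
      thus ?thesis using a(4) by (metis dvd_add_left_iff dvd_triv_left)
    qed
    then obtain c where c: "b ^ 2 + int p = 4 * int a * c" by blast
    have a0: "real a > 0" using a(1) by simp
    have rc: "(of_int b) ^ 2 + r = 4 * real a * of_int c"
      using arg_cong[OF c, of real_of_int] by (simp add: r_def)
    have rax: "r \<le> real a * x"
    proof -
      have "r = r powr (1/2 - \<epsilon> / 8) * x" unfolding x_def powr_add[symmetric] using r by simp
      also have "\<dots> \<le> real a * x" using a(2) x0 by (intro mult_right_mono) auto
      finally show ?thesis .
    qed
    have c1: "real_of_int c \<le> real a + x"
    proof -
      have "(of_int b) ^ 2 \<le> (2 * real a) ^ 2" using b by (intro power_mono) (auto simp flip: of_int_le_iff)
      moreover have "0 \<le> real a * x" using a0 x0 by simp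
      ultimately have "4 * real a * of_int c \<le> 4 * real a * (real a + x)"
        using rc rax by (simp add: power2_eq_square algebra_simps)
      thus ?thesis using a0 by simp
    qed
    define K where "K = nat \<lfloor>r powr (3 * \<epsilon> / 8)\<rfloor>"
    have rK: "1 \<le> r powr (3 * \<epsilon> / 8)" using r \<epsilon> by (intro ge_one_powr_ge_zero) auto
    have "1 \<le> \<lfloor>r powr (3 * \<epsilon> / 8)\<rfloor>" using rK by (simp add: le_floor_iff)
    hence K: "real K \<le> r powr (3 * \<epsilon> / 8)" "r powr (3 * \<epsilon> / 8) / 2 \<le> real K"
      unfolding K_def by linarith+
    have "real p powr (7/16) / 4 \<le> of_int (int a * int n ^ 2 + b * int n + c) \<and>
         of_int (int a * int n ^ 2 + b * int n + c) < real p powr (1/2 + \<epsilon>)" if n: "n \<in> {1..K}" for n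
    proof
      have n1: "real n \<ge> 1" "real n \<le> real K" using n by auto
      define F where "F = real_of_int (int a * int n ^ 2 + b * int n + c)"
      have F: "F = real a * real n ^ 2 + of_int b * real n + of_int c" by (simp add: F_def)
      have "4 * real a * F = (2 * real a * real n + of_int b) ^ 2 + r"
        using rc unfolding F by (simp add: power2_eq_square algebra_simps)
      hence "r \<le> 4 * real a * F" using zero_le_power2[of "2 * real a * real n + of_int b"] by linarith
      hence "r / (4 * real a) \<le> F" using a0 by (simp add: field_simps)
      moreover have "r powr (7/16) / 4 \<le> r / (4 * real a)"
      proof -
        have "real a * r powr (7/16) \<le> x * r powr (7/16)" using a(3) unfolding x_def by (intro mult_right_mono) auto
        also have "\<dots> = r powr (1/2 + \<epsilon> / 8 + 7/16)" unfolding x_def by (rule powr_add[symmetric])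
        also have "\<dots> \<le> r powr 1" using r \<epsilon> by (intro powr_mono) auto
        finally have "real a * r powr (7/16) \<le> r" using r by simp
        thus ?thesis using a0 by (simp add: field_simps)
      qed
      ultimately show "real p powr (7/16) / 4 \<le> of_int (int a * int n ^ 2 + b * int n + c)"
        unfolding F_def r_def by linarith
      have K1: "real K \<ge> 1" using n1 by linarith
      have ax: "real a \<le> x" using a(3) by (simp add: x_def)
      have nK: "real n ^ 2 \<le> real K ^ 2" "real n \<le> real K ^ 2"
      proof -
        show 1: "real n ^ 2 \<le> real K ^ 2" using n1 by (intro power_mono) auto
        have "real n * 1 \<le> real n * real n" using n1 by (intro mult_left_mono) auto
        thus "real n \<le> real K ^ 2" using 1 by (simp add: power2_eq_square)
      qed
      have "real a * real n ^ 2 \<le> x * real K ^ 2" using ax nK x0 by (intro mult_mono) auto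
      moreover have "of_int b * real n \<le> (2 * x) * real K ^ 2"
      proof (rule mult_mono)
        have "real_of_int b \<le> real_of_int (2 * int a)" using b(2) by (intro of_int_le_iff[THEN iffD2]) simp
        thus "real_of_int b \<le> 2 * x" using ax by simp
      qed (use nK x0 in auto)
      moreover have "of_int c \<le> (2 * x) * real K ^ 2"
      proof -
        have "1 \<le> real K ^ 2" using K1 by simp
        hence "(2 * x) * 1 \<le> (2 * x) * real K ^ 2" using x0 by (intro mult_left_mono) auto
        thus ?thesis using c1 ax by linarith
      qed
      \<comment> \<open>The three coefficients are at most \<open>x\<close>, \<open>2 * x\<close>
        and \<open>2 * x\<close>, and \<open>x * real K ^ 2\<close> is at most
        \<open>r powr (1/2 + \<epsilon>/8 + 3 * \<epsilon>/4)\<close>; the missing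
        \<open>\<epsilon> / 8\<close> absorbs the factor 5.\<close>
      ultimately have "F \<le> 5 * (x * real K ^ 2)" unfolding F by linarith
      also have "\<dots> \<le> 5 * (x * (r powr (3 * \<epsilon> / 8)) ^ 2)"
        using K x0 by (intro mult_left_mono power_mono) auto
      also have "x * (r powr (3 * \<epsilon> / 8)) ^ 2 = r powr (1/2 + \<epsilon>) * r powr - (\<epsilon> / 8)"
        unfolding x_def power2_eq_square powr_add[symmetric] by (rule arg_cong[of _ _ "(powr) r"]) simp
      also have "5 * (r powr (1/2 + \<epsilon>) * r powr - (\<epsilon> / 8)) = r powr (1/2 + \<epsilon>) * (5 * r powr - (\<epsilon> / 8))" by simp
      also have "\<dots> < r powr (1/2 + \<epsilon>) * 1"
        using P2[of r] p r by (intro mult_strict_left_mono) (auto simp: r_def)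
      finally show "of_int (int a * int n ^ 2 + b * int n + c) < real p powr (1/2 + \<epsilon>)"
        unfolding F_def r_def by simp
    qed
    moreover have "b ^ 2 - 4 * int a * c = (-1) ^ ((p - 1) div 2) * int p"
    proof -
      have "odd ((p - 1) div 2)" using p(2) by presburger
      thus ?thesis using c by simp
    qed
    ultimately show "real (card {q. prime q \<and> real q < real p powr (1/2 + \<epsilon>) \<and> quad_residue (int q) (int p)}) > real p powr (\<epsilon> / 25)"
      using p r K by (intro P1[of p b "int a" c K]) (auto simp: r_def)
  qed
qed

theorem theorem3:
  fixes \<epsilon> :: real
  assumes "0 < \<epsilon>" and "\<epsilon> \<le> 1/2"
  shows "\<exists>p0::real. \<forall>p::nat. prime p \<and> real p > p0 \<longrightarrow>
           real (card {q::nat. prime q \<and> real q < real p powr (1/2 + \<epsilon>) \<and>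
                               quad_residue (int q) (int p)})
             > real p powr (\<epsilon> / 25)"
proof -
  obtain P1 where P1: "\<And>p. prime p \<Longrightarrow> p mod 4 = 1 \<Longrightarrow> real p \<ge> P1 \<Longrightarrow>
     real (card {q. prime q \<and> real q < real p powr (1/2 + \<epsilon>) \<and> quad_residue (int q) (int p)}) > real p powr (\<epsilon> / 25)"
    using residues_1_mod_4[OF assms] by blast
  obtain P3 where P3: "\<And>p. prime p \<Longrightarrow> p mod 4 = 3 \<Longrightarrow> real p \<ge> P3 \<Longrightarrow>
     real (card {q. prime q \<and> real q < real p powr (1/2 + \<epsilon>) \<and> quad_residue (int q) (int p)}) > real p powr (\<epsilon> / 25)"
    using residues_3_mod_4[OF assms] by blast
  show ?thesis
  proof (intro exI[of _ "max 2 (max P1 P3)"] allI impI)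
    fix p :: nat assume p: "prime p \<and> real p > max 2 (max P1 P3)"
    hence "odd p" using prime_odd_nat[of p] by simp
    hence "p mod 4 = 1 \<or> p mod 4 = 3" by presburger
    thus "real (card {q::nat. prime q \<and> real q < real p powr (1/2 + \<epsilon>) \<and> quad_residue (int q) (int p)}) > real p powr (\<epsilon> / 25)"
      using P1[of p] P3[of p] p by auto
  qed
qed

end
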